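(* Let $n$ be a non-negative integer, let $p,q\in\mathbb{C}$ with $q\notin\{-1,-2,-3,\dots\}$, and let $\delta,\delta',\mu,\mu',\epsilon,\tau\in\mathbb{C}$ be such that $\Re(\epsilon)>0$ and $$\Re(\tau)>\max\{\Re(\mu),\ \Re(-\delta-\delta'+\epsilon),\ \Re(-\delta-\mu'+\epsilon)\}.$$ Assume that none of $\tau$, $\delta-\mu+\tau$, $\delta+\delta'+\mu'-\epsilon+\tau$ is a non-positive integer. Then for every $x>0$, $$\left(I_{-}^{\delta,\delta',\mu,\mu',\epsilon}\,t^{-\tau}M_n^{(p,q)}\left(\tfrac1t\right)\right)(x)=x^{-\delta-\delta'+\epsilon-\tau}\,\frac{(-1)^n\,\Gamma(q+n+1)\,\Gamma(\tau-\mu)\,\Gamma(\delta+\delta'-\epsilon+\tau)\,\Gamma(\delta+\mu'-\epsilon+\tau)}{\Gamma(\tau)\,\Gamma(q+1)\,\Gamma(\delta-\mu+\tau)\,\Gamma(\delta+\delta'+\mu'-\epsilon+\tau)}$$ $$\times\ {}_5F_4\left[\begin{array}{c}1+n-p,\ -n,\ -\mu+\tau,\ \delta+\delta'-\epsilon+\tau,\ \delta+\mu'-\epsilon+\tau\\ 1+q,\ \tau,\ \delta-\mu+\tau,\ \delta+\delta'+\mu'-\epsilon+\tau\end{array}\Big|\,-\frac1x\right].$$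
   Context: Pochhammer symbol: $(a)_0=1$, $(a)_k=a(a+1)\cdots(a+k-1)$. The generalized hypergeometric function is $${}_rF_s\left[\begin{array}{c}a_1,\dots,a_r\\ c_1,\dots,c_s\end{array}\Big|\,z\right]=\sum_{k=0}^\infty\frac{(a_1)_k\cdots(a_r)_k}{(c_1)_k\cdots(c_s)_k}\frac{z^k}{k!};$$ when one upper parameter is $-n$ with $n$ a non-negative integer (as here), the series is the finite sum over $0\le k\le n$ and is taken for all $z$. The Jacobi type orthogonal polynomial is $$M_n^{(p,q)}(x)=(-1)^n\,n!\sum_{k=0}^n\binom{p-n-1}{k}\binom{q+n}{n-k}(-x)^k,$$ where $\binom{a}{k}=a(a-1)\cdots(a-k+1)/k!$ for $a\in\mathbb{C}$. Appell's function is $F_3(a,a',b,b';c;X,Y)=\sum_{m,l\ge0}\frac{(a)_m(a')_l(b)_m(b')_l}{(c)_{m+l}\,m!\,l!}X^mY^l$ for $|X|,|Y|<1$, extended by analytic continuation to $(\mathbb{C}\setminus[1,\infty))^2$. The (right-sided) Marichev-Saigo-Maeda fractional integral, for $\Re(\epsilon)>0$ and $x>0$, is $$\left(I_{-}^{\delta,\delta',\mu,\mu',\epsilon}f\right)(x)=\frac{x^{-\delta'}}{\Gamma(\epsilon)}\int_x^\infty(t-x)^{\epsilon-1}t^{-\delta}F_3\left(\delta,\delta',\mu,\mu';\epsilon;1-\frac xt,1-\frac tx\right)f(t)\,dt.$$ Here $(I f(t))(x)$ means the operator applied to the function $t\mapsto f(t)$, evaluated at $x$. *)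

theory Defs
  imports "HOL-Complex_Analysis.Complex_Analysis"
begin

definition hypergeo :: "complex list \<Rightarrow> complex list \<Rightarrow> complex \<Rightarrow> complex" where
  "hypergeo as cs z = eval_fps (fps_hypergeo as cs 1) z"

lemma hypergeo_altdef:
  "hypergeo as cs z =
     (\<Sum>k. (\<Prod>a\<leftarrow>as. pochhammer a k) / (\<Prod>c\<leftarrow>cs. pochhammer c k) * z ^ k / fact k)"
proof -
  have 1: "foldl (\<lambda>r a. r * pochhammer a k) s xs = s * (\<Prod>a\<leftarrow>xs. pochhammer a k)"
    for k xs and s :: complex
    by (induction xs arbitrary: s) (auto simp: mult_ac)
  show ?thesis
    unfolding hypergeo_def eval_fps_def by (simp add: 1 field_simps)
qed

lemma hypergeo_terminating:
  "hypergeo (as @ - of_nat n # bs) cs z =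
     (\<Sum>k\<le>n. (\<Prod>a\<leftarrow>as @ - of_nat n # bs. pochhammer a k) / (\<Prod>c\<leftarrow>cs. pochhammer c k)
               * z ^ k / fact k)"
  unfolding hypergeo_altdef
  by (rule suminf_finite) (auto simp: pochhammer_of_nat_eq_0_iff)

definition jacobi_M :: "nat \<Rightarrow> complex \<Rightarrow> complex \<Rightarrow> complex \<Rightarrow> complex" where
  "jacobi_M n p q x =
     (-1) ^ n * fact n *
     (\<Sum>k\<le>n. ((p - of_nat n - 1) gchoose k) * ((q + of_nat n) gchoose (n - k)) * (- x) ^ k)"

definition appell_F3_series ::
    "complex \<Rightarrow> complex \<Rightarrow> complex \<Rightarrow> complex \<Rightarrow> complex \<Rightarrow> complex \<Rightarrow> complex \<Rightarrow> complex" where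
  "appell_F3_series a a' b b' c X Y =
     (\<Sum>\<^sub>\<infinity>(m, l)\<in>UNIV.
        pochhammer a m * pochhammer a' l * pochhammer b m * pochhammer b' l /
        (pochhammer c (m + l) * fact m * fact l) * X ^ m * Y ^ l)"

definition cut_plane :: "complex set" where
  "cut_plane = - (complex_of_real ` {1..})"

(* Holomorphy of a function of two complex variables on a product of open sets:
   joint continuity together with holomorphy in each variable (Osgood). *)
definition holomorphic2_on :: "(complex \<Rightarrow> complex \<Rightarrow> complex) \<Rightarrow> complex set \<Rightarrow> complex set \<Rightarrow> bool" where
  "holomorphic2_on G U V \<longleftrightarrow>
     continuous_on (U \<times> V) (\<lambda>(X, Y). G X Y) \<and>
     (\<forall>Y\<in>V. (\<lambda>X. G X Y) holomorphic_on U) \<and>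
     (\<forall>X\<in>U. (\<lambda>Y. G X Y) holomorphic_on V)"

definition appell_F3_continuation ::
    "complex \<Rightarrow> complex \<Rightarrow> complex \<Rightarrow> complex \<Rightarrow> complex \<Rightarrow> (complex \<Rightarrow> complex \<Rightarrow> complex) \<Rightarrow> bool" where
  "appell_F3_continuation a a' b b' c G \<longleftrightarrow>
     holomorphic2_on G cut_plane cut_plane \<and>
     (\<forall>X Y. norm X < 1 \<longrightarrow> norm Y < 1 \<longrightarrow> G X Y = appell_F3_series a a' b b' c X Y)"

(* The continuation is unique on the doubly cut domain only, hence the description
   of its value at a point rather than of the function; see appell_F3_eqI. *)
definition appell_F3 ::
    "complex \<Rightarrow> complex \<Rightarrow> complex \<Rightarrow> complex \<Rightarrow> complex \<Rightarrow> complex \<Rightarrow> complex \<Rightarrow> complex" where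
  "appell_F3 a a' b b' c X Y =
     (THE w. \<exists>G. appell_F3_continuation a a' b b' c G \<and> w = G X Y)"

lemma cut_plane_iff: "z \<in> cut_plane \<longleftrightarrow> \<not> (Im z = 0 \<and> Re z \<ge> 1)"
  unfolding cut_plane_def by (auto simp: image_iff complex_eq_iff)

lemma ball_subset_cut_plane: "ball 0 1 \<subseteq> cut_plane"
proof
  fix z :: complex assume "z \<in> ball 0 1"
  with complex_Re_le_cmod[of z] show "z \<in> cut_plane" by (auto simp: cut_plane_iff)
qed

lemma open_cut_plane: "open cut_plane"
proof -
  have "cut_plane = - ({z. Im z = 0} \<inter> {z. Re z \<ge> 1})" by (auto simp: cut_plane_iff)
  moreover have "closed ({z. Im z = 0} \<inter> {z. Re z \<ge> 1})"
    by (intro closed_Int closed_Collect_eq closed_Collect_le continuous_intros)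
  ultimately show ?thesis by (metis open_Compl)
qed

lemma connected_cut_plane: "connected cut_plane"
proof (rule starlike_imp_connected)
  have "(1 - u) *\<^sub>R 0 + u *\<^sub>R z \<in> cut_plane" if "z \<in> cut_plane" "0 \<le> u" "u \<le> 1" for u and z :: complex
  proof (cases "Im z = 0 \<and> u \<noteq> 0")
    case True
    hence "Re z < 1" using that by (auto simp: cut_plane_iff)
    hence "u * Re z < u * 1" using that True by (intro mult_strict_left_mono) auto
    hence "u * Re z < 1" using that by linarith
    thus ?thesis by (auto simp: cut_plane_iff)
  qed (auto simp: cut_plane_iff)
  thus "starlike cut_plane"
    unfolding starlike_def
    by (intro bexI[of _ 0]) (auto simp: closed_segment_def cut_plane_iff)
qed

lemma appell_F3_continuation_unique:
  assumes "appell_F3_continuation a a' b b' c G" "appell_F3_continuation a a' b b' c H"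
  assumes X: "X \<in> cut_plane" and Y: "Y \<in> cut_plane"
  shows "G X Y = H X Y"
proof -
  have *: "f z = g z" if "f holomorphic_on cut_plane" "g holomorphic_on cut_plane"
    "\<And>w. norm w < 1 \<Longrightarrow> f w = g w" "z \<in> cut_plane" for f g z
  proof -
    show ?thesis
      by (rule analytic_continuation_open[of "ball 0 1" cut_plane f g])
         (use that in \<open>simp_all add: ball_subset_cut_plane open_cut_plane connected_cut_plane\<close>)
  qed
  have GH: "(\<lambda>X. G X Y') holomorphic_on cut_plane" "(\<lambda>Y. G X' Y) holomorphic_on cut_plane"
      "(\<lambda>X. H X Y') holomorphic_on cut_plane" "(\<lambda>Y. H X' Y) holomorphic_on cut_plane"
    if "X' \<in> cut_plane" "Y' \<in> cut_plane" for X' Y'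
    using assms(1,2) that unfolding appell_F3_continuation_def holomorphic2_on_def by blast+
  have small: "G X Y' = H X Y'" if Y': "norm Y' < 1" for Y'
  proof (rule *[of "\<lambda>X. G X Y'" "\<lambda>X. H X Y'"])
    have "Y' \<in> cut_plane" using Y' ball_subset_cut_plane by auto
    thus "(\<lambda>X. G X Y') holomorphic_on cut_plane" "(\<lambda>X. H X Y') holomorphic_on cut_plane"
      using GH X by blast+
    show "G X' Y' = H X' Y'" if "norm X' < 1" for X'
      using assms(1,2) that Y' by (simp add: appell_F3_continuation_def)
  qed (fact X)
  show ?thesis
    by (rule *[of "G X" "H X"]) (use GH[OF X Y] small Y in auto)
qed

lemma appell_F3_eqI:
  assumes "appell_F3_continuation a a' b b' c G" "X \<in> cut_plane" "Y \<in> cut_plane"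
  shows "appell_F3 a a' b b' c X Y = G X Y"
  unfolding appell_F3_def
  by (rule the_equality) (use assms appell_F3_continuation_unique in blast)+

definition MSM_integrand ::
    "complex \<Rightarrow> complex \<Rightarrow> complex \<Rightarrow> complex \<Rightarrow> complex \<Rightarrow> (real \<Rightarrow> complex) \<Rightarrow> real \<Rightarrow> real \<Rightarrow> complex" where
  "MSM_integrand \<delta> \<delta>' \<mu> \<mu>' \<epsilon> f x t =
     of_real (t - x) powr (\<epsilon> - 1) * of_real t powr (- \<delta>) *
     appell_F3 \<delta> \<delta>' \<mu> \<mu>' \<epsilon> (of_real (1 - x / t)) (of_real (1 - t / x)) * f t"

definition MSM_right ::
    "complex \<Rightarrow> complex \<Rightarrow> complex \<Rightarrow> complex \<Rightarrow> complex \<Rightarrow> (real \<Rightarrow> complex) \<Rightarrow> real \<Rightarrow> complex" where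
  "MSM_right \<delta> \<delta>' \<mu> \<mu>' \<epsilon> f x =
     of_real x powr (- \<delta>') / Gamma \<epsilon> *
     (LINT t:{x<..}|lborel. MSM_integrand \<delta> \<delta>' \<mu> \<mu>' \<epsilon> f x t)"

(* A set integral of a non-integrable function is 0 by convention, so the existence of the
   operator at a point has to be asserted separately from its value. *)
definition MSM_right_exists ::
    "complex \<Rightarrow> complex \<Rightarrow> complex \<Rightarrow> complex \<Rightarrow> complex \<Rightarrow> (real \<Rightarrow> complex) \<Rightarrow> real \<Rightarrow> bool" where
  "MSM_right_exists \<delta> \<delta>' \<mu> \<mu>' \<epsilon> f x \<longleftrightarrow>
     set_integrable lborel {x<..} (MSM_integrand \<delta> \<delta>' \<mu> \<mu>' \<epsilon> f x)"

end

theory Submission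
  imports Defs "HOL-Real_Asymp.Real_Asymp"
begin

text \<open>Since \<open>M\<^sub>n(1/t)\<close> is a polynomial in \<open>1/t\<close>, the theorem is the sum over \<open>k \<le> n\<close> of the
formula for the single powers \<open>t\<^bsup>-\<tau>-k\<^esup>\<close>; the Gamma quotients of the summands differ by Pochhammer symbols,
and these make up the terms of the hypergeometric sum.

For one power, put \<open>T = \<delta> + \<tau>\<close> and \<open>t = x(1 + W)\<close>. The integral becomes a power of \<open>x\<close> times
the integral over \<open>W > 0\<close> of \<open>W\<^bsup>c-1\<^esup> (1 + W)\<^bsup>-T\<^esup> F\<^sub>3(a, a', b, b'; c; W/(1 + W), -W)\<close>, where \<open>a, a', b, b', c\<close>
stand for \<open>\<delta>, \<delta>', \<mu>, \<mu>', \<epsilon>\<close>. The claim is that this integral is a quotient of six Gamma values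
(\<open>MSM_kernel_integral\<close>), as soon as \<open>c\<close>, \<open>T - a - b\<close>, \<open>T + a' - c\<close> and \<open>T + b' - c\<close> have positive real part.

The argument \<open>-W\<close> leaves the unit disc, so the analytic continuation of \<open>F\<^sub>3\<close> has to be constructed.
If \<open>b\<close>, \<open>b'\<close> and \<open>c - b - b'\<close> have positive real part, it is given by an Euler double integral of
\<open>(1 - rX)\<^bsup>-a\<^esup> (1 - r'Y)\<^bsup>-a'\<^esup>\<close> with \<open>r, r' \<in> [0, 1]\<close>. Three contiguous relations (\<open>F3_series_raise_c\<close>,
\<open>F3_series_raise_b\<close>, \<open>F3_series_raise_b'\<close>) write \<open>F\<^sub>3\<close> in terms of functions \<open>F\<^sub>3\<close> for which \<open>c - b - b'\<close>, \<open>b\<close> or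
\<open>b'\<close> is larger by one, and induction gives the continuation whenever \<open>c\<close> has positive real part.

The same two steps evaluate the integral. In the range of the Euler integral, interchanging the
integrations leaves three successive Beta integrals (\<open>Beta_kernel_composition\<close>, used twice, and one
Beta integral on the half-line), and these converge under exactly the conditions above. The contiguous
relations then extend the result. They have been chosen so that, multiplied by \<open>W\<^bsup>c-1\<^esup> (1 + W)\<^bsup>-T\<^esup>\<close>,
each of their terms is again such an integrand, with parameters that satisfy the same conditions; hence
convergence never has to be read off the behaviour of \<open>F\<^sub>3\<close> at infinity. The relations that raise \<open>b\<close> and
\<open>b'\<close> reduce the formula to cases already known. The relation that raises \<open>c\<close> only yields the
difference of the integrands at \<open>T\<close> and \<open>T + 1\<close>; hence integral and Gamma quotient agree up to a
function of \<open>T\<close> with period one, and that function vanishes because both sides tend to zero along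
\<open>T, T + 1, T + 2, \<dots>\<close>.\<close>

section \<open>Complex powers on the positive half-line\<close>

text \<open>Extending the power by zero to the negative half-line lets the integrands of all Beta integrals carry their
own domain of integration: \<open>ppow (d - 1) v * ppow (e - 1) (1 - v)\<close> lives on the unit interval and
\<open>ppow (d - 1) Z * ppow s (1 + Z)\<close> on the positive half-line, so that all integrals can be taken over
the whole line.\<close>
definition ppow :: "complex \<Rightarrow> real \<Rightarrow> complex" where
  "ppow z t = (if t > 0 then of_real t powr z else 0)"

lemma ppow_nonpos [simp]: "t \<le> 0 \<Longrightarrow> ppow z t = 0"
  by (simp add: ppow_def)

lemma ppow_1 [simp]: "ppow z 1 = 1"
  by (simp add: ppow_def)

lemma ppow_zero: "t > 0 \<Longrightarrow> ppow 0 t = 1"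
  by (simp add: ppow_def)

lemma ppow_nonzero: "t > 0 \<Longrightarrow> ppow z t \<noteq> 0"
  by (simp add: ppow_def powr_def)

lemma ppow_add: "ppow (z + w) t = ppow z t * ppow w t"
  by (simp add: ppow_def powr_add)

lemma ppow_mult: "s > 0 \<Longrightarrow> t > 0 \<Longrightarrow> ppow z (s * t) = ppow z s * ppow z t"
  by (simp add: ppow_def powr_times_real)

lemma ppow_minus: "ppow (- z) t = inverse (ppow z t)"
  by (simp add: ppow_def powr_minus)

lemma ppow_divide: "s > 0 \<Longrightarrow> t > 0 \<Longrightarrow> ppow z (s / t) = ppow z s * ppow (- z) t"
  using ppow_mult[of t "s / t" z] ppow_nonzero[of t z]
  by (simp add: ppow_minus field_simps)

lemma ppow_of_nat: "t > 0 \<Longrightarrow> ppow (of_nat k) t = of_real t ^ k"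
  by (simp add: ppow_def powr_nat')

lemma ppow_one: "t > 0 \<Longrightarrow> ppow 1 t = of_real t"
  by (simp add: ppow_def)

text \<open>The modulus of a power is again a power. Every integral formula for complex exponents thus contains the
formula for its absolute value, which is what the integrability conditions of Fubini's theorem ask for.\<close>
lemma of_real_norm_ppow: "of_real (norm (ppow z t)) = ppow (of_real (Re z)) t"
  by (simp add: ppow_def norm_powr_real_powr powr_of_real)

lemma ppow_measurable [measurable]: "ppow z \<in> borel_measurable borel"
proof -
  have "ppow z = (\<lambda>t. if t > 0 then exp (z * of_real (ln t)) else 0)"
    by (auto simp: ppow_def powr_def Ln_of_real)
  thus ?thesis by simp
qed

lemma continuous_on_ppow [continuous_intros]:
  assumes "continuous_on A f" "\<And>x. x \<in> A \<Longrightarrow> f x > 0"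
  shows "continuous_on A (\<lambda>x. ppow z (f x))"
proof -
  have "continuous_on A (\<lambda>x. of_real (f x) powr z)"
    using assms by (intro continuous_intros) (force intro: less_imp_le)+
  thus ?thesis
    by (rule continuous_on_eq) (use assms in \<open>auto simp: ppow_def\<close>)
qed

lemma not_nonpos_Int_of_Re_pos: "Re z > 0 \<Longrightarrow> z \<notin> \<int>\<^sub>\<le>\<^sub>0"
  by (auto elim!: nonpos_Ints_cases)

lemma Gamma_nonzero_of_Re_pos: "Re z > 0 \<Longrightarrow> Gamma z \<noteq> 0"
  using not_nonpos_Int_of_Re_pos by (simp add: Gamma_eq_zero_iff)

section \<open>Beta integrals\<close>

lemma has_bochner_integral_Fubini_swap:
  fixes f :: "real \<Rightarrow> real \<Rightarrow> complex"
  assumes [measurable]: "case_prod f \<in> borel_measurable (lborel \<Otimes>\<^sub>M lborel)"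
    and inner: "\<And>x. has_bochner_integral lborel (f x) (g x)"
    and inner_norm: "\<And>x. has_bochner_integral lborel (\<lambda>y. norm (f x y)) (h x)"
    and outer: "has_bochner_integral lborel g v"
    and outer_norm: "integrable lborel h"
  shows "integrable (lborel \<Otimes>\<^sub>M lborel) (case_prod f)"
    and "has_bochner_integral lborel (\<lambda>y. LINT x|lborel. f x y) v"
proof -
  have eq: "(\<lambda>x. LINT y|lborel. f x y) = g" "(\<lambda>x. LINT y|lborel. norm (f x y)) = h"
    using inner inner_norm by (auto simp: has_bochner_integral_iff)
  show *: "integrable (lborel \<Otimes>\<^sub>M lborel) (case_prod f)"
  proof (rule lborel_pair.Fubini_integrable)
    show "integrable lborel (\<lambda>x. LINT y|lborel. norm (case (x, y) of (x, y) \<Rightarrow> f x y))"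
      using outer_norm eq by simp
    show "AE x in lborel. integrable lborel (\<lambda>y. case (x, y) of (x, y) \<Rightarrow> f x y)"
      using inner by (simp add: has_bochner_integral_iff)
  qed simp
  have "(LINT y|lborel. LINT x|lborel. f x y) = (LINT x|lborel. LINT y|lborel. f x y)"
    using lborel_pair.Fubini_integral[of f] * by simp
  thus "has_bochner_integral lborel (\<lambda>y. LINT x|lborel. f x y) v"
    using lborel_pair.integrable_snd[OF *] outer eq by (simp add: has_bochner_integral_iff)
qed

lemma absolutely_integrable_on_iff_has_bochner_integral:
  fixes f :: "real \<Rightarrow> complex"
  assumes [measurable]: "f \<in> borel_measurable borel" and "S \<in> sets borel" and "\<And>x. x \<notin> S \<Longrightarrow> f x = 0"
  shows "f absolutely_integrable_on S \<and> integral S f = v \<longleftrightarrow> has_bochner_integral lborel f v"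
proof -
  have "(\<lambda>x. indicator S x *\<^sub>R f x) = f"
    using assms(3) by (auto simp: indicator_def)
  thus ?thesis
    using set_lebesgue_integral_eq_integral(2)[of S f]
    by (auto simp: set_integrable_def set_lebesgue_integral_def has_bochner_integral_iff
          integrable_completion integral_completion)
qed

lemma has_bochner_integral_ppow_exp:
  assumes z: "Re z > 0" and A: "A > 0"
  shows "has_bochner_integral lborel (\<lambda>x. ppow (z - 1) x * of_real (exp (- (A * x))))
           (Gamma z * ppow (- z) A)"
proof -
  let ?f = "\<lambda>t. complex_of_real t powr (z - 1) / of_real (exp t)"
  let ?g = "\<lambda>t. ppow (z - 1) t * of_real (exp (- t))"
  have "set_integrable lebesgue {0<..} ?f"
    by (rule absolutely_integrable_Gamma_integral'[OF z])
  hence "?g absolutely_integrable_on {0<..}"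
    by (rule set_integrable_cong[THEN iffD1, rotated -1]) (auto simp: ppow_def exp_minus divide_inverse)
  moreover have "(?g has_integral Gamma z) {0<..}"
    using Gamma_integral_complex'[OF z]
    by (rule has_integral_eq[rotated]) (auto simp: ppow_def exp_minus divide_inverse)
  ultimately have 1: "has_bochner_integral lborel ?g (Gamma z)"
    by (subst absolutely_integrable_on_iff_has_bochner_integral[of _ "{0<..}", symmetric])
       (auto simp: integral_unique)
  have 2: "ppow (z - 1) x * of_real (exp (- (A * x))) =
      ppow (1 - z) A * (ppow (z - 1) (0 + A * x) * of_real (exp (- (0 + A * x))))" for x
  proof (cases "x > 0")
    case True
    thus ?thesis using A ppow_minus[of "z - 1" A] ppow_nonzero[of A "z-1"] by (simp add: ppow_mult)
  qed (use A in \<open>simp add: mult_nonneg_nonpos\<close>)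
  have "has_bochner_integral lborel (\<lambda>x. ppow (z - 1) (0 + A * x) * of_real (exp (- (0 + A * x))))
          (Gamma z /\<^sub>R \<bar>A\<bar>)"
    using 1 lborel_has_bochner_integral_real_affine_iff[of A _ "Gamma z" 0] A by simp
  from has_bochner_integral_mult_right[OF this, of "ppow (1 - z) A"]
  have "has_bochner_integral lborel (\<lambda>x. ppow (z - 1) x * of_real (exp (- (A * x))))
          (ppow (1 - z) A * (Gamma z /\<^sub>R \<bar>A\<bar>))"
    unfolding 2 [symmetric] .
  moreover have "ppow (1 - z) A = of_real A * ppow (- z) A"
    using ppow_add[of 1 "- z" A] A by (simp add: ppow_one)
  hence "ppow (1 - z) A * (Gamma z /\<^sub>R \<bar>A\<bar>) = Gamma z * ppow (- z) A"
    using A by (simp add: scaleR_conv_of_real)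
  ultimately show ?thesis by simp
qed

lemma has_bochner_integral_norm_ppow_exp:
  assumes z: "Re z > 0" and A: "A > 0"
  shows "has_bochner_integral lborel (\<lambda>x. norm (ppow (z - 1) x) * exp (- (A * x)))
           (Re (Gamma (of_real (Re z))) * norm (ppow (- z) A))"
proof -
  have "has_bochner_integral lborel (\<lambda>x. of_real (norm (ppow (z - 1) x) * exp (- (A * x))))
           (Gamma (of_real (Re z)) * of_real (norm (ppow (- z) A)) :: complex)"
    using has_bochner_integral_ppow_exp[of "of_real (Re z)" A] assms
    by (simp add: of_real_norm_ppow)
  from has_bochner_integral_Re[OF this] show ?thesis by simp
qed

text \<open>Writing \<open>\<Gamma>(d + e) (1 + Z)\<^bsup>-(d+e)\<^esup>\<close> as the Gamma integral of \<open>l\<^bsup>d+e-1\<^esup> e\<^bsup>-l(1+Z)\<^esup>\<close> and integrating over \<open>Z\<close> first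
leaves the Gamma integrals of \<open>d\<close> and \<open>e\<close>.\<close>
lemma has_bochner_integral_Beta_halfline_aux:
  assumes d: "Re d > 0" and e: "Re e > 0"
  shows "has_bochner_integral lborel (\<lambda>Z. ppow (d - 1) Z * ppow (- (d + e)) (1 + Z)) (Beta d e)"
proof -
  define f where "f = (\<lambda>l Z. ppow (d + e - 1) l * of_real (exp (- l)) *
                        (ppow (d - 1) Z * of_real (exp (- (l * Z)))))"
  have split: "ppow (d + e - 1) l * ppow (- d) l = ppow (e - 1) l" for l
    using ppow_add[of "d + e - 1" "-d" l] by (simp add: algebra_simps)
  have inner: "has_bochner_integral lborel (f l) (Gamma d * (ppow (e - 1) l * of_real (exp (- l))))" for l
  proof (cases "l > 0")
    case True
    from has_bochner_integral_mult_right[OF has_bochner_integral_ppow_exp[OF d True],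
         of "ppow (d + e - 1) l * of_real (exp (- l))"]
    show ?thesis unfolding f_def by (simp add: split [symmetric] mult_ac)
  qed (simp add: f_def has_bochner_integral_zero)
  have inner': "has_bochner_integral lborel (\<lambda>Z. norm (f l Z))
       (Re (Gamma (of_real (Re d))) * (norm (ppow (e - 1) l) * exp (- l)))" for l
  proof (cases "l > 0")
    case True
    from has_bochner_integral_mult_right[OF has_bochner_integral_norm_ppow_exp[OF d True],
         of "norm (ppow (d + e - 1) l) * exp (- l)"]
    show ?thesis unfolding f_def by (simp add: split [symmetric] norm_mult mult_ac)
  qed (simp add: f_def has_bochner_integral_zero)
  have [measurable]: "case_prod f \<in> borel_measurable (lborel \<Otimes>\<^sub>M lborel)"
    unfolding f_def by measurable
  have "has_bochner_integral lborel (\<lambda>Z. LINT l|lborel. f l Z) (Gamma d * Gamma e)"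
  proof (rule has_bochner_integral_Fubini_swap(2)[OF _ inner inner'])
    show "has_bochner_integral lborel (\<lambda>l. Gamma d * (ppow (e - 1) l * of_real (exp (- l)))) (Gamma d * Gamma e)"
      using has_bochner_integral_mult_right[OF has_bochner_integral_ppow_exp[OF e, of 1], of "Gamma d"] by simp
    show "integrable lborel (\<lambda>l. Re (Gamma (of_real (Re d))) * (norm (ppow (e - 1) l) * exp (- l)))"
      using has_bochner_integral_mult_right[OF has_bochner_integral_norm_ppow_exp[OF e, of 1]]
      by (simp add: has_bochner_integral_iff)
  qed simp
  moreover have "(LINT l|lborel. f l Z) = Gamma (d + e) * (ppow (d - 1) Z * ppow (- (d + e)) (1 + Z))" for Z
  proof (cases "Z > 0")
    case True
    have "has_bochner_integral lborel (\<lambda>l. ppow (d - 1) Z *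
            (ppow (d + e - 1) l * of_real (exp (- ((1 + Z) * l)))))
            (ppow (d - 1) Z * (Gamma (d + e) * ppow (- (d + e)) (1 + Z)))"
      by (intro has_bochner_integral_mult_right has_bochner_integral_ppow_exp) (use d e True in auto)
    moreover have "(\<lambda>l. ppow (d - 1) Z * (ppow (d + e - 1) l * of_real (exp (- ((1 + Z) * l))))) = (\<lambda>l. f l Z)"
      by (auto simp: f_def mult_ac ring_distribs exp_add exp_minus exp_diff divide_inverse)
    ultimately have "has_bochner_integral lborel (\<lambda>l. f l Z)
            (ppow (d - 1) Z * (Gamma (d + e) * ppow (- (d + e)) (1 + Z)))" by (simp only:)
    thus ?thesis by (simp only: has_bochner_integral_integral_eq mult_ac)
  qed (simp add: f_def has_bochner_integral_zero)
  ultimately have "has_bochner_integral lborel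
     (\<lambda>Z. Gamma (d + e) * (ppow (d - 1) Z * ppow (- (d + e)) (1 + Z))) (Gamma d * Gamma e)" by simp
  from has_bochner_integral_mult_right[OF this, of "inverse (Gamma (d + e))"]
  have "has_bochner_integral lborel
     (\<lambda>Z. inverse (Gamma (d + e)) * (Gamma (d + e) * (ppow (d - 1) Z * ppow (- (d + e)) (1 + Z)))) (Beta d e)"
    by (simp add: Beta_def field_simps)
  moreover have "(\<lambda>Z. inverse (Gamma (d + e)) * (Gamma (d + e) * (ppow (d - 1) Z * ppow (- (d + e)) (1 + Z)))) =
      (\<lambda>Z. ppow (d - 1) Z * ppow (- (d + e)) (1 + Z))"
    using Gamma_nonzero_of_Re_pos[of "d + e"] d e by (simp add: fun_eq_iff)
  ultimately show ?thesis by (simp only:)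
qed

text \<open>The general linear form \<open>AZ + B\<close> reduces to \<open>1 + Z\<close> by scaling.\<close>
lemma has_bochner_integral_Beta_halfline:
  assumes d: "Re d > 0" and e: "Re e > 0" and A: "A > 0" and B: "B > 0"
  shows "has_bochner_integral lborel (\<lambda>Z. ppow (d - 1) Z * ppow (- (d + e)) (A * Z + B))
           (Beta d e * ppow (- d) A * ppow (- e) B)"
proof -
  let ?f = "\<lambda>Z. ppow (d - 1) Z * ppow (- (d + e)) (1 + Z)"
  let ?c = "ppow (1 - d) (A / B) * ppow (- (d + e)) B"
  have AB: "A / B > 0" using A B by simp
  have eq: "?c * ?f (0 + A / B * Z) = ppow (d - 1) Z * ppow (- (d + e)) (A * Z + B)" for Z
  proof (cases "Z > 0")
    case True
    have "A * Z + B = B * (1 + A / B * Z)" using B by (simp add: field_simps)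
    moreover have "1 + A / B * Z > 0" using mult_pos_pos[OF AB True] by linarith
    ultimately have "ppow (- (d + e)) (A * Z + B) = ppow (- (d + e)) B * ppow (- (d + e)) (1 + A / B * Z)"
      using B by (simp only: ppow_mult)
    moreover have "ppow (1 - d) (A / B) * ppow (d - 1) (A / B) = 1"
      using AB by (simp flip: ppow_add add: ppow_zero)
    moreover have "ppow (d - 1) (A / B * Z) = ppow (d - 1) (A / B) * ppow (d - 1) Z"
      by (rule ppow_mult) (use AB True in auto)
    ultimately show ?thesis by (simp add: mult_ac)
  next
    case False
    hence "A / B * Z \<le> 0" using AB by (intro mult_nonneg_nonpos) auto
    thus ?thesis using False by simp
  qed
  have "has_bochner_integral lborel (\<lambda>Z. ?f (0 + A / B * Z)) (Beta d e /\<^sub>R \<bar>A / B\<bar>)"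
    by (rule lborel_has_bochner_integral_real_affine_iff[THEN iffD1, OF _ has_bochner_integral_Beta_halfline_aux[OF d e]])
       (use A B in simp)
  from has_bochner_integral_mult_right[OF this, of ?c]
  have "has_bochner_integral lborel (\<lambda>Z. ppow (d - 1) Z * ppow (- (d + e)) (A * Z + B))
          (?c * (Beta d e /\<^sub>R \<bar>A / B\<bar>))"
    unfolding eq .
  moreover have "?c * (Beta d e /\<^sub>R \<bar>A / B\<bar>) = Beta d e * ppow (- d) A * ppow (- e) B"
  proof -
    have "ppow (1 - d) (A / B) = of_real (A / B) * (ppow (- d) A * ppow d B)"
      using ppow_add[of 1 "- d" "A / B"] AB A B ppow_divide[of A B "-d"] by (simp add: ppow_one)
    moreover have "ppow d B * ppow (- (d + e)) B = ppow (- e) B"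
      by (simp flip: ppow_add)
    ultimately show ?thesis
      using A B by (simp add: scaleR_conv_of_real mult_ac)
  qed
  ultimately show ?thesis by simp
qed

text \<open>Feynman's parametrisation of the Beta integral; it is the integral on the half-line after the substitution
\<open>v = Z / (1 + Z)\<close>.\<close>
lemma has_bochner_integral_Beta_interval:
  assumes d: "Re d > 0" and e: "Re e > 0" and A: "A > 0" and B: "B > 0"
  shows "has_bochner_integral lborel
           (\<lambda>v. ppow (d - 1) v * ppow (e - 1) (1 - v) * ppow (- (d + e)) (A * v + B * (1 - v)))
           (Beta d e * ppow (- d) A * ppow (- e) B)"
    (is "has_bochner_integral lborel ?f ?v")
proof -
  let ?g = "\<lambda>Z::real. Z / (1 + Z)"
  let ?g' = "\<lambda>Z::real. 1 / (1 + Z)^2"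
  let ?S = "{0<..} :: real set"
  let ?F = "\<lambda>Z. ppow (d - 1) Z * ppow (- (d + e)) (A * Z + B)"
  have img: "?g ` ?S = {0<..<1}"
  proof (intro equalityI subsetI)
    fix v :: real assume v: "v \<in> {0<..<1}"
    hence "v = ?g (v / (1 - v))" by (simp add: field_simps)
    thus "v \<in> ?g ` ?S" using v by (intro image_eqI[of _ _ "v / (1 - v)"]) auto
  qed auto
  have inj: "inj_on ?g ?S"
    by (rule inj_onI) (auto simp: divide_simps algebra_simps split: if_splits)
  have der: "(?g has_field_derivative ?g' Z) (at Z within ?S)" if "Z \<in> ?S" for Z
    using that by (auto intro!: derivative_eq_intros simp: field_simps power2_eq_square)
  have sub: "\<bar>?g' Z\<bar> *\<^sub>R ?f (?g Z) = ?F Z" if "Z \<in> ?S" for Z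
  proof -
    have Z: "Z > 0" using that by simp
    have 1: "1 - ?g Z = 1 / (1 + Z)" using Z by (simp add: field_simps)
    have 2: "A * ?g Z + B * (1 - ?g Z) = (A * Z + B) / (1 + Z)" using Z by (simp add: 1 add_divide_distrib)
    have 3: "A * Z + B > 0" using A B Z by (simp add: add_pos_pos)
    have "\<bar>?g' Z\<bar> *\<^sub>R ?f (?g Z) = ppow (- 2) (1 + Z) * ?f (?g Z)"
      using Z ppow_of_nat[of "1 + Z" 2] by (simp add: scaleR_conv_of_real ppow_minus field_simps)
    also have "\<dots> = ppow (- 2) (1 + Z) * ppow (- (d - 1)) (1 + Z) * ppow (- (e - 1)) (1 + Z) *
                  ppow (- (- (d + e))) (1 + Z) * ?F Z"
    proof -
      have "ppow (- (d + e)) (A * ?g Z + B * (1 - ?g Z)) = ppow (- (d + e)) (A * Z + B) * ppow (- (- (d + e))) (1 + Z)"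
        unfolding 2 by (rule ppow_divide) (use Z 3 in auto)
      moreover have "ppow (e - 1) (1 - ?g Z) = ppow (- (e - 1)) (1 + Z)"
        unfolding 1 using ppow_divide[of 1 "1 + Z" "e - 1"] Z by simp
      moreover have "ppow (d - 1) (?g Z) = ppow (d - 1) Z * ppow (- (d - 1)) (1 + Z)"
        by (rule ppow_divide) (use Z in auto)
      ultimately show ?thesis by (simp only: mult_ac)
    qed
    also have "ppow (- 2) (1 + Z) * ppow (- (d - 1)) (1 + Z) * ppow (- (e - 1)) (1 + Z) *
                  ppow (- (- (d + e))) (1 + Z) = 1"
      using Z by (simp only: flip: ppow_add) (simp add: ppow_zero)
    finally show ?thesis by simp
  qed
  have "has_bochner_integral lborel ?F ?v" by (rule has_bochner_integral_Beta_halfline) fact+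
  hence F: "?F absolutely_integrable_on ?S" "integral ?S ?F = ?v"
    using absolutely_integrable_on_iff_has_bochner_integral[of ?F ?S ?v] by simp_all
  have "(\<lambda>Z. \<bar>?g' Z\<bar> *\<^sub>R ?f (?g Z)) absolutely_integrable_on ?S"
    using F(1) by (rule set_integrable_cong[THEN iffD1, rotated -1]) (use sub in auto)
  moreover have "integral ?S (\<lambda>Z. \<bar>?g' Z\<bar> *\<^sub>R ?f (?g Z)) = ?v"
    unfolding F(2)[symmetric] by (rule integral_cong) (use sub in auto)
  ultimately have f: "?f absolutely_integrable_on {0<..<1}" "integral {0<..<1} ?f = ?v"
    using has_absolute_integral_change_of_variables_real[OF _ der inj, of ?f ?v] img by auto
  have "?f v = 0" if "v \<notin> {0<..<1}" for v
    using that by (cases "v > 0") auto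
  thus ?thesis
    using f by (subst absolutely_integrable_on_iff_has_bochner_integral[of _ "{0<..<1}", symmetric]) simp_all
qed

corollary has_bochner_integral_Beta:
  assumes "Re d > 0" "Re e > 0"
  shows "has_bochner_integral lborel (\<lambda>v. ppow (d - 1) v * ppow (e - 1) (1 - v)) (Beta d e)"
  using has_bochner_integral_Beta_interval[OF assms, of 1 1] by simp

lemma has_bochner_integral_norm_Beta_interval:
  assumes d: "Re d > 0" and e: "Re e > 0" and A: "A > 0" and B: "B > 0"
  shows "has_bochner_integral lborel
           (\<lambda>v. norm (ppow (d - 1) v * ppow (e - 1) (1 - v) * ppow (- (d + e)) (A * v + B * (1 - v))))
           (Re (Beta (of_real (Re d)) (of_real (Re e))) * norm (ppow (- d) A * ppow (- e) B))"
proof -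
  have "has_bochner_integral lborel
           (\<lambda>v. of_real (norm (ppow (d - 1) v * ppow (e - 1) (1 - v) * ppow (- (d + e)) (A * v + B * (1 - v)))))
           (Beta (of_real (Re d)) (of_real (Re e)) * of_real (norm (ppow (- d) A * ppow (- e) B)) :: complex)"
    using has_bochner_integral_Beta_interval[of "of_real (Re d)" "of_real (Re e)" A B] assms
    by (simp add: of_real_norm_ppow norm_mult mult_ac)
  from has_bochner_integral_Re[OF this] show ?thesis by simp
qed

text \<open>Averaging \<open>h(sW)\<close> over \<open>s\<close> against a Beta density, and then integrating over \<open>W\<close> against a Beta density of the
second kind, only changes the exponents of the latter and produces a Beta factor. With \<open>Z = sW\<close> in place of
\<open>W\<close> and \<open>s\<close> as the inner variable, the inner integral is Feynman's with the linear form
\<open>(1 + Z)s + Z(1 - s) = s + Z\<close>. Integrability of the outer integrand is part of the statement because the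
operator has to be shown to exist.\<close>
lemma Beta_kernel_composition:
  assumes e: "Re e > 0" and \<sigma>: "Re (\<sigma> - e) > 0"
    and [measurable]: "h \<in> borel_measurable borel"
    and h: "has_bochner_integral lborel (\<lambda>Z. ppow (\<kappa> - e - 1) Z * ppow (e - \<sigma>) (1 + Z) * h Z) v"
  shows "has_bochner_integral lborel
           (\<lambda>W. ppow (\<kappa> - 1) W * ppow (- \<sigma>) (1 + W) *
                  (LINT s|lborel. ppow (\<kappa> - e - 1) s * ppow (e - 1) (1 - s) * h (s * W)))
           (Beta (\<sigma> - e) e * v)"
proof -
  define F where "F = (\<lambda>Z s. ppow (\<kappa> - 1) Z * h Z *
     (ppow ((\<sigma> - e) - 1) s * ppow (e - 1) (1 - s) * ppow (- ((\<sigma> - e) + e)) ((1 + Z) * s + Z * (1 - s))))"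
  define hZ where "hZ = (\<lambda>Z. ppow (\<kappa> - e - 1) Z * ppow (e - \<sigma>) (1 + Z) * h Z)"
  have split: "ppow (\<kappa> - 1) Z * h Z * (ppow (- (\<sigma> - e)) (1 + Z) * ppow (- e) Z) = hZ Z" for Z
    unfolding hZ_def using ppow_add[of "\<kappa> - 1" "-e" Z] by (simp add: algebra_simps)
  have inner: "has_bochner_integral lborel (F Z) (Beta (\<sigma> - e) e * hZ Z)" for Z
  proof (cases "Z > 0")
    case True
    hence "has_bochner_integral lborel (F Z) (ppow (\<kappa> - 1) Z * h Z *
             (Beta (\<sigma> - e) e * ppow (- (\<sigma> - e)) (1 + Z) * ppow (- e) Z))"
      unfolding F_def
      by (intro has_bochner_integral_mult_right has_bochner_integral_Beta_interval) (use e \<sigma> in auto)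
    thus ?thesis unfolding split [symmetric] by (simp only: mult_ac)
  qed (simp add: F_def hZ_def has_bochner_integral_zero)
  define b where "b = Re (Beta (of_real (Re (\<sigma> - e))) (of_real (Re e)))"
  have inner': "has_bochner_integral lborel (\<lambda>s. norm (F Z s)) (b * norm (hZ Z))" for Z
  proof (cases "Z > 0")
    case True
    hence "has_bochner_integral lborel (\<lambda>s. norm (F Z s)) (norm (ppow (\<kappa> - 1) Z * h Z) *
             (b * norm (ppow (- (\<sigma> - e)) (1 + Z) * ppow (- e) Z)))"
      unfolding F_def b_def norm_mult[of "ppow (\<kappa> - 1) Z * h Z"]
      by (intro has_bochner_integral_mult_right has_bochner_integral_norm_Beta_interval) (use e \<sigma> in auto)
    thus ?thesis unfolding split [symmetric] by (simp only: mult_ac norm_mult)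
  qed (simp add: F_def hZ_def has_bochner_integral_zero)
  have [measurable]: "case_prod F \<in> borel_measurable (lborel \<Otimes>\<^sub>M lborel)"
    unfolding F_def by measurable
  have "has_bochner_integral lborel (\<lambda>Z. Beta (\<sigma> - e) e * hZ Z) (Beta (\<sigma> - e) e * v)"
    using h unfolding hZ_def by (rule has_bochner_integral_mult_right)
  moreover have "integrable lborel (\<lambda>Z. b * norm (hZ Z))"
    using h unfolding hZ_def has_bochner_integral_iff by auto
  ultimately have F: "integrable (lborel \<Otimes>\<^sub>M lborel) (case_prod F)"
      "has_bochner_integral lborel (\<lambda>s. LINT Z|lborel. F Z s) (Beta (\<sigma> - e) e * v)"
    using has_bochner_integral_Fubini_swap[of F, OF _ inner inner'] by auto

  \<comment> \<open>\<open>F\<close> after the substitution \<open>Z = sW\<close>; the summand \<open>0\<close> matches the affine form of the substitution rule.\<close>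
  define F' where "F' = (\<lambda>s W. of_real s * F (0 + s * W) s)"
  have F'_0: "F' s W = 0" if "s \<le> 0" for s W using that by (simp add: F'_def F_def)
  have F_0: "F Z s = 0" if "s \<le> 0" for s Z using that by (simp add: F_def)
  have [measurable]: "case_prod F' \<in> borel_measurable (lborel \<Otimes>\<^sub>M lborel)"
    unfolding F'_def F_def by measurable
  have int: "(LINT W|lborel. F' s W) = (LINT Z|lborel. F Z s)" for s
    using lborel_integral_real_affine[of s "\<lambda>Z. F Z s" 0]
    by (cases "s > 0") (auto simp: F'_def F_0 scaleR_conv_of_real)
  have int': "(LINT W|lborel. norm (F' s W)) = (LINT Z|lborel. norm (F Z s))" for s
    using lborel_integral_real_affine[of s "\<lambda>Z. norm (F Z s)" 0]
    by (cases "s > 0") (auto simp: F'_def F_0 norm_mult)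
  have "integrable (lborel \<Otimes>\<^sub>M lborel) (case_prod F')"
  proof (rule lborel_pair.Fubini_integrable)
    have "integrable (lborel \<Otimes>\<^sub>M lborel) (case_prod (\<lambda>Z s. norm (F Z s)))"
      using integrable_norm[OF F(1)] by (simp add: case_prod_unfold)
    from lborel_pair.integrable_snd[OF this]
    show "integrable lborel (\<lambda>s. LINT W|lborel. norm (case (s, W) of (s, W) \<Rightarrow> F' s W))"
      by (simp add: int')
    from lborel_pair.AE_integrable_snd[OF F(1)]
    show "AE s in lborel. integrable lborel (\<lambda>W. case (s, W) of (s, W) \<Rightarrow> F' s W)"
    proof eventually_elim
      case (elim s)
      show ?case
        using lborel_integrable_real_affine[OF elim, of s 0]
        by (cases "s > 0") (auto simp: F'_def F_0)
    qed
  qed simp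
  hence "has_bochner_integral lborel (\<lambda>W. LINT s|lborel. F' s W) (LINT s|lborel. LINT W|lborel. F' s W)"
    using lborel_pair.integrable_snd[of F'] lborel_pair.Fubini_integral[of F']
    by (simp add: has_bochner_integral_iff)
  hence "has_bochner_integral lborel (\<lambda>W. LINT s|lborel. F' s W) (Beta (\<sigma> - e) e * v)"
    using F(2) by (simp add: int has_bochner_integral_iff)
  moreover have "F' s W = ppow (\<kappa> - 1) W * ppow (- \<sigma>) (1 + W) *
       (ppow (\<kappa> - e - 1) s * ppow (e - 1) (1 - s) * h (s * W))" for s W
  proof (cases "s > 0 \<and> W > 0")
    case True
    hence s: "s > 0" and W: "W > 0" "1 + W > 0" by auto
    have "(1 + (0 + s * W)) * s + (0 + s * W) * (1 - s) = s * (1 + W)" by (simp add: algebra_simps)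
    hence 1: "ppow (- (\<sigma> - e + e)) ((1 + (0 + s * W)) * s + (0 + s * W) * (1 - s)) =
        ppow (- \<sigma>) s * ppow (- \<sigma>) (1 + W)"
      using s W by (simp only: ppow_mult) simp
    have "F' s W = (ppow 1 s * ppow (\<kappa> - 1) s * ppow (\<sigma> - e - 1) s * ppow (- \<sigma>) s) *
            (ppow (\<kappa> - 1) W * ppow (- \<sigma>) (1 + W) * (ppow (e - 1) (1 - s) * h (s * W)))"
      unfolding F'_def F_def 1 using s W by (simp add: ppow_mult ppow_one mult_ac)
    also have "ppow 1 s * ppow (\<kappa> - 1) s * ppow (\<sigma> - e - 1) s * ppow (- \<sigma>) s = ppow (\<kappa> - e - 1) s"
      by (simp only: flip: ppow_add) (simp add: algebra_simps)
    finally show ?thesis by (simp only: mult_ac)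
  next
    case False
    thus ?thesis by (cases "s > 0") (auto simp: F'_def F_def mult_nonneg_nonpos)
  qed
  ultimately show ?thesis by simp
qed

section \<open>The series of Appell's function and its contiguous relations\<close>

definition F3_coeff ::
    "complex \<Rightarrow> complex \<Rightarrow> complex \<Rightarrow> complex \<Rightarrow> complex \<Rightarrow> nat \<Rightarrow> nat \<Rightarrow> complex" where
  "F3_coeff a a' b b' c m l =
     pochhammer a m * pochhammer a' l * pochhammer b m * pochhammer b' l /
       (pochhammer c (m + l) * fact m * fact l)"

lemma appell_F3_series_altdef:
  "appell_F3_series a a' b b' c X Y = (\<Sum>\<^sub>\<infinity>(m, l)\<in>UNIV. F3_coeff a a' b b' c m l * X ^ m * Y ^ l)"
  by (simp add: appell_F3_series_def F3_coeff_def)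

text \<open>Ratio test: the quotients of successive terms are bounded by quantities tending to \<open>r < 1\<close>.\<close>
lemma summable_hypergeo_2F1_norm:
  fixes a b :: complex and \<gamma> r :: real
  assumes \<gamma>: "\<gamma> > 0" and r: "0 \<le> r" "r < 1"
  shows "summable (\<lambda>m. norm (pochhammer a m) * norm (pochhammer b m) / (pochhammer \<gamma> m * fact m) * r ^ m)"
    (is "summable ?f")
proof -
  have "((\<lambda>m. (norm a + real m) * (norm b + real m) * r / ((\<gamma> + real m) * (1 + real m))) \<longlongrightarrow> r) at_top"
    using \<gamma> by real_asymp
  moreover have "r < (1 + r) / 2" using r by simp
  ultimately have "eventually (\<lambda>m. (norm a + real m) * (norm b + real m) * r / ((\<gamma> + real m) * (1 + real m)) < (1 + r) / 2) at_top"
    by (rule order_tendstoD)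
  then obtain N where N: "\<And>m. m \<ge> N \<Longrightarrow>
      (norm a + real m) * (norm b + real m) * r / ((\<gamma> + real m) * (1 + real m)) < (1 + r) / 2"
    by (auto simp: eventually_at_top_linorder)
  show ?thesis
  proof (rule summable_ratio_test)
    show "(1 + r) / 2 < 1" using r by simp
    fix m assume "N \<le> m"
    have nonneg: "?f m \<ge> 0" for m
      using \<gamma> r by (intro mult_nonneg_nonneg divide_nonneg_nonneg) (auto simp: pochhammer_nonneg)
    have norm: "norm (a + of_nat m) \<le> norm a + real m" "norm (b + of_nat m) \<le> norm b + real m"
      by (metis norm_of_nat norm_triangle_ineq)+
    have abs: "norm (?f m) = ?f m" for m
      using nonneg[of m] unfolding real_norm_def by (rule abs_of_nonneg)
    have "norm (?f (Suc m)) = ?f (Suc m)" by (rule abs)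
    also have "\<dots> = (norm (a + of_nat m) * norm (b + of_nat m) * r / ((\<gamma> + real m) * (1 + real m))) * ?f m"
      by (simp add: pochhammer_Suc norm_mult mult_ac)
    also have "\<dots> \<le> ((norm a + real m) * (norm b + real m) * r / ((\<gamma> + real m) * (1 + real m))) * ?f m"
      using norm \<gamma> r nonneg by (intro mult_right_mono divide_right_mono mult_mono) auto
    also have "\<dots> \<le> (1 + r) / 2 * ?f m"
      using N[OF \<open>N \<le> m\<close>] nonneg by (intro mult_right_mono) auto
    finally show "norm (?f (Suc m)) \<le> (1 + r) / 2 * norm (?f m)" unfolding abs .
  qed
qed

lemma norm_pochhammer_ge:
  assumes "Re c > 0"
  shows "pochhammer (Re c) n \<le> norm (pochhammer c n)"
proof -
  have "Re c + real k \<le> norm (c + of_nat k)" for k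
    using complex_Re_le_cmod[of "c + of_nat k"] by simp
  thus ?thesis using assms
    by (auto simp: pochhammer_prod prod_norm [symmetric] intro!: prod_mono)
qed

lemma pochhammer_add_ge:
  fixes \<gamma> :: real
  assumes "\<gamma> > 0"
  shows "pochhammer \<gamma> m * pochhammer \<gamma> l \<le> pochhammer \<gamma> (m + l)"
proof -
  have "pochhammer \<gamma> l \<le> pochhammer (\<gamma> + real m) l"
    using assms by (auto simp: pochhammer_prod intro!: prod_mono)
  thus ?thesis using assms
    by (subst pochhammer_product'[of \<gamma> m l]) (intro mult_left_mono, auto simp: pochhammer_nonneg)
qed

lemma pochhammer_nonzero_of_Re_pos: "Re c > 0 \<Longrightarrow> pochhammer c n \<noteq> 0"
  using norm_pochhammer_ge[of c n] pochhammer_pos[of "Re c" n] by auto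

lemma add_of_nat_nonzero_of_Re_pos: "Re c > 0 \<Longrightarrow> c + of_nat n \<noteq> 0"
  by (auto simp: complex_eq_iff)

text \<open>Since \<open>\<bar>(c)\<^sub>m\<^sub>+\<^sub>l\<bar> \<ge> (Re c)\<^sub>m (Re c)\<^sub>l\<close>, the double series is dominated by a product of two Gauss series.\<close>
lemma F3_coeff_abs_summable:
  assumes c: "Re c > 0" and X: "norm X < 1" and Y: "norm Y < 1"
  shows "(\<lambda>ml. norm (case ml of (m, l) \<Rightarrow> F3_coeff a a' b b' c m l * X ^ m * Y ^ l)) summable_on UNIV"
proof -
  define g where "g = (\<lambda>m. norm (pochhammer a m) * norm (pochhammer b m) / (pochhammer (Re c) m * fact m) * norm X ^ m)"
  define h where "h = (\<lambda>l. norm (pochhammer a' l) * norm (pochhammer b' l) / (pochhammer (Re c) l * fact l) * norm Y ^ l)"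
  have nonneg: "g m \<ge> 0" "h m \<ge> 0" for m
    using c by (auto simp: g_def h_def pochhammer_nonneg)
  have sg: "g summable_on UNIV" and sh: "h summable_on UNIV"
  proof -
    have "summable g" "summable h"
      unfolding g_def h_def using c X Y by (intro summable_hypergeo_2F1_norm; simp)+
    thus "g summable_on UNIV" "h summable_on UNIV"
      using nonneg by (auto intro!: norm_summable_imp_summable_on)
  qed
  have "(\<lambda>(m, l). g m * h l) summable_on (SIGMA m:UNIV. UNIV)"
  proof (rule summable_on_SigmaI)
    show "((\<lambda>l. case (m, l) of (m, l) \<Rightarrow> g m * h l) has_sum (g m * infsum h UNIV)) UNIV" for m
      using has_sum_cmult_right[OF has_sum_infsum[OF sh], of "g m"] by simp
    show "(\<lambda>m. g m * infsum h UNIV) summable_on UNIV"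
      by (rule summable_on_cmult_left[OF sg])
  qed (use nonneg in auto)
  hence "(\<lambda>(m, l). g m * h l) summable_on UNIV" by simp
  thus ?thesis
  proof (rule Infinite_Sum.abs_summable_on_comparison_test')
    fix ml :: "nat \<times> nat"
    obtain m l where ml: "ml = (m, l)" by (cases ml)
    have pos: "0 < pochhammer (Re c) k" for k using c by (rule pochhammer_pos)
    have "pochhammer (Re c) m * pochhammer (Re c) l \<le> norm (pochhammer c (m + l))"
      using pochhammer_add_ge[OF c, of m l] norm_pochhammer_ge[OF c, of "m + l"] by simp
    hence "norm (F3_coeff a a' b b' c m l * X ^ m * Y ^ l) \<le>
        norm (pochhammer a m) * norm (pochhammer a' l) * norm (pochhammer b m) * norm (pochhammer b' l) /
         (pochhammer (Re c) m * pochhammer (Re c) l * fact m * fact l) * norm X ^ m * norm Y ^ l"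
      unfolding F3_coeff_def norm_mult norm_divide norm_power norm_fact
      by (intro mult_right_mono divide_left_mono mult_pos_pos mult_nonneg_nonneg pos)
         (use pos order.strict_trans2[OF mult_pos_pos[OF pos pos]] in \<open>auto simp: pochhammer_nonzero_of_Re_pos[OF c]\<close>)
    also have "\<dots> = g m * h l" by (simp add: g_def h_def mult_ac)
    finally show "norm (case ml of (m, l) \<Rightarrow> F3_coeff a a' b b' c m l * X ^ m * Y ^ l) \<le>
        (case ml of (m, l) \<Rightarrow> g m * h l)" by (simp add: ml)
  qed
qed

lemma has_sum_appell_F3_series:
  assumes "Re c > 0" "norm X < 1" "norm Y < 1"
  shows "((\<lambda>(m, l). F3_coeff a a' b b' c m l * X ^ m * Y ^ l) has_sum appell_F3_series a a' b b' c X Y) UNIV"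
  unfolding appell_F3_series_altdef
  using abs_summable_summable[OF F3_coeff_abs_summable[OF assms]] by (rule has_sum_infsum)

lemma has_sum_shift_fst:
  fixes X Y :: complex
  assumes "((\<lambda>(m, l). f m l * X ^ m * Y ^ l) has_sum S) UNIV"
  shows "((\<lambda>(m, l). (if m = 0 then 0 else f (m - 1) l) * X ^ m * Y ^ l) has_sum (X * S)) UNIV"
    (is "(?g has_sum _) _")
proof -
  let ?h = "\<lambda>(m, l::nat). (Suc m, l)"
  have "((\<lambda>ml. X * (case ml of (m, l) \<Rightarrow> f m l * X ^ m * Y ^ l)) has_sum (X * S)) UNIV"
    by (rule has_sum_cmult_right[OF assms])
  hence "((?g \<circ> ?h) has_sum (X * S)) UNIV"
    by (simp add: o_def case_prod_unfold mult_ac)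
  hence "(?g has_sum (X * S)) (range ?h)"
    by (subst has_sum_reindex) (auto simp: inj_on_def)
  also have "?this \<longleftrightarrow> (?g has_sum (X * S)) UNIV"
  proof (rule has_sum_cong_neutral)
    show "?g ml = 0" if "ml \<in> UNIV - range ?h" for ml
    proof -
      have "fst ml = 0" using that by (cases "fst ml") (auto simp: image_iff, metis prod.collapse)
      thus ?thesis by (simp add: case_prod_unfold)
    qed
  qed auto
  finally show ?thesis .
qed

lemma has_sum_shift_snd:
  fixes X Y :: complex
  assumes "((\<lambda>(m, l). f m l * X ^ m * Y ^ l) has_sum S) UNIV"
  shows "((\<lambda>(m, l). (if l = 0 then 0 else f m (l - 1)) * X ^ m * Y ^ l) has_sum (Y * S)) UNIV"
    (is "(?g has_sum _) _")
proof -
  let ?h = "\<lambda>(m::nat, l). (m, Suc l)"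
  have "((\<lambda>ml. Y * (case ml of (m, l) \<Rightarrow> f m l * X ^ m * Y ^ l)) has_sum (Y * S)) UNIV"
    by (rule has_sum_cmult_right[OF assms])
  hence "((?g \<circ> ?h) has_sum (Y * S)) UNIV"
    by (simp add: o_def case_prod_unfold mult_ac)
  hence "(?g has_sum (Y * S)) (range ?h)"
    by (subst has_sum_reindex) (auto simp: inj_on_def)
  also have "?this \<longleftrightarrow> (?g has_sum (Y * S)) UNIV"
  proof (rule has_sum_cong_neutral)
    show "?g ml = 0" if "ml \<in> UNIV - range ?h" for ml
    proof -
      have "snd ml = 0" using that by (cases "snd ml") (auto simp: image_iff, metis prod.collapse)
      thus ?thesis by (simp add: case_prod_unfold)
    qed
  qed auto
  finally show ?thesis .
qed

lemma pochhammer_shift: "z * pochhammer (z + 1) n = pochhammer z n * (z + of_nat n)"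
  for z :: "'a :: comm_ring_1"
  by (metis pochhammer_rec pochhammer_Suc)

text \<open>The contiguous relations are identities between coefficients; multiplication by \<open>X\<close> or \<open>Y\<close> shifts the
coefficients by one place.\<close>
lemma F3_series_raise_b':
  assumes c: "Re c > 0" and X: "norm X < 1" and Y: "norm Y < 1"
  shows "appell_F3_series a a' b b' c X Y =
     appell_F3_series a a' b (b' + 1) c X Y - a' / c * Y * appell_F3_series a (a' + 1) b (b' + 1) (c + 1) X Y"
proof -
  have c1: "Re (c + 1) > 0" using c by simp
  let ?f = "\<lambda>m l. F3_coeff a a' b (b' + 1) c m l -
        a' / c * (if l = 0 then 0 else F3_coeff a (a' + 1) b (b' + 1) (c + 1) m (l - 1))"
  have "((\<lambda>(m, l). ?f m l * X ^ m * Y ^ l) has_sum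
      (appell_F3_series a a' b (b' + 1) c X Y - a' / c * (Y * appell_F3_series a (a' + 1) b (b' + 1) (c + 1) X Y))) UNIV"
    using has_sum_add[OF has_sum_appell_F3_series[OF c X Y, of a a' b "b' + 1"]
        has_sum_cmult_right[OF has_sum_shift_snd[OF has_sum_appell_F3_series[OF c1 X Y, of a "a' + 1" b "b' + 1"]], of "- (a' / c)"]]
    by (simp add: case_prod_unfold ring_distribs mult_ac)
  moreover have "?f m l = F3_coeff a a' b b' c m l" for m l
  proof (cases l)
    case (Suc k)
    define A where "A = pochhammer a m * pochhammer b m / fact m"
    define P where "P = pochhammer (c + 1) (m + k)"
    define a1 where "a1 = pochhammer (a' + 1) k"
    define b1 where "b1 = pochhammer (b' + 1) k"
    have nz: "P \<noteq> 0" "c \<noteq> 0" "(of_nat (Suc k) :: complex) \<noteq> 0"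
      using pochhammer_nonzero_of_Re_pos[OF c1] c by (auto simp: P_def simp del: of_nat_Suc)
    have e: "F3_coeff a a' b b' c m (Suc k) = A * (a' * a1) * (b' * b1) / (c * P * (of_nat (Suc k) * fact k))"
            "F3_coeff a a' b (b' + 1) c m (Suc k) = A * (a' * a1) * (b1 * (b' + 1 + of_nat k)) / (c * P * (of_nat (Suc k) * fact k))"
            "F3_coeff a (a' + 1) b (b' + 1) (c + 1) m k = A * a1 * b1 / (P * fact k)"
      unfolding F3_coeff_def A_def P_def a1_def b1_def
      by (simp_all add: pochhammer_rec[of a'] pochhammer_rec[of b'] pochhammer_rec[of c] pochhammer_Suc[of "b' + 1"] mult_ac)
    show ?thesis
      unfolding Suc using nz by (simp add: e divide_simps) (simp add: algebra_simps)
  qed (simp add: F3_coeff_def)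
  ultimately have "((\<lambda>(m, l). F3_coeff a a' b b' c m l * X ^ m * Y ^ l) has_sum
      (appell_F3_series a a' b (b' + 1) c X Y - a' / c * (Y * appell_F3_series a (a' + 1) b (b' + 1) (c + 1) X Y))) UNIV"
    by simp
  from has_sum_unique[OF has_sum_appell_F3_series[OF c X Y] this] show ?thesis by simp
qed

text \<open>Relative to the coefficient with parameters \<open>a, a', b, b', c\<close>, the three coefficients in the relation that raises \<open>c\<close> have
the factors \<open>c\<close>, \<open>m\<close> and \<open>l\<close> over \<open>c + m + l\<close>, which add up to one.\<close>
lemma F3_coeff_c_plus_1:
  assumes c: "Re c > 0"
  shows "F3_coeff a a' b b' (c + 1) m l = c / (c + of_nat (m + l)) * F3_coeff a a' b b' c m l"
proof -
  have nz: "c + of_nat (m + l) \<noteq> 0" "c \<noteq> 0" "pochhammer c (m + l) \<noteq> 0"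
    using add_of_nat_nonzero_of_Re_pos[OF c, of "m + l"] add_of_nat_nonzero_of_Re_pos[OF c, of 0]
      pochhammer_nonzero_of_Re_pos[OF c] by simp_all
  have "pochhammer (c + 1) (m + l) = pochhammer c (m + l) * (c + of_nat (m + l)) / c"
    using pochhammer_shift[of c "m + l"] nz(2) by (simp add: field_simps)
  thus ?thesis unfolding F3_coeff_def using nz by (simp add: mult_ac)
qed

lemma F3_coeff_shift_fst:
  assumes c: "Re c > 0"
  shows "a * b / (c * (c + 1)) * (if m = 0 then 0 else F3_coeff (a + 1) a' (b + 1) b' (c + 2) (m - 1) l) =
           of_nat m / (c + of_nat (m + l)) * F3_coeff a a' b b' c m l"
proof (cases m)
  case (Suc k)
  have "Re (c + 1) > 0" "Re (c + 2) > 0" using c by simp_all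
  hence nz: "c \<noteq> 0" "c + 1 \<noteq> 0" "pochhammer (c + 2) (k + l) \<noteq> 0" "c + of_nat (m + l) \<noteq> 0"
      "(of_nat (Suc k) :: complex) \<noteq> 0" "pochhammer c (m + l) \<noteq> 0"
    using add_of_nat_nonzero_of_Re_pos[OF c, of 0] add_of_nat_nonzero_of_Re_pos[of "c + 1" 0]
      add_of_nat_nonzero_of_Re_pos[OF c, of "m + l"] pochhammer_nonzero_of_Re_pos
      c by (simp_all del: of_nat_Suc of_nat_add)
  have "pochhammer c (m + l) * (c + of_nat (m + l)) = pochhammer c (Suc (Suc (k + l)))"
    unfolding Suc by (simp add: pochhammer_Suc)
  also have "\<dots> = c * (c + 1) * pochhammer (c + 2) (k + l)"
    by (simp add: pochhammer_rec add.assoc mult.assoc)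
  finally have "pochhammer (c + 2) (k + l) = pochhammer c (m + l) * (c + of_nat (m + l)) / (c * (c + 1))"
    using nz(1,2) by (simp only: nonzero_eq_divide_eq mult_eq_0_iff de_Morgan_disj simp_thms mult_ac)
  thus ?thesis using nz
    by (simp add: F3_coeff_def Suc pochhammer_rec[of a] pochhammer_rec[of b] mult_ac del: of_nat_Suc)
qed simp

lemma F3_coeff_swap: "F3_coeff a a' b b' c m l = F3_coeff a' a b' b c l m"
  by (simp add: F3_coeff_def add.commute mult_ac)

lemma F3_coeff_shift_snd:
  assumes c: "Re c > 0"
  shows "a' * b' / (c * (c + 1)) * (if l = 0 then 0 else F3_coeff a (a' + 1) b (b' + 1) (c + 2) m (l - 1)) =
           of_nat l / (c + of_nat (m + l)) * F3_coeff a a' b b' c m l"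
  using F3_coeff_shift_fst[OF c, of a' b' l a b m]
  unfolding F3_coeff_swap[of a "a' + 1"] F3_coeff_swap[of a a'] add.commute[of m l] .

lemma F3_series_raise_c:
  assumes c: "Re c > 0" and X: "norm X < 1" and Y: "norm Y < 1"
  shows "appell_F3_series a a' b b' c X Y =
     appell_F3_series a a' b b' (c + 1) X Y
     + a * b / (c * (c + 1)) * X * appell_F3_series (a + 1) a' (b + 1) b' (c + 2) X Y
     + a' * b' / (c * (c + 1)) * Y * appell_F3_series a (a' + 1) b (b' + 1) (c + 2) X Y" (is "_ = ?S")
proof -
  have c1: "Re (c + 1) > 0" and c2: "Re (c + 2) > 0" using c by simp_all
  have nzc: "c \<noteq> 0" "c + 1 \<noteq> 0" using c c1 by force+
  let ?f = "\<lambda>m l. F3_coeff a a' b b' (c + 1) m l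
        + a * b / (c * (c + 1)) * (if m = 0 then 0 else F3_coeff (a + 1) a' (b + 1) b' (c + 2) (m - 1) l)
        + a' * b' / (c * (c + 1)) * (if l = 0 then 0 else F3_coeff a (a' + 1) b (b' + 1) (c + 2) m (l - 1))"
  have "((\<lambda>(m, l). ?f m l * X ^ m * Y ^ l) has_sum ?S) UNIV"
    using has_sum_add[OF has_sum_add[OF has_sum_appell_F3_series[OF c1 X Y, of a a' b b']
        has_sum_cmult_right[OF has_sum_shift_fst[OF has_sum_appell_F3_series[OF c2 X Y, of "a + 1" a' "b + 1" b']],
          of "a * b / (c * (c + 1))"]]
        has_sum_cmult_right[OF has_sum_shift_snd[OF has_sum_appell_F3_series[OF c2 X Y, of a "a' + 1" b "b' + 1"]],
          of "a' * b' / (c * (c + 1))"]]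
    by (simp add: case_prod_unfold ring_distribs mult_ac)
  moreover have "?f m l = F3_coeff a a' b b' c m l" for m l
  proof -
    have "c + of_nat (m + l) \<noteq> 0" by (rule add_of_nat_nonzero_of_Re_pos[OF c])
    thus ?thesis
      unfolding F3_coeff_shift_fst[OF c] F3_coeff_shift_snd[OF c] F3_coeff_c_plus_1[OF c]
      by (simp add: divide_simps) (simp add: algebra_simps)
  qed
  ultimately have "((\<lambda>(m, l). F3_coeff a a' b b' c m l * X ^ m * Y ^ l) has_sum ?S) UNIV" by simp
  from has_sum_unique[OF has_sum_appell_F3_series[OF c X Y] this] show ?thesis .
qed

text \<open>The term by term relation is Gauss's \<open>F(a, b; c) = (1 - X) F(a, b+1; c) + (1 - a/c) X F(a, b+1; c+1)\<close> with
\<open>c + l\<close> in place of \<open>c\<close>; the resulting factor \<open>l\<close> accounts for the term with \<open>XY\<close>. The simpler relation without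
the factor \<open>1 - X\<close>, obtained from \<open>F3_series_raise_b'\<close> by exchanging the roles of the variables, would be of no
use later on: its terms would lower \<open>T - a - b\<close>, and the integrals could diverge.\<close>
lemma F3_series_raise_b:
  assumes c: "Re c > 0" and X: "norm X < 1" and Y: "norm Y < 1"
  shows "appell_F3_series a a' b b' c X Y =
     (1 - X) * appell_F3_series a a' (b + 1) b' c X Y
     + (c - a) / c * X * appell_F3_series a a' (b + 1) b' (c + 1) X Y
     + a' * b' / (c * (c + 1)) * X * Y * appell_F3_series a (a' + 1) (b + 1) (b' + 1) (c + 2) X Y" (is "_ = ?S")
proof -
  have c1: "Re (c + 1) > 0" and c2: "Re (c + 2) > 0" using c by simp_all
  have nzc: "c \<noteq> 0" using c by force
  let ?K = "F3_coeff a a' (b + 1) b' c"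
  let ?g = "\<lambda>m l. - ?K m l + (c - a) / c * F3_coeff a a' (b + 1) b' (c + 1) m l +
       a' * b' / (c * (c + 1)) * (if l = 0 then 0 else F3_coeff a (a' + 1) (b + 1) (b' + 1) (c + 2) m (l - 1))"
  let ?f = "\<lambda>m l. ?K m l + (if m = 0 then 0 else ?g (m - 1) l)"
  have "((\<lambda>(m, l). ?g m l * X ^ m * Y ^ l) has_sum
      (- appell_F3_series a a' (b + 1) b' c X Y + (c - a) / c * appell_F3_series a a' (b + 1) b' (c + 1) X Y
       + a' * b' / (c * (c + 1)) * (Y * appell_F3_series a (a' + 1) (b + 1) (b' + 1) (c + 2) X Y))) UNIV"
    using has_sum_add[OF has_sum_add[OF
        has_sum_cmult_right[OF has_sum_appell_F3_series[OF c X Y, of a a' "b + 1" b'], of "-1"]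
        has_sum_cmult_right[OF has_sum_appell_F3_series[OF c1 X Y, of a a' "b + 1" b'], of "(c - a) / c"]]
        has_sum_cmult_right[OF has_sum_shift_snd[OF has_sum_appell_F3_series[OF c2 X Y, of a "a' + 1" "b + 1" "b' + 1"]],
          of "a' * b' / (c * (c + 1))"]]
    by (simp add: case_prod_unfold ring_distribs mult_ac)
  from has_sum_add[OF has_sum_appell_F3_series[OF c X Y, of a a' "b + 1" b'] has_sum_shift_fst[OF this]]
  have "((\<lambda>(m, l). ?f m l * X ^ m * Y ^ l) has_sum ?S) UNIV"
    by (simp add: case_prod_unfold algebra_simps)
  moreover have "?f m l = F3_coeff a a' b b' c m l" for m l
  proof (cases m)
    case (Suc k)
    have nz: "c + of_nat (k + l) \<noteq> 0" "(of_nat (Suc k) :: complex) \<noteq> 0" "pochhammer c (k + l) \<noteq> 0"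
      using add_of_nat_nonzero_of_Re_pos[OF c, of "k + l"] pochhammer_nonzero_of_Re_pos[OF c]
      by (simp_all del: of_nat_Suc of_nat_add)
    have g: "?g k l = - (a + of_nat k) / (c + of_nat (k + l)) * ?K k l"
      unfolding F3_coeff_shift_snd[OF c] F3_coeff_c_plus_1[OF c]
      using nz nzc by (simp add: divide_simps) (simp add: algebra_simps)
    have e1: "?K (Suc k) l =
        (a + of_nat k) * (b + 1 + of_nat k) / ((c + of_nat (k + l)) * of_nat (Suc k)) * ?K k l"
      by (simp add: F3_coeff_def pochhammer_Suc mult_ac del: of_nat_Suc)
    have e2: "F3_coeff a a' b b' c (Suc k) l =
        (a + of_nat k) * b / ((c + of_nat (k + l)) * of_nat (Suc k)) * ?K k l"
      by (simp add: F3_coeff_def pochhammer_Suc[of a] pochhammer_Suc[of c] pochhammer_rec[of b] mult_ac del: of_nat_Suc)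
    show ?thesis
      unfolding Suc diff_Suc_1 g e1 e2 using nz by (simp add: divide_simps del: of_nat_Suc) (simp add: algebra_simps)
  qed (simp add: F3_coeff_def)
  ultimately have "((\<lambda>(m, l). F3_coeff a a' b b' c m l * X ^ m * Y ^ l) has_sum ?S) UNIV" by simp
  from has_sum_unique[OF has_sum_appell_F3_series[OF c X Y] this] show ?thesis .
qed

section \<open>Euler integrals as holomorphic functions\<close>

text \<open>Retraction onto the unit interval. It keeps \<open>1 - rX\<close> off the branch cut of the power even at points where the
weight vanishes, so that bounds hold everywhere and not only on the support.\<close>
definition clamp01 :: "real \<Rightarrow> real" where
  "clamp01 s = max 0 (min 1 s)"

lemma clamp01_bounds [simp]: "0 \<le> clamp01 s" "clamp01 s \<le> 1"
  by (simp_all add: clamp01_def)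

lemma clamp01_in [simp]: "clamp01 s \<in> {0..1}"
  by simp

lemma clamp01_eq: "0 \<le> s \<Longrightarrow> s \<le> 1 \<Longrightarrow> clamp01 s = s"
  by (simp add: clamp01_def)

lemma continuous_on_clamp01 [continuous_intros]:
  "continuous_on A f \<Longrightarrow> continuous_on A (\<lambda>x. clamp01 (f x))"
  unfolding clamp01_def by (intro continuous_intros)

lemma clamp01_measurable [measurable]: "clamp01 \<in> borel_measurable borel"
  unfolding clamp01_def by measurable

definition Euler_kernel :: "complex \<Rightarrow> real \<Rightarrow> complex \<Rightarrow> complex" where
  "Euler_kernel a r X = (1 - of_real r * X) powr (- a)"

lemma Euler_kernel_base:
  assumes "X \<in> cut_plane" "r \<in> {0..1}"
  shows "1 - of_real r * X \<notin> \<real>\<^sub>\<le>\<^sub>0"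
proof
  assume *: "1 - of_real r * X \<in> \<real>\<^sub>\<le>\<^sub>0"
  hence 1: "1 \<le> r * Re X" and 2: "r * Im X = 0" by (auto simp: complex_nonpos_Reals_iff)
  from 1 have "r > 0" using assms by (cases "r = 0") auto
  moreover have "r * Re X \<le> Re X" if "Re X \<ge> 0" using that assms by (simp add: mult_left_le_one_le)
  moreover have "Re X \<ge> 0" using 1 \<open>r > 0\<close> by (metis linorder_not_le mult_pos_neg order_less_trans zero_less_one not_less)
  ultimately show False using assms 1 2 by (auto simp: cut_plane_iff)
qed

lemma continuous_on_Euler_kernel:
  "continuous_on ({0..1} \<times> cut_plane) (\<lambda>(r, X). Euler_kernel a r X)"
proof -
  have "0 < Re (1 - of_real (fst p) * snd p) \<or> Im (1 - of_real (fst p) * snd p) \<noteq> 0"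
    if "p \<in> {0..1} \<times> cut_plane" for p :: "real \<times> complex"
    using Euler_kernel_base[of "snd p" "fst p"] that by (auto simp: complex_nonpos_Reals_iff mem_Times_iff)
  thus ?thesis
    unfolding Euler_kernel_def case_prod_unfold
    by (intro continuous_intros) (fastforce simp: complex_eq_iff)+
qed

lemma Euler_kernel_has_field_derivative:
  assumes "X \<in> cut_plane" "r \<in> {0..1}"
  shows "((\<lambda>X. Euler_kernel a r X) has_field_derivative (a * of_real r * Euler_kernel (a + 1) r X)) (at X)"
proof -
  have "((\<lambda>X. (1 - of_real r * X) powr (- a)) has_field_derivative
          (- a * (1 - of_real r * X) powr (- a - 1)) * (- of_real r)) (at X)"
  proof (rule DERIV_chain2[where f = "\<lambda>z. z powr (- a)" and g = "\<lambda>X. 1 - of_real r * X"])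
    show "((\<lambda>z. z powr (- a)) has_field_derivative - a * (1 - of_real r * X) powr (- a - 1)) (at (1 - of_real r * X))"
      by (rule has_field_derivative_powr[OF Euler_kernel_base[OF assms]])
    show "((\<lambda>X. 1 - of_real r * X) has_field_derivative - of_real r) (at X)"
      by (auto intro!: derivative_eq_intros)
  qed
  thus ?thesis by (simp add: Euler_kernel_def mult_ac)
qed

lemma Euler_kernel_measurable:
  assumes X: "X \<in> cut_plane" and [measurable]: "\<rho> \<in> borel_measurable M" and \<rho>: "\<And>z. \<rho> z \<in> {0..1}"
  shows "(\<lambda>z. Euler_kernel a (\<rho> z) X) \<in> borel_measurable M"
proof -
  have "continuous_on UNIV (\<lambda>r. (\<lambda>(r, X). Euler_kernel a r X) (clamp01 r, X))"
    by (rule continuous_on_compose2[OF continuous_on_Euler_kernel])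
       (use X in \<open>auto intro!: continuous_intros\<close>)
  hence [measurable]: "(\<lambda>r. Euler_kernel a (clamp01 r) X) \<in> borel_measurable borel"
    by (simp add: borel_measurable_continuous_onI)
  have "(\<lambda>z. Euler_kernel a (clamp01 (\<rho> z)) X) \<in> borel_measurable M" by measurable
  moreover have "clamp01 (\<rho> z) = \<rho> z" for z using \<rho>[of z] by (intro clamp01_eq) auto
  ultimately show ?thesis by simp
qed

lemma Euler_kernel_bounded:
  assumes "compact C" "C \<subseteq> cut_plane"
  obtains B where "B > 0" "\<And>r X. r \<in> {0..1} \<Longrightarrow> X \<in> C \<Longrightarrow> norm (Euler_kernel a r X) \<le> B"
proof -
  have "compact ((\<lambda>(r, X). Euler_kernel a r X) ` ({0..1} \<times> C))"
    using assms by (intro compact_continuous_image continuous_on_subset[OF continuous_on_Euler_kernel] compact_Times) auto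
  hence "bounded ((\<lambda>(r, X). Euler_kernel a r X) ` ({0..1} \<times> C))" by (rule compact_imp_bounded)
  then obtain B where "B > 0" "\<forall>x\<in>(\<lambda>(r, X). Euler_kernel a r X) ` ({0..1} \<times> C). norm x \<le> B"
    by (auto simp: bounded_pos)
  thus ?thesis by (intro that[of B]) force+
qed

lemma integrable_mult_bounded:
  fixes f g :: "'a \<Rightarrow> complex"
  assumes f: "integrable M f" and [measurable]: "g \<in> borel_measurable M" and "\<And>x. norm (g x) \<le> B"
  shows "integrable M (\<lambda>x. f x * g x)"
proof (rule Bochner_Integration.integrable_bound)
  have [measurable]: "f \<in> borel_measurable M" using f by auto
  show "(\<lambda>x. f x * g x) \<in> borel_measurable M" by measurable
  show "integrable M (\<lambda>x. B * norm (f x))" using f by auto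
  have "norm (f x * g x) \<le> norm (B * norm (f x))" for x
  proof -
    have "norm (f x) * norm (g x) \<le> norm (f x) * \<bar>B\<bar>"
      using assms(3)[of x] by (intro mult_left_mono) auto
    thus ?thesis by (simp add: norm_mult abs_mult mult.commute)
  qed
  thus "AE x in M. norm (f x * g x) \<le> norm (B * norm (f x))" by simp
qed

lemma integrable_mult_Euler_kernel:
  assumes w: "integrable M w" and X: "X \<in> cut_plane"
    and \<rho>: "\<rho> \<in> borel_measurable M" "\<And>z. \<rho> z \<in> {0..1}"
  shows "integrable M (\<lambda>z. w z * Euler_kernel a (\<rho> z) X)"
proof -
  obtain B where B: "B > 0" "\<And>r X'. r \<in> {0..1} \<Longrightarrow> X' \<in> {X} \<Longrightarrow> norm (Euler_kernel a r X') \<le> B"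
    using Euler_kernel_bounded[of "{X}" a] X by auto
  show ?thesis
    by (rule integrable_mult_bounded[OF w Euler_kernel_measurable[OF X \<rho>], where B = B]) (use B \<rho> in auto)
qed

text \<open>Differentiation under the integral sign: difference quotients in \<open>X\<close> are bounded uniformly in \<open>r \<in> [0, 1]\<close>,
because the derivative of the kernel is bounded on compact sets, and dominated convergence applies.\<close>
lemma Euler_integral_holomorphic:
  assumes w: "integrable M w" and \<rho>: "\<rho> \<in> borel_measurable M" "\<And>z. \<rho> z \<in> {0..1}"
  shows "(\<lambda>X. LINT z|M. w z * Euler_kernel a (\<rho> z) X) holomorphic_on cut_plane"
proof (subst holomorphic_on_open[OF open_cut_plane], intro ballI)
  fix X assume X: "X \<in> cut_plane"
  define D where "D = (LINT z|M. w z * (a * of_real (\<rho> z) * Euler_kernel (a + 1) (\<rho> z) X))"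
  obtain r where r: "r > 0" "cball X r \<subseteq> cut_plane"
    using X open_cut_plane open_contains_cball by blast
  obtain B where B: "B > 0" "\<And>t X'. t \<in> {0..1} \<Longrightarrow> X' \<in> cball X r \<Longrightarrow> norm (Euler_kernel (a + 1) t X') \<le> B"
    using Euler_kernel_bounded[of "cball X r" "a + 1"] r by auto
  have [measurable]: "w \<in> borel_measurable M" "\<rho> \<in> borel_measurable M" using w \<rho> by auto
  have lip: "norm (Euler_kernel a t (X + h) - Euler_kernel a t X) \<le> (norm a * B) * norm h"
    if t: "t \<in> {0..1}" and h: "norm h < r" for t h
  proof -
    have "norm (Euler_kernel a t (X + h) - Euler_kernel a t X) \<le> (norm a * B) * norm ((X + h) - X)"
    proof (rule field_differentiable_bound[of "cball X r"])
      show "((\<lambda>X. Euler_kernel a t X) has_field_derivative (a * of_real t * Euler_kernel (a + 1) t z)) (at z within cball X r)"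
        if "z \<in> cball X r" for z
        by (rule has_field_derivative_at_within[OF Euler_kernel_has_field_derivative[OF subsetD[OF r(2) that] t]])
      show "norm (a * of_real t * Euler_kernel (a + 1) t z) \<le> norm a * B" if "z \<in> cball X r" for z
      proof -
        have "norm a * \<bar>t\<bar> * norm (Euler_kernel (a + 1) t z) \<le> norm a * 1 * B"
          using t B(2)[OF t that] B(1) by (intro mult_mono) auto
        thus ?thesis by (simp add: norm_mult)
      qed
    qed (use r h in \<open>auto simp: dist_norm\<close>)
    thus ?thesis by simp
  qed
  have "((\<lambda>h. ((LINT z|M. w z * Euler_kernel a (\<rho> z) (X + h)) - (LINT z|M. w z * Euler_kernel a (\<rho> z) X)) / h)
           \<longlongrightarrow> D) (at 0 within ball 0 r)"
    unfolding tendsto_at_iff_sequentially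
  proof (intro allI impI)
    fix H :: "nat \<Rightarrow> complex"
    assume "\<forall>i. H i \<in> ball 0 r - {0}" and lim: "H \<longlonglongrightarrow> 0"
    hence H: "norm (H i) < r" "H i \<noteq> 0" for i by auto
    have XH: "X + H i \<in> cut_plane" for i
      by (rule subsetD[OF r(2)]) (use H(1)[of i] in \<open>simp add: dist_norm\<close>)
    define Q where "Q = (\<lambda>i z. w z * ((Euler_kernel a (\<rho> z) (X + H i) - Euler_kernel a (\<rho> z) X) / H i))"
    have eq: "((LINT z|M. w z * Euler_kernel a (\<rho> z) (X + H i)) - (LINT z|M. w z * Euler_kernel a (\<rho> z) X)) / H i
                = (LINT z|M. Q i z)" for i
      using integrable_mult_Euler_kernel[OF w XH \<rho>, of a i] integrable_mult_Euler_kernel[OF w X \<rho>, of a]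
      by (simp add: Q_def diff_divide_distrib right_diff_distrib)
    have "(\<lambda>i. LINT z|M. Q i z) \<longlonglongrightarrow> D"
      unfolding D_def
    proof (rule integral_dominated_convergence)
      show "integrable M (\<lambda>z. norm (w z) * (norm a * B))" using w by auto
      show "(\<lambda>z. w z * (a * of_real (\<rho> z) * Euler_kernel (a + 1) (\<rho> z) X)) \<in> borel_measurable M"
        using Euler_kernel_measurable[OF X \<rho>, of "a + 1"] by measurable
      show "(\<lambda>z. Q i z) \<in> borel_measurable M" for i
        unfolding Q_def using Euler_kernel_measurable[OF X \<rho>, of a] Euler_kernel_measurable[OF XH \<rho>, of a i] by measurable
      show "AE z in M. norm (Q i z) \<le> norm (w z) * (norm a * B)" for i
      proof (rule AE_I2)
        fix z
        have "norm (Euler_kernel a (\<rho> z) (X + H i) - Euler_kernel a (\<rho> z) X) / norm (H i) \<le> norm a * B"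
          using lip[OF \<rho>(2) H(1), of z i] H(2)[of i] by (simp add: divide_le_eq)
        thus "norm (Q i z) \<le> norm (w z) * (norm a * B)"
          unfolding Q_def norm_mult norm_divide by (intro mult_left_mono) auto
      qed
      show "AE z in M. (\<lambda>i. Q i z) \<longlonglongrightarrow> w z * (a * of_real (\<rho> z) * Euler_kernel (a + 1) (\<rho> z) X)"
      proof (rule AE_I2)
        fix z
        have "((\<lambda>h. (Euler_kernel a (\<rho> z) (X + h) - Euler_kernel a (\<rho> z) X) / h) \<longlongrightarrow>
                 a * of_real (\<rho> z) * Euler_kernel (a + 1) (\<rho> z) X) (at 0)"
          using Euler_kernel_has_field_derivative[OF X \<rho>(2), of a z] by (simp add: DERIV_def)
        hence "(\<lambda>i. (Euler_kernel a (\<rho> z) (X + H i) - Euler_kernel a (\<rho> z) X) / H i) \<longlonglongrightarrow>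
                 a * of_real (\<rho> z) * Euler_kernel (a + 1) (\<rho> z) X"
          using lim H(2) unfolding tendsto_at_iff_sequentially o_def by auto
        thus "(\<lambda>i. Q i z) \<longlonglongrightarrow> w z * (a * of_real (\<rho> z) * Euler_kernel (a + 1) (\<rho> z) X)"
          unfolding Q_def by (intro tendsto_intros)
      qed
    qed
    thus "((\<lambda>h. ((LINT z|M. w z * Euler_kernel a (\<rho> z) (X + h)) - (LINT z|M. w z * Euler_kernel a (\<rho> z) X)) / h) \<circ> H)
            \<longlonglongrightarrow> D"
      by (simp add: o_def eq)
  qed
  hence "((\<lambda>X. LINT z|M. w z * Euler_kernel a (\<rho> z) X) has_field_derivative D) (at X)"
    using r(1) by (simp add: DERIV_def at_within_open[of 0 "ball 0 r"])
  thus "\<exists>D. ((\<lambda>X. LINT z|M. w z * Euler_kernel a (\<rho> z) X) has_field_derivative D) (at X)" ..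
qed

text \<open>Holomorphy in each variable follows from the one-variable case, the other factor being absorbed into the
weight; joint continuity is dominated convergence along a convergent sequence of points, which together with
its limit forms a compact set.\<close>
lemma double_Euler_integral_holomorphic2:
  assumes w: "integrable M w"
    and \<rho>: "\<rho> \<in> borel_measurable M" "\<And>z. \<rho> z \<in> {0..1}"
    and \<sigma>: "\<sigma> \<in> borel_measurable M" "\<And>z. \<sigma> z \<in> {0..1}"
  shows "holomorphic2_on (\<lambda>X Y. LINT z|M. w z * Euler_kernel a (\<rho> z) X * Euler_kernel a' (\<sigma> z) Y)
           cut_plane cut_plane"
  unfolding holomorphic2_on_def
proof (intro conjI ballI)
  fix Y assume Y: "Y \<in> cut_plane"
  have "(\<lambda>X. LINT z|M. (w z * Euler_kernel a' (\<sigma> z) Y) * Euler_kernel a (\<rho> z) X) holomorphic_on cut_plane"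
    by (intro Euler_integral_holomorphic integrable_mult_Euler_kernel w \<rho> \<sigma> Y)
  thus "(\<lambda>X. LINT z|M. w z * Euler_kernel a (\<rho> z) X * Euler_kernel a' (\<sigma> z) Y) holomorphic_on cut_plane"
    by (simp add: mult_ac)
next
  fix X assume X: "X \<in> cut_plane"
  show "(\<lambda>Y. LINT z|M. w z * Euler_kernel a (\<rho> z) X * Euler_kernel a' (\<sigma> z) Y) holomorphic_on cut_plane"
    by (intro Euler_integral_holomorphic integrable_mult_Euler_kernel w \<rho> \<sigma> X)
next
  show "continuous_on (cut_plane \<times> cut_plane)
          (\<lambda>(X, Y). LINT z|M. w z * Euler_kernel a (\<rho> z) X * Euler_kernel a' (\<sigma> z) Y)"
    unfolding continuous_on_sequentially
  proof (intro ballI allI impI, elim conjE)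
    fix XY :: "complex \<times> complex" and S :: "nat \<Rightarrow> complex \<times> complex"
    assume XY: "XY \<in> cut_plane \<times> cut_plane" and S: "\<forall>n. S n \<in> cut_plane \<times> cut_plane" and lim: "S \<longlonglongrightarrow> XY"
    define X where "X = fst XY"
    define Y where "Y = snd XY"
    define P where "P = (\<lambda>n. fst (S n))"
    define Q where "Q = (\<lambda>n. snd (S n))"
    have mem: "X \<in> cut_plane" "Y \<in> cut_plane" "P n \<in> cut_plane" "Q n \<in> cut_plane" for n
      using XY S by (auto simp: X_def Y_def P_def Q_def mem_Times_iff)
    have limP: "P \<longlonglongrightarrow> X" and limQ: "Q \<longlonglongrightarrow> Y"
      unfolding X_def Y_def P_def Q_def using lim by (auto intro: tendsto_fst tendsto_snd)
    obtain B where B: "B > 0" "\<And>r x. r \<in> {0..1} \<Longrightarrow> x \<in> insert X (range P) \<Longrightarrow> norm (Euler_kernel a r x) \<le> B"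
      using Euler_kernel_bounded[OF compact_sequence_with_limit[OF limP], of a] mem by auto
    obtain B' where B': "B' > 0" "\<And>r x. r \<in> {0..1} \<Longrightarrow> x \<in> insert Y (range Q) \<Longrightarrow> norm (Euler_kernel a' r x) \<le> B'"
      using Euler_kernel_bounded[OF compact_sequence_with_limit[OF limQ], of a'] mem by auto
    have [measurable]: "w \<in> borel_measurable M" using w by auto
    have lim_kernel: "(\<lambda>n. Euler_kernel \<alpha> r (R n)) \<longlonglongrightarrow> Euler_kernel \<alpha> r Z"
      if "R \<longlonglongrightarrow> Z" "Z \<in> cut_plane" "r \<in> {0..1}" for R Z r \<alpha>
    proof -
      have "isCont (Euler_kernel \<alpha> r) Z"
        using DERIV_isCont[OF Euler_kernel_has_field_derivative[OF that(2,3), of \<alpha>]] by simp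
      thus ?thesis using that(1) by (rule isCont_tendsto_compose)
    qed
    have "(\<lambda>n. LINT z|M. w z * Euler_kernel a (\<rho> z) (P n) * Euler_kernel a' (\<sigma> z) (Q n)) \<longlonglongrightarrow>
          (LINT z|M. w z * Euler_kernel a (\<rho> z) X * Euler_kernel a' (\<sigma> z) Y)"
    proof (rule integral_dominated_convergence)
      show "integrable M (\<lambda>z. norm (w z) * B * B')" using w by auto
      show "(\<lambda>z. w z * Euler_kernel a (\<rho> z) X * Euler_kernel a' (\<sigma> z) Y) \<in> borel_measurable M"
        using Euler_kernel_measurable[OF mem(1) \<rho>, of a] Euler_kernel_measurable[OF mem(2) \<sigma>, of a'] by measurable
      show "(\<lambda>z. w z * Euler_kernel a (\<rho> z) (P n) * Euler_kernel a' (\<sigma> z) (Q n)) \<in> borel_measurable M" for n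
        using Euler_kernel_measurable[OF mem(3) \<rho>, of a n] Euler_kernel_measurable[OF mem(4) \<sigma>, of a' n] by measurable
      show "AE z in M. norm (w z * Euler_kernel a (\<rho> z) (P n) * Euler_kernel a' (\<sigma> z) (Q n)) \<le> norm (w z) * B * B'" for n
        using B B' \<rho>(2) \<sigma>(2) by (intro AE_I2) (auto simp: norm_mult intro!: mult_mono)
      show "AE z in M. (\<lambda>n. w z * Euler_kernel a (\<rho> z) (P n) * Euler_kernel a' (\<sigma> z) (Q n)) \<longlonglongrightarrow>
              w z * Euler_kernel a (\<rho> z) X * Euler_kernel a' (\<sigma> z) Y"
        by (intro AE_I2 tendsto_intros lim_kernel limP limQ mem \<rho>(2) \<sigma>(2))
    qed
    thus "((\<lambda>(X, Y). LINT z|M. w z * Euler_kernel a (\<rho> z) X * Euler_kernel a' (\<sigma> z) Y) \<circ> S) \<longlonglongrightarrow>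
            (case XY of (X, Y) \<Rightarrow> LINT z|M. w z * Euler_kernel a (\<rho> z) X * Euler_kernel a' (\<sigma> z) Y)"
      by (simp add: o_def case_prod_unfold X_def Y_def P_def Q_def)
  qed
qed

lemma Euler_kernel_sums:
  assumes "norm X < 1" "r \<in> {0..1}"
  shows "(\<lambda>m. pochhammer a m / fact m * of_real r ^ m * X ^ m) sums Euler_kernel a r X"
proof -
  have "norm (- (of_real r * X)) < 1"
    using assms mult_left_le_one_le[of "norm X" r] by (auto simp: norm_mult)
  from gen_binomial_complex[OF this, of "- a"]
  show ?thesis
    by (simp add: Euler_kernel_def gbinomial_pochhammer power_minus' power_mult_distrib mult_ac)
qed

lemma Euler_integral_sums:
  assumes w: "integrable M w" and \<rho>: "\<rho> \<in> borel_measurable M" "\<And>z. \<rho> z \<in> {0..1}" and X: "norm X < 1"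
  shows "(\<lambda>m. pochhammer a m / fact m * X ^ m * (LINT z|M. w z * of_real (\<rho> z) ^ m)) sums
           (LINT z|M. w z * Euler_kernel a (\<rho> z) X)"
proof -
  define f where "f = (\<lambda>m z. w z * (pochhammer a m / fact m * of_real (\<rho> z) ^ m * X ^ m))"
  define \<alpha> where "\<alpha> = (\<lambda>m. norm (pochhammer a m) / fact m * norm X ^ m)"
  have summ: "summable \<alpha>"
    using summable_hypergeo_2F1_norm[of 1 "norm X" a 1] X
    by (simp add: \<alpha>_def pochhammer_fact [symmetric])
  have [measurable]: "w \<in> borel_measurable M" "\<rho> \<in> borel_measurable M" using w \<rho> by auto
  have \<rho>_le: "\<bar>\<rho> z\<bar> ^ m \<le> 1" for z m using \<rho>(2)[of z] by (intro power_le_one) auto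
  have int: "integrable M (f m)" for m
  proof -
    have "integrable M (\<lambda>z. w z * of_real (\<rho> z) ^ m)"
      by (rule integrable_mult_bounded[OF w, of _ 1]) (use \<rho>_le in \<open>auto simp: norm_power\<close>)
    from integrable_mult_right[OF this, of "pochhammer a m / fact m * X ^ m"]
    show ?thesis by (simp add: f_def mult_ac)
  qed
  have bound: "norm (f m z) \<le> norm (w z) * \<alpha> m" for m z
  proof -
    have "norm (f m z) = norm (w z) * \<alpha> m * \<bar>\<rho> z\<bar> ^ m"
      by (simp add: f_def \<alpha>_def norm_mult norm_divide norm_power mult_ac)
    also have "\<dots> \<le> norm (w z) * \<alpha> m * 1"
      by (intro mult_left_mono \<rho>_le) (auto simp: \<alpha>_def)
    finally show ?thesis by simp
  qed
  have "(\<lambda>m. LINT z|M. f m z) sums (LINT z|M. (\<Sum>m. f m z))"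
  proof (rule sums_integral[OF int])
    show "AE z in M. summable (\<lambda>m. norm (f m z))"
      by (intro AE_I2 summable_comparison_test'[OF summable_mult[OF summ]]) (use bound in auto)
    show "summable (\<lambda>m. LINT z|M. norm (f m z))"
    proof (rule summable_comparison_test'[OF summable_mult[OF summ]])
      fix m
      have "(LINT z|M. norm (f m z)) \<le> (LINT z|M. norm (w z) * \<alpha> m)"
        by (intro integral_mono bound) (use int w in auto)
      thus "norm (LINT z|M. norm (f m z)) \<le> (LINT z|M. norm (w z)) * \<alpha> m"
        by (simp add: abs_of_nonneg)
    qed
  qed
  moreover have "(\<Sum>m. f m z) = w z * Euler_kernel a (\<rho> z) X" for z
    unfolding f_def using sums_mult[OF Euler_kernel_sums[OF X \<rho>(2), of a z], of "w z"]
    by (simp add: sums_iff)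
  moreover have "(LINT z|M. f m z) = pochhammer a m / fact m * X ^ m * (LINT z|M. w z * of_real (\<rho> z) ^ m)" for m
    by (subst integral_mult_right_zero [symmetric]) (simp add: f_def mult_ac)
  ultimately show ?thesis by simp
qed

section \<open>Analytic continuation of Appell's function\<close>

text \<open>Weight of the Euler integral over the triangle \<open>u, w \<ge> 0\<close>, \<open>u + w \<le> 1\<close>, in the coordinates \<open>s = 1 - u\<close>, \<open>w = sv\<close>
in which the triangle becomes the unit square and the weight a product.\<close>
definition Euler_weight :: "complex \<Rightarrow> complex \<Rightarrow> complex \<Rightarrow> real \<times> real \<Rightarrow> complex" where
  "Euler_weight b b' c = (\<lambda>(s, v). ppow (c - b - 1) s * ppow (b - 1) (1 - s) *
                              (ppow (b' - 1) v * ppow (c - b - b' - 1) (1 - v)))"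

definition F3_Euler_const :: "complex \<Rightarrow> complex \<Rightarrow> complex \<Rightarrow> complex" where
  "F3_Euler_const b b' c = Gamma c / (Gamma b * Gamma b' * Gamma (c - b - b'))"

definition F3_Euler ::
    "complex \<Rightarrow> complex \<Rightarrow> complex \<Rightarrow> complex \<Rightarrow> complex \<Rightarrow> complex \<Rightarrow> complex \<Rightarrow> complex" where
  "F3_Euler a a' b b' c X Y = F3_Euler_const b b' c *
     (LINT z|(lborel \<Otimes>\<^sub>M lborel). Euler_weight b b' c z *
        Euler_kernel a (clamp01 (1 - fst z)) X * Euler_kernel a' (clamp01 (fst z) * clamp01 (snd z)) Y)"

lemma clamp01_mult_in [simp]: "clamp01 s * clamp01 v \<in> {0..1}"
  by (simp add: mult_le_one)

lemma has_bochner_integral_product: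
  fixes f g :: "real \<Rightarrow> complex"
  assumes f: "has_bochner_integral lborel f u" and g: "has_bochner_integral lborel g v"
  shows "has_bochner_integral (lborel \<Otimes>\<^sub>M lborel) (\<lambda>(x, y). f x * g y) (u * v)"
proof -
  have [measurable]: "f \<in> borel_measurable lborel" "g \<in> borel_measurable lborel"
    using f g by (auto simp: has_bochner_integral_iff)
  have "integrable (lborel \<Otimes>\<^sub>M lborel) (\<lambda>(x, y). f x * g y)"
    by (rule lborel_pair.Fubini_integrable)
       (use f g in \<open>auto simp: norm_mult has_bochner_integral_iff\<close>)
  moreover from lborel_pair.integral_fst'[OF this]
    have "integral\<^sup>L (lborel \<Otimes>\<^sub>M lborel) (\<lambda>(x, y). f x * g y) = u * v"
    using f g by (simp add: has_bochner_integral_iff)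
  ultimately show ?thesis by (simp add: has_bochner_integral_iff)
qed

lemma Euler_weight_moment:
  assumes b: "Re b > 0" and b': "Re b' > 0" and e: "Re (c - b - b') > 0"
  shows "has_bochner_integral (lborel \<Otimes>\<^sub>M lborel)
           (\<lambda>z. Euler_weight b b' c z * of_real (clamp01 (1 - fst z)) ^ m *
                  of_real (clamp01 (fst z) * clamp01 (snd z)) ^ l)
           (Beta (c - b + of_nat l) (b + of_nat m) * Beta (b' + of_nat l) (c - b - b'))"
proof -
  have "has_bochner_integral (lborel \<Otimes>\<^sub>M lborel)
      (\<lambda>(s, v). (ppow (c - b + of_nat l - 1) s * ppow (b + of_nat m - 1) (1 - s)) *
               (ppow (b' + of_nat l - 1) v * ppow (c - b - b' - 1) (1 - v)))
           (Beta (c - b + of_nat l) (b + of_nat m) * Beta (b' + of_nat l) (c - b - b'))"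
    by (intro has_bochner_integral_product has_bochner_integral_Beta) (use b b' e in auto)
  moreover have "(ppow (c - b + of_nat l - 1) s * ppow (b + of_nat m - 1) (1 - s)) *
               (ppow (b' + of_nat l - 1) v * ppow (c - b - b' - 1) (1 - v)) =
      Euler_weight b b' c (s, v) * of_real (clamp01 (1 - s)) ^ m * of_real (clamp01 s * clamp01 v) ^ l" for s v
  proof (cases "0 < s \<and> s < 1 \<and> 0 < v \<and> v < 1")
    case True
    have split: "ppow (z + of_nat k - 1) t = ppow (z - 1) t * of_real t ^ k" if "t > 0" for z k t
      using ppow_add[of "z - 1" "of_nat k" t] that by (simp add: ppow_of_nat algebra_simps)
    show ?thesis using True
      by (simp add: split Euler_weight_def clamp01_eq power_mult_distrib mult_ac)
  next
    case False
    thus ?thesis by (cases "s > 0"; cases "v > 0") (auto simp: Euler_weight_def not_less)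
  qed
  ultimately show ?thesis by (simp add: case_prod_unfold)
qed

lemma Euler_weight_integrable:
  assumes "Re b > 0" "Re b' > 0" "Re (c - b - b') > 0"
  shows "integrable (lborel \<Otimes>\<^sub>M lborel) (Euler_weight b b' c)"
  using Euler_weight_moment[OF assms, of 0 0] by (simp add: has_bochner_integral_iff)

lemma F3_Euler_const_moment:
  assumes b: "Re b > 0" and b': "Re b' > 0" and e: "Re (c - b - b') > 0"
  shows "F3_Euler_const b b' c * (Beta (c - b + of_nat l) (b + of_nat m) * Beta (b' + of_nat l) (c - b - b')) =
           pochhammer b m * pochhammer b' l / pochhammer c (m + l)"
proof -
  have nz: "Gamma b \<noteq> 0" "Gamma b' \<noteq> 0" "Gamma c \<noteq> 0" "Gamma (c - b - b') \<noteq> 0" "Gamma (c - b + of_nat l) \<noteq> 0"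
      "Gamma (c + of_nat (m + l)) \<noteq> 0"
    using b b' e by (auto intro!: Gamma_nonzero_of_Re_pos)
  have 1: "c - b + of_nat l + (b + of_nat m) = c + of_nat (m + l)" by simp
  have 2: "b' + of_nat l + (c - b - b') = c - b + of_nat l" by simp
  have G: "Gamma (z + of_nat n) = pochhammer z n * Gamma z" if "Re z > 0" for z n
    using pochhammer_Gamma[of z n] not_nonpos_Int_of_Re_pos[OF that] Gamma_nonzero_of_Re_pos[OF that]
    by simp
  have c: "Re c > 0" using b b' e by simp
  show ?thesis
    unfolding F3_Euler_const_def Beta_def 1 2
    using nz pochhammer_nonzero_of_Re_pos[OF c, of "m + l"]
    by (simp add: G[OF b] G[OF b'] G[OF c] divide_simps mult_ac del: of_nat_add)
qed

text \<open>Binomial expansion of both kernels and termwise integration; the moments of the weight supply the factors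
\<open>(b)\<^sub>m (b')\<^sub>l / (c)\<^sub>m\<^sub>+\<^sub>l\<close>.\<close>
lemma F3_Euler_eq_series:
  assumes b: "Re b > 0" and b': "Re b' > 0" and e: "Re (c - b - b') > 0"
    and X: "norm X < 1" and Y: "norm Y < 1"
  shows "F3_Euler a a' b b' c X Y = appell_F3_series a a' b b' c X Y"
proof -
  let ?M = "lborel \<Otimes>\<^sub>M lborel :: (real \<times> real) measure"
  define \<rho> where "\<rho> = (\<lambda>z::real \<times> real. clamp01 (1 - fst z))"
  define \<sigma> where "\<sigma> = (\<lambda>z::real \<times> real. clamp01 (fst z) * clamp01 (snd z))"
  define w where "w = Euler_weight b b' c"
  have [measurable]: "\<rho> \<in> borel_measurable ?M"
    unfolding \<rho>_def by measurable
  moreover have "\<rho> z \<in> {0..1}" for z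
    unfolding \<rho>_def by (rule clamp01_in)
  ultimately have \<rho>: "\<rho> \<in> borel_measurable ?M" "\<And>z. \<rho> z \<in> {0..1}" .
  have [measurable]: "\<sigma> \<in> borel_measurable ?M"
    unfolding \<sigma>_def by measurable
  moreover have "\<sigma> z \<in> {0..1}" for z
    unfolding \<sigma>_def by (rule clamp01_mult_in)
  ultimately have \<sigma>: "\<sigma> \<in> borel_measurable ?M" "\<And>z. \<sigma> z \<in> {0..1}" .
  have w: "integrable ?M w" unfolding w_def by (rule Euler_weight_integrable) fact+
  have Yc: "Y \<in> cut_plane" using Y ball_subset_cut_plane by auto
  have wm: "integrable ?M (\<lambda>z. w z * of_real (\<rho> z) ^ m)" for m
    using Euler_weight_moment[OF b b' e, of m 0] by (simp add: w_def \<rho>_def has_bochner_integral_iff)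
  have c: "Re c > 0" using b b' e by simp
  define T where "T = (\<lambda>m l. F3_coeff a a' b b' c m l * X ^ m * Y ^ l)"
  define C where "C = F3_Euler_const b b' c"
  have inner: "(\<lambda>l. T m l) sums (pochhammer a m / fact m * X ^ m *
      (C * (LINT z|?M. w z * of_real (\<rho> z) ^ m * Euler_kernel a' (\<sigma> z) Y)))" for m
  proof -
    have moment: "C * (LINT z|?M. w z * of_real (\<rho> z) ^ m * of_real (\<sigma> z) ^ l) =
        pochhammer b m * pochhammer b' l / pochhammer c (m + l)" for l
      using Euler_weight_moment[OF b b' e, of m l] F3_Euler_const_moment[OF b b' e, of l m]
      by (simp add: C_def w_def \<rho>_def \<sigma>_def has_bochner_integral_iff)
    have "(\<lambda>l. pochhammer a m / fact m * X ^ m * (C * (pochhammer a' l / fact l * Y ^ l *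
              (LINT z|?M. w z * of_real (\<rho> z) ^ m * of_real (\<sigma> z) ^ l)))) sums
       (pochhammer a m / fact m * X ^ m * (C * (LINT z|?M. w z * of_real (\<rho> z) ^ m * Euler_kernel a' (\<sigma> z) Y)))"
      by (intro sums_mult Euler_integral_sums wm \<sigma> Y)
    moreover have "pochhammer a m / fact m * X ^ m * (C * (pochhammer a' l / fact l * Y ^ l *
              (LINT z|?M. w z * of_real (\<rho> z) ^ m * of_real (\<sigma> z) ^ l))) = T m l" for l
    proof -
      have "pochhammer a m / fact m * X ^ m * (C * (pochhammer a' l / fact l * Y ^ l *
              (LINT z|?M. w z * of_real (\<rho> z) ^ m * of_real (\<sigma> z) ^ l))) =
            pochhammer a m / fact m * X ^ m * (pochhammer a' l / fact l * Y ^ l) *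
              (C * (LINT z|?M. w z * of_real (\<rho> z) ^ m * of_real (\<sigma> z) ^ l))"
        by (simp only: mult_ac)
      also have "\<dots> = T m l"
        unfolding moment by (simp add: T_def F3_coeff_def mult_ac)
      finally show ?thesis .
    qed
    ultimately show ?thesis by simp
  qed
  have "(\<lambda>m. C * (pochhammer a m / fact m * X ^ m *
          (LINT z|?M. w z * Euler_kernel a' (\<sigma> z) Y * of_real (\<rho> z) ^ m))) sums
        (C * (LINT z|?M. w z * Euler_kernel a' (\<sigma> z) Y * Euler_kernel a (\<rho> z) X))"
    by (intro sums_mult Euler_integral_sums integrable_mult_Euler_kernel w \<rho> \<sigma> X Yc)
  hence outer: "(\<lambda>m. \<Sum>l. T m l) sums F3_Euler a a' b b' c X Y"
    using inner by (simp add: sums_iff F3_Euler_def C_def w_def \<rho>_def \<sigma>_def mult_ac)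
  have summ: "(\<lambda>(m, l). T m l) summable_on (SIGMA m:UNIV. UNIV)"
    using has_sum_appell_F3_series[OF c X Y, of a a' b b'] by (auto simp: T_def summable_on_def)
  have "((\<lambda>m. infsum (T m) UNIV) has_sum appell_F3_series a a' b b' c X Y) UNIV"
    using has_sum_SigmaD[where f = "\<lambda>(m, l). T m l" and A = UNIV and B = "\<lambda>_. UNIV" and g = "\<lambda>m. infsum (T m) UNIV"]
      has_sum_appell_F3_series[OF c X Y, of a a' b b'] summable_on_SigmaD1[OF summ] by (simp add: T_def)
  hence "(\<lambda>m. infsum (T m) UNIV) sums appell_F3_series a a' b b' c X Y"
    by (rule has_sum_imp_sums)
  moreover have "infsum (T m) UNIV = (\<Sum>l. T m l)" for m
    using has_sum_imp_sums[OF has_sum_infsum[OF summable_on_SigmaD1[OF summ, of m]]] by (simp add: sums_iff)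
  ultimately show ?thesis using outer by (simp add: sums_iff)
qed

lemma F3_Euler_continuation:
  assumes b: "Re b > 0" and b': "Re b' > 0" and e: "Re (c - b - b') > 0"
  shows "appell_F3_continuation a a' b b' c (F3_Euler a a' b b' c)"
proof -
  have "holomorphic2_on (\<lambda>X Y. LINT z|(lborel \<Otimes>\<^sub>M lborel). Euler_weight b b' c z *
        Euler_kernel a (clamp01 (1 - fst z)) X * Euler_kernel a' (clamp01 (fst z) * clamp01 (snd z)) Y) cut_plane cut_plane"
    by (intro double_Euler_integral_holomorphic2 Euler_weight_integrable assms clamp01_in clamp01_mult_in)
       measurable
  hence "holomorphic2_on (F3_Euler a a' b b' c) cut_plane cut_plane"
    unfolding holomorphic2_on_def F3_Euler_def case_prod_unfold
    by (auto intro!: continuous_intros holomorphic_intros)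
  thus ?thesis
    unfolding appell_F3_continuation_def using F3_Euler_eq_series[OF assms] by blast
qed

lemma holomorphic2_on_add:
  "holomorphic2_on F U V \<Longrightarrow> holomorphic2_on G U V \<Longrightarrow> holomorphic2_on (\<lambda>X Y. F X Y + G X Y) U V"
  unfolding holomorphic2_on_def case_prod_unfold by (auto intro!: continuous_intros holomorphic_intros)

lemma holomorphic2_on_mult:
  "holomorphic2_on F U V \<Longrightarrow> holomorphic2_on G U V \<Longrightarrow> holomorphic2_on (\<lambda>X Y. F X Y * G X Y) U V"
  unfolding holomorphic2_on_def case_prod_unfold by (auto intro!: continuous_intros holomorphic_intros)

lemma holomorphic2_on_bilinear:
  "holomorphic2_on (\<lambda>X Y. k0 + k1 * X + k2 * Y + k3 * X * Y) U V"
  unfolding holomorphic2_on_def case_prod_unfold by (auto intro!: continuous_intros holomorphic_intros)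

definition F3_continuable :: "complex \<Rightarrow> complex \<Rightarrow> complex \<Rightarrow> complex \<Rightarrow> complex \<Rightarrow> bool" where
  "F3_continuable a a' b b' c \<longleftrightarrow> (\<exists>G. appell_F3_continuation a a' b b' c G)"

text \<open>Contiguous relations transport continuations, since their coefficients are polynomials in \<open>X\<close> and \<open>Y\<close>.\<close>
lemma F3_continuation_combine:
  assumes "appell_F3_continuation a1 a1' b1 b1' c1 G1" "appell_F3_continuation a2 a2' b2 b2' c2 G2"
      "appell_F3_continuation a3 a3' b3 b3' c3 G3"
    and "holomorphic2_on P1 cut_plane cut_plane" "holomorphic2_on P2 cut_plane cut_plane" "holomorphic2_on P3 cut_plane cut_plane"
    and "\<And>X Y. norm X < 1 \<Longrightarrow> norm Y < 1 \<Longrightarrow> appell_F3_series a a' b b' c X Y =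
            P1 X Y * appell_F3_series a1 a1' b1 b1' c1 X Y + P2 X Y * appell_F3_series a2 a2' b2 b2' c2 X Y
            + P3 X Y * appell_F3_series a3 a3' b3 b3' c3 X Y"
  shows "appell_F3_continuation a a' b b' c (\<lambda>X Y. P1 X Y * G1 X Y + P2 X Y * G2 X Y + P3 X Y * G3 X Y)"
  unfolding appell_F3_continuation_def
proof (intro conjI allI impI)
  show "holomorphic2_on (\<lambda>X Y. P1 X Y * G1 X Y + P2 X Y * G2 X Y + P3 X Y * G3 X Y) cut_plane cut_plane"
    using assms(1-6) by (intro holomorphic2_on_add holomorphic2_on_mult) (auto simp: appell_F3_continuation_def)
next
  fix X Y :: complex assume "norm X < 1" "norm Y < 1"
  thus "P1 X Y * G1 X Y + P2 X Y * G2 X Y + P3 X Y * G3 X Y = appell_F3_series a a' b b' c X Y"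
    using assms(1-3) by (subst assms(7)) (simp_all add: appell_F3_continuation_def)
qed

text \<open>Trivial factors and summands are kept below, so that the continuations are literal instances of the combination.\<close>
lemma F3_continuation_raise_c:
  assumes "Re c > 0"
    and "appell_F3_continuation a a' b b' (c + 1) G1" "appell_F3_continuation (a + 1) a' (b + 1) b' (c + 2) G2"
      "appell_F3_continuation a (a' + 1) b (b' + 1) (c + 2) G3"
  shows "appell_F3_continuation a a' b b' c
     (\<lambda>X Y. 1 * G1 X Y + (a * b / (c * (c + 1)) * X) * G2 X Y + (a' * b' / (c * (c + 1)) * Y) * G3 X Y)"
  by (rule F3_continuation_combine[OF assms(2-4)])
     (insert
      holomorphic2_on_bilinear[of 1 0 0 0]
      holomorphic2_on_bilinear[of 0 "a * b / (c * (c + 1))" 0 0]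
      holomorphic2_on_bilinear[of 0 0 "a' * b' / (c * (c + 1))" 0],
      simp_all only: mult_zero_left add_0_left add_0_right mult_1_left mult_minus1 diff_conv_add_uminus add_0,
      subst F3_series_raise_c[OF assms(1)], simp_all)

lemma F3_continuation_raise_b:
  assumes "Re c > 0"
    and "appell_F3_continuation a a' (b + 1) b' c G1" "appell_F3_continuation a a' (b + 1) b' (c + 1) G2"
      "appell_F3_continuation a (a' + 1) (b + 1) (b' + 1) (c + 2) G3"
  shows "appell_F3_continuation a a' b b' c
     (\<lambda>X Y. (1 - X) * G1 X Y + ((c - a) / c * X) * G2 X Y + (a' * b' / (c * (c + 1)) * X * Y) * G3 X Y)"
  by (rule F3_continuation_combine[OF assms(2-4)])
     (insert
      holomorphic2_on_bilinear[of 1 "-1" 0 0]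
      holomorphic2_on_bilinear[of 0 "(c - a) / c" 0 0]
      holomorphic2_on_bilinear[of 0 0 0 "a' * b' / (c * (c + 1))"],
      simp_all only: mult_zero_left add_0_left add_0_right mult_1_left mult_minus1 diff_conv_add_uminus add_0,
      subst F3_series_raise_b[OF assms(1)], simp_all)

lemma F3_continuation_raise_b':
  assumes "Re c > 0"
    and "appell_F3_continuation a a' b (b' + 1) c G1" "appell_F3_continuation a (a' + 1) b (b' + 1) (c + 1) G2"
  shows "appell_F3_continuation a a' b b' c (\<lambda>X Y. 1 * G1 X Y + (- a' / c * Y) * G2 X Y + 0 * G2 X Y)"
  by (rule F3_continuation_combine[OF assms(2,3,3)])
     (insert
      holomorphic2_on_bilinear[of 1 0 0 0]
      holomorphic2_on_bilinear[of 0 0 "- a' / c" 0]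
      holomorphic2_on_bilinear[of 0 0 0 0],
      simp_all only: mult_zero_left add_0_left add_0_right mult_1_left mult_minus1 diff_conv_add_uminus add_0,
      subst F3_series_raise_b'[OF assms(1)], simp_all)

text \<open>Each of the three terms of the relation for \<open>c\<close> raises \<open>c - b - b'\<close> by one and lowers none of \<open>b, b', c\<close>, so
that finitely many applications lead to Euler integrals. The two lemmas after this one remove the conditions
on \<open>b\<close> and on \<open>b'\<close> in the same way.\<close>
lemma F3_continuable_pos:
  assumes "Re b > 0" "Re b' > 0" "Re c > 0"
  shows "F3_continuable a a' b b' c"
proof -
  have "F3_continuable a a' b b' c" if "Re b > 0" "Re b' > 0" "Re c > 0" "Re (c - b - b') + real N > 0" for N a a' b b' c
    using that
  proof (induction N arbitrary: a a' b b' c)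
    case 0
    thus ?case using F3_Euler_continuation[of b b' c a a'] by (auto simp: F3_continuable_def)
  next
    case (Suc N)
    have "F3_continuable a a' b b' (c + 1)" "F3_continuable (a + 1) a' (b + 1) b' (c + 2)"
        "F3_continuable a (a' + 1) b (b' + 1) (c + 2)"
      by (intro Suc.IH; use Suc.prems in simp)+
    thus ?case using F3_continuation_raise_c[OF Suc.prems(3)] unfolding F3_continuable_def by blast
  qed
  moreover obtain N :: nat where "- Re (c - b - b') < real N" using reals_Archimedean2 by blast
  hence "Re (c - b - b') + real N > 0" by linarith
  ultimately show ?thesis using assms by blast
qed

lemma F3_continuable_pos_b':
  assumes "Re b' > 0" "Re c > 0"
  shows "F3_continuable a a' b b' c"
proof -
  have "F3_continuable a a' b b' c" if "Re b' > 0" "Re c > 0" "Re b + real N > 0" for N a a' b b' c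
    using that
  proof (induction N arbitrary: a a' b b' c)
    case 0
    thus ?case using F3_continuable_pos by simp
  next
    case (Suc N)
    have "F3_continuable a a' (b + 1) b' c" "F3_continuable a a' (b + 1) b' (c + 1)"
        "F3_continuable a (a' + 1) (b + 1) (b' + 1) (c + 2)"
      by (intro Suc.IH; use Suc.prems in simp)+
    thus ?case using F3_continuation_raise_b[OF Suc.prems(2)] unfolding F3_continuable_def by blast
  qed
  moreover obtain N :: nat where "- Re b < real N" using reals_Archimedean2 by blast
  hence "Re b + real N > 0" by linarith
  ultimately show ?thesis using assms by blast
qed

lemma F3_continuable:
  assumes "Re c > 0"
  shows "F3_continuable a a' b b' c"
proof -
  have "F3_continuable a a' b b' c" if "Re c > 0" "Re b' + real N > 0" for N a a' b b' c
    using that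
  proof (induction N arbitrary: a a' b b' c)
    case 0
    thus ?case using F3_continuable_pos_b' by simp
  next
    case (Suc N)
    have "F3_continuable a a' b (b' + 1) c" "F3_continuable a (a' + 1) b (b' + 1) (c + 1)"
      by (intro Suc.IH; use Suc.prems in simp)+
    thus ?case using F3_continuation_raise_b'[OF Suc.prems(1)] unfolding F3_continuable_def by blast
  qed
  moreover obtain N :: nat where "- Re b' < real N" using reals_Archimedean2 by blast
  hence "Re b' + real N > 0" by linarith
  ultimately show ?thesis using assms by blast
qed

text \<open>The function defined through a description of its values is itself a continuation, so the contiguous
relations hold for it on the whole domain by uniqueness.\<close>
lemma appell_F3_is_continuation:
  assumes "Re c > 0"
  shows "appell_F3_continuation a a' b b' c (appell_F3 a a' b b' c)"
proof -
  obtain G where G: "appell_F3_continuation a a' b b' c G"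
    using F3_continuable[OF assms] unfolding F3_continuable_def by blast
  have eq: "appell_F3 a a' b b' c X Y = G X Y" if "X \<in> cut_plane" "Y \<in> cut_plane" for X Y
    using appell_F3_eqI[OF G that] .
  have "holomorphic2_on (appell_F3 a a' b b' c) cut_plane cut_plane \<longleftrightarrow> holomorphic2_on G cut_plane cut_plane"
    unfolding holomorphic2_on_def
    by (intro conj_cong continuous_on_cong ball_cong holomorphic_cong) (auto simp: eq)
  moreover have "appell_F3 a a' b b' c X Y = G X Y" if "norm X < 1" "norm Y < 1" for X Y
    using that ball_subset_cut_plane by (intro eq) auto
  ultimately show ?thesis using G unfolding appell_F3_continuation_def by simp
qed

section \<open>The integral kernel in the range of the Euler integral\<close>

text \<open>The integrand for a single power after the substitution \<open>t = x(1 + W)\<close>. Dividing \<open>F\<^sub>3\<close> by \<open>\<Gamma>(c)\<close> removes the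
denominators from the contiguous relations.\<close>
definition MSM_kernel ::
    "complex \<Rightarrow> complex \<Rightarrow> complex \<Rightarrow> complex \<Rightarrow> complex \<Rightarrow> complex \<Rightarrow> real \<Rightarrow> complex" where
  "MSM_kernel a a' b b' c T W = ppow (c - 1) W * ppow (- T) (1 + W) *
     (rGamma c * appell_F3 a a' b b' c (of_real (W / (1 + W))) (of_real (- W)))"

text \<open>The value of the integral, which as a function of \<open>T\<close> is a Mellin transform. Reciprocal Gamma functions make it
meaningful for all admissible parameters, including those at which a Gamma function in the denominator has a pole.\<close>
definition MSM_mellin ::
    "complex \<Rightarrow> complex \<Rightarrow> complex \<Rightarrow> complex \<Rightarrow> complex \<Rightarrow> complex \<Rightarrow> complex" where
  "MSM_mellin a a' b b' c T = Gamma (T - a - b) * Gamma (T + a' - c) * Gamma (T + b' - c) *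
     rGamma (T - a) * rGamma (T - b) * rGamma (T + a' + b' - c)"

text \<open>The condition on \<open>c\<close> makes the integral over \<open>W\<close> converge at zero, the other three make it converge at infinity.\<close>
definition MSM_admissible ::
    "complex \<Rightarrow> complex \<Rightarrow> complex \<Rightarrow> complex \<Rightarrow> complex \<Rightarrow> complex \<Rightarrow> bool" where
  "MSM_admissible a a' b b' c T \<longleftrightarrow>
     Re c > 0 \<and> Re (T - a - b) > 0 \<and> Re (T + a' - c) > 0 \<and> Re (T + b' - c) > 0"

lemma locus_in_cut_plane:
  assumes "W \<ge> 0"
  shows "of_real (W / (1 + W)) \<in> cut_plane" "of_real (- W) \<in> cut_plane"
  using assms by (auto simp: cut_plane_iff field_simps)

lemma MSM_kernel_0 [simp]: "W \<le> 0 \<Longrightarrow> MSM_kernel a a' b b' c T W = 0"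
  by (simp add: MSM_kernel_def)

text \<open>With \<open>X = W/(1 + W)\<close> and \<open>Y = -W\<close> the two kernels of the Euler integral become
\<open>(1 + W)\<^bsup>a\<^esup> (1 + sW)\<^bsup>-a\<^esup>\<close> and \<open>(1 + vsW)\<^bsup>-a'\<^esup>\<close>. Both the integration over \<open>s\<close> and the one over \<open>v\<close> thus have the shape
of \<open>Beta_kernel_composition\<close>.\<close>
lemma MSM_kernel_base:
  assumes adm: "MSM_admissible a a' b b' c T"
    and b: "Re b > 0" and b': "Re b' > 0" and e: "Re (c - b - b') > 0"
  shows "has_bochner_integral lborel (MSM_kernel a a' b b' c T) (MSM_mellin a a' b b' c T)"
proof -
  let ?e = "c - b - b'"
  let ?p = "T - a - b" let ?q = "T + a' - c" let ?r = "T + b' - c"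
  define H where "H = (\<lambda>Z. LINT v|lborel. ppow (b' - 1) v * ppow (?e - 1) (1 - v) * ppow (- a') (1 + v * Z))"
  define h where "h = (\<lambda>Z. ppow (- a) (1 + Z) * H Z)"
  define \<kappa> where "\<kappa> = inverse (Gamma b * Gamma b' * Gamma ?e)"
  have Re: "Re ?p > 0" "Re ?q > 0" "Re ?r > 0" "Re c > 0"
    using adm by (auto simp: MSM_admissible_def)
  have [measurable]: "H \<in> borel_measurable borel" unfolding H_def by measurable
  have [measurable]: "h \<in> borel_measurable borel" unfolding h_def by measurable

  \<comment> \<open>From the inside out: the remaining integral over the half-line, then the integration over \<open>v\<close>, then over \<open>s\<close>.\<close>
  have "has_bochner_integral lborel (\<lambda>Z. ppow (b' - 1) Z * ppow (- (b' + ?q)) (1 + Z)) (Beta b' ?q)"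
    by (rule has_bochner_integral_Beta_halfline_aux) (use Re b' in auto)
  moreover have "ppow (- (b' + ?q)) t = ppow (?e - (T - b)) t * ppow (- a') t" for t
    by (simp flip: ppow_add) (simp add: algebra_simps)
  ultimately have "has_bochner_integral lborel
      (\<lambda>Z. ppow ((c - b) - ?e - 1) Z * ppow (?e - (T - b)) (1 + Z) * ppow (- a') (1 + Z)) (Beta b' ?q)"
    by (simp add: mult.assoc)
  from Beta_kernel_composition[OF _ _ _ this]
  have "has_bochner_integral lborel (\<lambda>Z. ppow (c - b - 1) Z * ppow (- (T - b)) (1 + Z) * H Z)
          (Beta (T - b - ?e) ?e * Beta b' ?q)"
    using e Re by (simp add: H_def algebra_simps)
  moreover have "T - b - ?e = ?r" by simp
  moreover have "ppow (- (T - b)) t = ppow (b - (T - a)) t * ppow (- a) t" for t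
    by (simp flip: ppow_add)
  ultimately have "has_bochner_integral lborel
      (\<lambda>Z. ppow (c - b - 1) Z * ppow (b - (T - a)) (1 + Z) * h Z) (Beta ?r ?e * Beta b' ?q)"
    by (simp add: h_def mult.assoc)
  from Beta_kernel_composition[OF _ _ _ this]
  have "has_bochner_integral lborel (\<lambda>W. ppow (c - 1) W * ppow (- (T - a)) (1 + W) *
          (LINT s|lborel. ppow (c - b - 1) s * ppow (b - 1) (1 - s) * h (s * W)))
          (Beta ?p b * (Beta ?r ?e * Beta b' ?q))"
    using b Re by simp
  from has_bochner_integral_mult_right[OF this, of \<kappa>]
  have "has_bochner_integral lborel (\<lambda>W. \<kappa> * (ppow (c - 1) W * ppow (- (T - a)) (1 + W) *
          (LINT s|lborel. ppow (c - b - 1) s * ppow (b - 1) (1 - s) * h (s * W))))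
          (\<kappa> * (Beta ?p b * (Beta ?r ?e * Beta b' ?q)))" .
  moreover have "\<kappa> * (Beta ?p b * (Beta ?r ?e * Beta b' ?q)) = MSM_mellin a a' b b' c T"
  proof -
    have nz: "Gamma b \<noteq> 0" "Gamma b' \<noteq> 0" "Gamma ?e \<noteq> 0"
      by (rule Gamma_nonzero_of_Re_pos, fact)+
    have "?p + b = T - a" "?r + ?e = T - b" "b' + ?q = T + a' + b' - c" by (simp_all add: algebra_simps)
    thus ?thesis
      unfolding \<kappa>_def Beta_altdef MSM_mellin_def using nz by (simp add: field_simps)
  qed
  moreover have "\<kappa> * (ppow (c - 1) W * ppow (- (T - a)) (1 + W) *
          (LINT s|lborel. ppow (c - b - 1) s * ppow (b - 1) (1 - s) * h (s * W))) = MSM_kernel a a' b b' c T W" for W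
  proof (cases "W > 0")
    case W: True
    let ?X = "complex_of_real (W / (1 + W))" and ?Y = "complex_of_real (- W)"
    let ?f = "\<lambda>z. Euler_weight b b' c z *
        Euler_kernel a (clamp01 (1 - fst z)) ?X * Euler_kernel a' (clamp01 (fst z) * clamp01 (snd z)) ?Y"
    have cut: "?X \<in> cut_plane" "?Y \<in> cut_plane" using locus_in_cut_plane[of W] W by auto
    have f: "?f (s, v) = ppow (c - b - 1) s * ppow (b - 1) (1 - s) * (ppow a (1 + W) * ppow (- a) (1 + s * W)) *
        (ppow (b' - 1) v * ppow (?e - 1) (1 - v) * ppow (- a') (1 + v * (s * W)))" for s v
    proof (cases "0 < s \<and> s < 1 \<and> 0 < v \<and> v < 1")
      case True
      hence pos: "s * W > 0" "v * (s * W) > 0" using W by auto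
      have "1 - of_real (1 - s) * ?X = of_real ((1 + s * W) / (1 + W))"
        using W by (simp add: field_simps flip: of_real_mult of_real_diff of_real_add)
      hence "Euler_kernel a (1 - s) ?X = ppow (- a) ((1 + s * W) / (1 + W))"
        using pos W by (simp only: Euler_kernel_def ppow_def) simp
      also have "\<dots> = ppow a (1 + W) * ppow (- a) (1 + s * W)"
        using pos W by (subst ppow_divide) auto
      finally have 1: "Euler_kernel a (1 - s) ?X = ppow a (1 + W) * ppow (- a) (1 + s * W)" .
      have "1 - of_real (s * v) * ?Y = complex_of_real (1 + v * (s * W))" by (simp add: mult_ac)
      hence 2: "Euler_kernel a' (s * v) ?Y = ppow (- a') (1 + v * (s * W))"
        using pos by (simp only: Euler_kernel_def ppow_def) simp
      show ?thesis using True 1 2 by (simp add: Euler_weight_def clamp01_eq mult_ac)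
    next
      case False
      thus ?thesis by (cases "s > 0"; cases "v > 0") (auto simp: Euler_weight_def not_less)
    qed
    have int: "integrable (lborel \<Otimes>\<^sub>M lborel) ?f"
    proof (intro integrable_mult_Euler_kernel Euler_weight_integrable assms cut clamp01_in clamp01_mult_in)
    qed measurable
    have "F3_Euler a a' b b' c ?X ?Y = F3_Euler_const b b' c * (LINT s|lborel. LINT v|lborel. ?f (s, v))"
      unfolding F3_Euler_def using lborel_pair.integral_fst'[OF int] by simp
    also have "(LINT s|lborel. LINT v|lborel. ?f (s, v)) =
        (LINT s|lborel. ppow a (1 + W) * (ppow (c - b - 1) s * ppow (b - 1) (1 - s) * h (s * W)))"
      unfolding f h_def H_def by (subst integral_mult_right_zero) (simp add: mult_ac)
    also have "\<dots> = ppow a (1 + W) * (LINT s|lborel. ppow (c - b - 1) s * ppow (b - 1) (1 - s) * h (s * W))"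
      by (rule integral_mult_right_zero)
    finally have "rGamma c * appell_F3 a a' b b' c ?X ?Y = rGamma c * F3_Euler_const b b' c * (ppow a (1 + W) *
        (LINT s|lborel. ppow (c - b - 1) s * ppow (b - 1) (1 - s) * h (s * W)))"
      using appell_F3_eqI[OF F3_Euler_continuation[OF b b' e] cut] by simp
    moreover have "rGamma c * F3_Euler_const b b' c = \<kappa>"
      using Gamma_nonzero_of_Re_pos[OF Re(4)]
      by (simp add: F3_Euler_const_def \<kappa>_def rGamma_inverse_Gamma divide_inverse)
    moreover have "ppow (- (T - a)) (1 + W) = ppow (- T) (1 + W) * ppow a (1 + W)"
      by (simp flip: ppow_add)
    ultimately show ?thesis by (simp add: MSM_kernel_def mult_ac)
  qed simp
  ultimately show ?thesis by simp
qed

section \<open>Contiguous relations of the kernel\<close>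

lemma rGamma_shift: "rGamma c = c * rGamma (c + 1)" "rGamma c = c * (c + 1) * rGamma (c + 2)" for c :: complex
proof -
  show 1: "rGamma c = c * rGamma (c + 1)" for c :: complex by (simp add: rGamma_plus1)
  show "rGamma c = c * (c + 1) * rGamma (c + 2)" using 1[of c] 1[of "c + 1"] by (simp add: add.assoc)
qed

lemma appell_F3_raise_c:
  assumes c: "Re c > 0" and X: "X \<in> cut_plane" and Y: "Y \<in> cut_plane"
  shows "rGamma c * appell_F3 a a' b b' c X Y =
     c * (rGamma (c + 1) * appell_F3 a a' b b' (c + 1) X Y)
     + a * b * X * (rGamma (c + 2) * appell_F3 (a + 1) a' (b + 1) b' (c + 2) X Y)
     + a' * b' * Y * (rGamma (c + 2) * appell_F3 a (a' + 1) b (b' + 1) (c + 2) X Y)"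
proof -
  have c': "Re (c + 1) > 0" "Re (c + 2) > 0" and nz: "c \<noteq> 0" "c + 1 \<noteq> 0"
    using c by (auto simp: complex_eq_iff)
  define k where "k = c * (c + 1)"
  define R where "R = rGamma c / k"
  have k: "k \<noteq> 0" using nz by (simp add: k_def)
  have R1: "c * rGamma (c + 1) = rGamma c" and R2: "rGamma (c + 2) = R"
    using rGamma_shift(1)[of c] rGamma_shift(2)[of c] k by (simp_all add: R_def k_def)
  have R: "rGamma c = k * R" using k by (simp add: R_def)
  note eq = appell_F3_eqI[OF F3_continuation_raise_c[OF c appell_F3_is_continuation[OF c'(1)]
        appell_F3_is_continuation[OF c'(2)] appell_F3_is_continuation[OF c'(2)]] X Y]
  have "rGamma c * (1 * u + (v / k * X) * F + (x / k * Y) * G) = rGamma c * u + v * X * (R * F) + x * Y * (R * G)"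
    for u v F x G :: complex
    using k unfolding R by (simp add: distrib_left)
  thus ?thesis
    unfolding k_def by (subst eq) (simp only: R1 R2 mult.assoc [of c, symmetric])
qed

lemma appell_F3_raise_b:
  assumes c: "Re c > 0" and X: "X \<in> cut_plane" and Y: "Y \<in> cut_plane"
  shows "rGamma c * appell_F3 a a' b b' c X Y =
     (1 - X) * (rGamma c * appell_F3 a a' (b + 1) b' c X Y)
     + (c - a) * X * (rGamma (c + 1) * appell_F3 a a' (b + 1) b' (c + 1) X Y)
     + a' * b' * X * Y * (rGamma (c + 2) * appell_F3 a (a' + 1) (b + 1) (b' + 1) (c + 2) X Y)"
proof -
  have c': "Re (c + 1) > 0" "Re (c + 2) > 0" and nz: "c \<noteq> 0" "c + 1 \<noteq> 0"
    using c by (auto simp: complex_eq_iff)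
  define k where "k = c * (c + 1)"
  define R where "R = rGamma c / k"
  have k: "k \<noteq> 0" using nz by (simp add: k_def)
  have R1: "rGamma (c + 1) = rGamma c / c" and R2: "rGamma (c + 2) = R"
    using rGamma_shift(1)[of c] rGamma_shift(2)[of c] k nz by (simp_all add: R_def k_def)
  have R: "rGamma c = k * R" using k by (simp add: R_def)
  have RR: "rGamma c * (u + v / c * X * F + x / k * X * Y * G) = rGamma c * u + v * X * (rGamma c / c * F) + x * X * Y * (R * G)"
    for u v F x G :: complex
    using nz k unfolding R by (simp add: distrib_left)
  note eq = appell_F3_eqI[OF F3_continuation_raise_b[OF c appell_F3_is_continuation[OF c]
        appell_F3_is_continuation[OF c'(1)] appell_F3_is_continuation[OF c'(2)]] X Y]
  show ?thesis
    unfolding R1 R2 by (subst eq, subst RR [unfolded k_def]) (simp add: mult_ac)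
qed

lemma appell_F3_raise_b':
  assumes c: "Re c > 0" and X: "X \<in> cut_plane" and Y: "Y \<in> cut_plane"
  shows "rGamma c * appell_F3 a a' b b' c X Y =
     rGamma c * appell_F3 a a' b (b' + 1) c X Y
     - a' * Y * (rGamma (c + 1) * appell_F3 a (a' + 1) b (b' + 1) (c + 1) X Y)"
proof -
  have c': "Re (c + 1) > 0" and nz: "c \<noteq> 0" using c by (auto simp: complex_eq_iff)
  note eq = appell_F3_eqI[OF F3_continuation_raise_b'[OF c appell_F3_is_continuation[OF c]
        appell_F3_is_continuation[OF c']] X Y]
  have "rGamma (c + 1) = rGamma c / c" using rGamma_shift(1)[of c] nz by (simp add: field_simps)
  thus ?thesis by (subst eq) (simp add: algebra_simps)
qed

lemma ppow_plus_1: "t > 0 \<Longrightarrow> ppow (z + 1) t = of_real t * ppow z t"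
  by (simp add: ppow_add ppow_one)

lemma MSM_kernel_factors:
  fixes c T :: complex
  assumes W: "W > 0"
  shows "ppow (c + 1 - 1) W = of_real W * ppow (c - 1) W"
    and "ppow (c + 2 - 1) W = of_real W * of_real W * ppow (c - 1) W"
    and "ppow (- (T + 1)) (1 + W) = ppow (- T) (1 + W) * inverse (1 + of_real W)"
    and "ppow (- (T + 2)) (1 + W) = ppow (- T) (1 + W) * inverse (1 + of_real W) * inverse (1 + of_real W)"
proof -
  show "ppow (c + 1 - 1) W = of_real W * ppow (c - 1) W"
       "ppow (c + 2 - 1) W = of_real W * of_real W * ppow (c - 1) W"
    using ppow_plus_1[OF W, of "c - 1"] ppow_plus_1[OF W, of c] W by (simp_all add: add.commute)
  have w: "1 + complex_of_real W \<noteq> 0" using W by (simp add: complex_eq_iff)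
  have s: "ppow (- (z + 1)) (1 + W) = ppow (- z) (1 + W) * inverse (1 + of_real W)" for z
    using ppow_plus_1[of "1 + W" "- (z + 1)"] W w by (simp add: field_simps)
  show "ppow (- (T + 1)) (1 + W) = ppow (- T) (1 + W) * inverse (1 + of_real W)" by (rule s)
  show "ppow (- (T + 2)) (1 + W) = ppow (- T) (1 + W) * inverse (1 + of_real W) * inverse (1 + of_real W)"
    using s[of "T + 1"] s[of T] by (simp add: add.assoc)
qed

text \<open>The relation for \<open>F\<^sub>3\<close> has to be multiplied by \<open>X = W/(1 + W)\<close>, because only then all its terms are kernels; since
\<open>1 - X = 1/(1 + W)\<close>, this factor turns the left-hand side into a difference in \<open>T\<close>.\<close>
lemma MSM_kernel_raise_c:
  assumes c: "Re c > 0"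
  shows "MSM_kernel a a' b b' c T W - MSM_kernel a a' b b' c (T + 1) W =
     c * MSM_kernel a a' b b' (c + 1) (T + 1) W + a * b * MSM_kernel (a + 1) a' (b + 1) b' (c + 2) (T + 2) W
     - a' * b' * MSM_kernel a (a' + 1) b (b' + 1) (c + 2) (T + 1) W"
    and "W > 0 \<Longrightarrow> MSM_kernel a a' b b' c T W - MSM_kernel a a' b b' c (T + 1) W =
          of_real (W / (1 + W)) * MSM_kernel a a' b b' c T W"
proof -
  have *: "(MSM_kernel a a' b b' c T W - MSM_kernel a a' b b' c (T + 1) W =
     c * MSM_kernel a a' b b' (c + 1) (T + 1) W + a * b * MSM_kernel (a + 1) a' (b + 1) b' (c + 2) (T + 2) W
     - a' * b' * MSM_kernel a (a' + 1) b (b' + 1) (c + 2) (T + 1) W) \<and>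
     MSM_kernel a a' b b' c T W - MSM_kernel a a' b b' c (T + 1) W =
          of_real (W / (1 + W)) * MSM_kernel a a' b b' c T W" if W: "W > 0"
  proof -
    define X where "X = complex_of_real (W / (1 + W))"
    define Y where "Y = complex_of_real (- W)"
    have XY: "X \<in> cut_plane" "Y \<in> cut_plane"
      unfolding X_def Y_def by (rule locus_in_cut_plane, use W in simp)+
    define J where "J = (\<lambda>a a' b b' c. rGamma c * appell_F3 a a' b b' c X Y)"
    have K: "MSM_kernel a a' b b' c T W = ppow (c - 1) W * ppow (- T) (1 + W) * J a a' b b' c" for a a' b b' c T
      by (simp add: MSM_kernel_def X_def Y_def J_def)
    define P where "P = ppow (c - 1) W * ppow (- T) (1 + W)"
    define w where "w = complex_of_real W"
    define i where "i = inverse (1 + w)"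
    have "1 + w \<noteq> 0" using W by (simp add: w_def complex_eq_iff)
    hence i: "1 - i = w * i" by (simp add: i_def field_simps)
    note alg = MSM_kernel_factors[OF W, folded w_def, folded i_def]
    have X: "X = w * i" and Y: "Y = - w" by (simp_all add: X_def Y_def w_def i_def divide_inverse)
    have J: "J a a' b b' c = c * J a a' b b' (c + 1) + a * b * X * J (a + 1) a' (b + 1) b' (c + 2)
          + a' * b' * Y * J a (a' + 1) b (b' + 1) (c + 2)"
      unfolding J_def by (rule appell_F3_raise_c[OF c XY])
    have diff: "MSM_kernel a a' b b' c T W - MSM_kernel a a' b b' c (T + 1) W = X * (P * J a a' b b' c)"
      unfolding K P_def alg X i [symmetric] by (simp add: algebra_simps)
    moreover have "MSM_kernel a a' b b' c T W = P * J a a' b b' c"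
      by (simp add: K P_def)
    moreover have "X * (P * J a a' b b' c) =
      c * MSM_kernel a a' b b' (c + 1) (T + 1) W + a * b * MSM_kernel (a + 1) a' (b + 1) b' (c + 2) (T + 2) W
       - a' * b' * MSM_kernel a (a' + 1) b (b' + 1) (c + 2) (T + 1) W"
      unfolding K P_def alg J X Y by (simp add: algebra_simps)
    ultimately show ?thesis by (simp add: X_def)
  qed
  show "MSM_kernel a a' b b' c T W - MSM_kernel a a' b b' c (T + 1) W =
     c * MSM_kernel a a' b b' (c + 1) (T + 1) W + a * b * MSM_kernel (a + 1) a' (b + 1) b' (c + 2) (T + 2) W
     - a' * b' * MSM_kernel a (a' + 1) b (b' + 1) (c + 2) (T + 1) W"
    using * by (cases "W > 0") auto
  show "W > 0 \<Longrightarrow> MSM_kernel a a' b b' c T W - MSM_kernel a a' b b' c (T + 1) W =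
          of_real (W / (1 + W)) * MSM_kernel a a' b b' c T W"
    using * by blast
qed

lemma MSM_kernel_raise_b:
  assumes c: "Re c > 0"
  shows "MSM_kernel a a' b b' c T W =
     MSM_kernel a a' (b + 1) b' c (T + 1) W + (c - a) * MSM_kernel a a' (b + 1) b' (c + 1) (T + 1) W
     - a' * b' * MSM_kernel a (a' + 1) (b + 1) (b' + 1) (c + 2) (T + 1) W"
proof (cases "W > 0")
  case W: True
  define X where "X = complex_of_real (W / (1 + W))"
  define Y where "Y = complex_of_real (- W)"
  have XY: "X \<in> cut_plane" "Y \<in> cut_plane"
    unfolding X_def Y_def by (rule locus_in_cut_plane, use W in simp)+
  define J where "J = (\<lambda>a a' b b' c. rGamma c * appell_F3 a a' b b' c X Y)"
  have K: "MSM_kernel a a' b b' c T W = ppow (c - 1) W * ppow (- T) (1 + W) * J a a' b b' c" for a a' b b' c T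
    by (simp add: MSM_kernel_def X_def Y_def J_def)
  note alg = MSM_kernel_factors[OF W]
  have J: "J a a' b b' c = (1 - X) * J a a' (b + 1) b' c + (c - a) * X * J a a' (b + 1) b' (c + 1)
          + a' * b' * X * Y * J a (a' + 1) (b + 1) (b' + 1) (c + 2)"
    unfolding J_def by (rule appell_F3_raise_b[OF c XY])
  define i where "i = inverse (1 + complex_of_real W)"
  have "1 + complex_of_real W \<noteq> 0" using W by (simp add: complex_eq_iff)
  hence i: "1 - of_real W * i = i" by (simp add: i_def field_simps)
  have X: "X = of_real W * i" and Y: "Y = - of_real W"
    by (simp_all add: X_def Y_def i_def divide_inverse)
  show ?thesis
    unfolding K alg J[unfolded X i] Y i_def [symmetric] by (simp add: algebra_simps)
qed simp

lemma MSM_kernel_raise_b':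
  assumes c: "Re c > 0"
  shows "MSM_kernel a a' b b' c T W =
     MSM_kernel a a' b (b' + 1) c T W + a' * MSM_kernel a (a' + 1) b (b' + 1) (c + 1) T W"
proof (cases "W > 0")
  case W: True
  have XY: "complex_of_real (W / (1 + W)) \<in> cut_plane" "complex_of_real (- W) \<in> cut_plane"
    by (rule locus_in_cut_plane, use W in simp)+
  show ?thesis
    unfolding MSM_kernel_def appell_F3_raise_b'[OF c XY, of a a' b b'] MSM_kernel_factors(1)[OF W]
    by (simp add: algebra_simps)
qed simp

section \<open>Recurrences and decay of the Gamma quotient\<close>

lemma Gamma_shift: "Re z > 0 \<Longrightarrow> Gamma (z + 1) = z * Gamma z" for z :: complex
  by (rule Gamma_plus1) (rule not_nonpos_Int_of_Re_pos)

text \<open>The Gamma quotient satisfies the same relations as the kernel. After division by a common Gamma quotient \<open>N\<close>, each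
of them is a polynomial identity in the parameters.\<close>
lemma MSM_mellin_raise_c:
  assumes "MSM_admissible a a' b b' c T"
  shows "MSM_mellin a a' b b' c T - MSM_mellin a a' b b' c (T + 1) =
     c * MSM_mellin a a' b b' (c + 1) (T + 1) + a * b * MSM_mellin (a + 1) a' (b + 1) b' (c + 2) (T + 2)
     - a' * b' * MSM_mellin a (a' + 1) b (b' + 1) (c + 2) (T + 1)"
proof -
  define p where "p = T - a - b"
  define q where "q = T + a' - c"
  define r where "r = T + b' - c"
  define u where "u = T - a"
  define v where "v = T - b"
  define s where "s = T + a' + b' - c"
  define N where "N = Gamma p * Gamma q * Gamma r * rGamma (u + 1) * rGamma (v + 1) * rGamma (s + 1)"
  have pos: "Re p > 0" "Re q > 0" "Re r > 0"
    using assms by (auto simp: MSM_admissible_def p_def q_def r_def)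
  have "MSM_mellin a a' b b' c T = Gamma p * Gamma q * Gamma r * rGamma u * rGamma v * rGamma s"
    by (simp add: MSM_mellin_def p_def q_def r_def u_def v_def s_def)
  hence 0: "MSM_mellin a a' b b' c T = u * v * s * N"
    unfolding N_def rGamma_shift(1)[of u] rGamma_shift(1)[of v] rGamma_shift(1)[of s] by (simp add: mult_ac)
  have "MSM_mellin a a' b b' c (T + 1) = Gamma (p + 1) * Gamma (q + 1) * Gamma (r + 1) * rGamma (u + 1) * rGamma (v + 1) * rGamma (s + 1)"
    by (simp add: MSM_mellin_def p_def q_def r_def u_def v_def s_def algebra_simps)
  hence 1: "MSM_mellin a a' b b' c (T + 1) = p * q * r * N"
    unfolding N_def Gamma_shift[OF pos(1)] Gamma_shift[OF pos(2)] Gamma_shift[OF pos(3)] by (simp add: mult_ac)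
  have "MSM_mellin a a' b b' (c + 1) (T + 1) = Gamma (p + 1) * Gamma q * Gamma r * rGamma (u + 1) * rGamma (v + 1) * rGamma s"
    by (simp add: MSM_mellin_def p_def q_def r_def u_def v_def s_def algebra_simps)
  hence 2: "MSM_mellin a a' b b' (c + 1) (T + 1) = p * s * N"
    unfolding N_def Gamma_shift[OF pos(1)] rGamma_shift(1)[of s] by (simp add: mult_ac)
  have "MSM_mellin (a + 1) a' (b + 1) b' (c + 2) (T + 2) = Gamma p * Gamma q * Gamma r * rGamma (u + 1) * rGamma (v + 1) * rGamma s"
    by (simp add: MSM_mellin_def p_def q_def r_def u_def v_def s_def algebra_simps)
  hence 3: "MSM_mellin (a + 1) a' (b + 1) b' (c + 2) (T + 2) = s * N"
    unfolding N_def rGamma_shift(1)[of s] by (simp add: mult_ac)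
  have "MSM_mellin a (a' + 1) b (b' + 1) (c + 2) (T + 1) = Gamma (p + 1) * Gamma q * Gamma r * rGamma (u + 1) * rGamma (v + 1) * rGamma (s + 1)"
    by (simp add: MSM_mellin_def p_def q_def r_def u_def v_def s_def algebra_simps)
  hence 4: "MSM_mellin a (a' + 1) b (b' + 1) (c + 2) (T + 1) = p * N"
    unfolding N_def Gamma_shift[OF pos(1)] by (simp add: mult_ac)
  have "u * v * s - p * q * r = c * (p * s) + a * b * s - a' * b' * p"
    by (simp add: p_def q_def r_def u_def v_def s_def algebra_simps)
  from arg_cong[OF this, of "\<lambda>z. z * N"] show ?thesis
    unfolding 0 1 2 3 4 by (simp add: algebra_simps)
qed

lemma MSM_mellin_raise_b:
  assumes "MSM_admissible a a' b b' c T"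
  shows "MSM_mellin a a' b b' c T =
     MSM_mellin a a' (b + 1) b' c (T + 1) + (c - a) * MSM_mellin a a' (b + 1) b' (c + 1) (T + 1)
     - a' * b' * MSM_mellin a (a' + 1) (b + 1) (b' + 1) (c + 2) (T + 1)"
proof -
  define p where "p = T - a - b"
  define q where "q = T + a' - c"
  define r where "r = T + b' - c"
  define u where "u = T - a"
  define v where "v = T - b"
  define s where "s = T + a' + b' - c"
  define N where "N = Gamma p * Gamma q * Gamma r * rGamma (u + 1) * rGamma v * rGamma (s + 1)"
  have pos: "Re p > 0" "Re q > 0" "Re r > 0"
    using assms by (auto simp: MSM_admissible_def p_def q_def r_def)
  have "MSM_mellin a a' b b' c T = Gamma p * Gamma q * Gamma r * rGamma u * rGamma v * rGamma s"
    by (simp add: MSM_mellin_def p_def q_def r_def u_def v_def s_def)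
  hence 0: "MSM_mellin a a' b b' c T = u * s * N"
    unfolding N_def rGamma_shift(1)[of u] rGamma_shift(1)[of s] by (simp add: mult_ac)
  have "MSM_mellin a a' (b + 1) b' c (T + 1) = Gamma p * Gamma (q + 1) * Gamma (r + 1) * rGamma (u + 1) * rGamma v * rGamma (s + 1)"
    by (simp add: MSM_mellin_def p_def q_def r_def u_def v_def s_def algebra_simps)
  hence 1: "MSM_mellin a a' (b + 1) b' c (T + 1) = q * r * N"
    unfolding N_def Gamma_shift[OF pos(2)] Gamma_shift[OF pos(3)] by (simp add: mult_ac)
  have "MSM_mellin a a' (b + 1) b' (c + 1) (T + 1) = Gamma p * Gamma q * Gamma r * rGamma (u + 1) * rGamma v * rGamma s"
    by (simp add: MSM_mellin_def p_def q_def r_def u_def v_def s_def algebra_simps)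
  hence 2: "MSM_mellin a a' (b + 1) b' (c + 1) (T + 1) = s * N"
    unfolding N_def rGamma_shift(1)[of s] by (simp add: mult_ac)
  have 3: "MSM_mellin a (a' + 1) (b + 1) (b' + 1) (c + 2) (T + 1) = N"
    by (simp add: MSM_mellin_def N_def p_def q_def r_def u_def v_def s_def algebra_simps)
  have "u * s = q * r + (c - a) * s - a' * b'"
    by (simp add: p_def q_def r_def u_def v_def s_def algebra_simps)
  from arg_cong[OF this, of "\<lambda>z. z * N"] show ?thesis
    unfolding 0 1 2 3 by (simp add: algebra_simps)
qed

lemma MSM_mellin_raise_b':
  assumes "MSM_admissible a a' b b' c T"
  shows "MSM_mellin a a' b b' c T =
     MSM_mellin a a' b (b' + 1) c T + a' * MSM_mellin a (a' + 1) b (b' + 1) (c + 1) T"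
proof -
  define r where "r = T + b' - c"
  define s where "s = T + a' + b' - c"
  define N where "N = Gamma (T - a - b) * Gamma (T + a' - c) * Gamma r * rGamma (T - a) * rGamma (T - b) * rGamma (s + 1)"
  have pos: "Re r > 0" using assms by (auto simp: MSM_admissible_def r_def)
  have "MSM_mellin a a' b b' c T = Gamma (T - a - b) * Gamma (T + a' - c) * Gamma r * rGamma (T - a) * rGamma (T - b) * rGamma s"
    by (simp add: MSM_mellin_def r_def s_def)
  hence 0: "MSM_mellin a a' b b' c T = s * N"
    unfolding N_def rGamma_shift(1)[of s] by (simp add: mult_ac)
  have "MSM_mellin a a' b (b' + 1) c T =
      Gamma (T - a - b) * Gamma (T + a' - c) * Gamma (r + 1) * rGamma (T - a) * rGamma (T - b) * rGamma (s + 1)"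
    by (simp add: MSM_mellin_def r_def s_def algebra_simps)
  hence 1: "MSM_mellin a a' b (b' + 1) c T = r * N"
    unfolding N_def Gamma_shift[OF pos] by (simp add: mult_ac)
  have 2: "MSM_mellin a (a' + 1) b (b' + 1) (c + 1) T = N"
    by (simp add: MSM_mellin_def N_def r_def s_def algebra_simps)
  have "s = r + a'" by (simp add: r_def s_def)
  thus ?thesis unfolding 0 1 2 by (simp add: algebra_simps)
qed

lemma rGamma_series_limit:
  assumes "Re z > 0"
  shows "(\<lambda>n. Gamma (z + of_nat (Suc n)) * rGamma z / (fact n * exp (z * of_real (ln (real n))))) \<longlonglongrightarrow> rGamma z"
proof -
  have "pochhammer z (Suc n) = Gamma (z + of_nat (Suc n)) * rGamma z" for n
    using pochhammer_Gamma[of z "Suc n"] not_nonpos_Int_of_Re_pos[OF assms]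
    by (simp add: rGamma_inverse_Gamma divide_inverse)
  thus ?thesis
    using rGamma_series_LIMSEQ[of z] by (simp add: rGamma_series_def[abs_def])
qed

text \<open>\<open>\<Gamma>(z + n + 1)\<close> grows like \<open>n! n\<^bsup>z\<^esup>\<close>; this is Euler's limit formula for the Gamma function.\<close>
lemma Gamma_ratio_limit:
  assumes z: "Re z > 0"
  shows "(\<lambda>n. Gamma (z + of_nat (Suc n)) / (fact n * exp (z * of_real (ln (real n))))) \<longlonglongrightarrow> 1"
proof -
  have nz: "rGamma z \<noteq> 0" using Gamma_nonzero_of_Re_pos[OF z] by (simp add: rGamma_inverse_Gamma)
  from tendsto_divide[OF rGamma_series_limit[OF z] tendsto_const[of "rGamma z"] nz]
  show ?thesis using nz by simp
qed

text \<open>The arguments of the three Gamma functions in the denominator exceed those in the numerator by \<open>c\<close> in total, so that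
the quotient decays like \<open>n\<^bsup>-c\<^esup>\<close>.\<close>
lemma MSM_mellin_tendsto_0:
  assumes c: "Re c > 0" and pos: "Re (T - a - b) > 0" "Re (T + a' - c) > 0" "Re (T + b' - c) > 0"
     "Re (T - a) > 0" "Re (T - b) > 0" "Re (T + a' + b' - c) > 0"
  shows "(\<lambda>n. MSM_mellin a a' b b' c (T + of_nat (Suc n))) \<longlonglongrightarrow> 0"
proof -
  define g where "g = (\<lambda>n z. Gamma (z + of_nat (Suc n)) / (fact n * exp (z * of_real (ln (real n)))) :: complex)"
  define L where "L = (\<lambda>n. g n (T - a - b) * g n (T + a' - c) * g n (T + b' - c) /
                         (g n (T - a) * g n (T - b) * g n (T + a' + b' - c)))"
  have g: "(\<lambda>n. g n z) \<longlonglongrightarrow> 1" if "Re z > 0" for z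
    unfolding g_def by (rule Gamma_ratio_limit[OF that])
  have "L \<longlonglongrightarrow> 1 * 1 * 1 / (1 * 1 * 1)"
    unfolding L_def by (intro tendsto_intros g pos) auto
  moreover have "(\<lambda>n. exp (- c * of_real (ln (real n)))) \<longlonglongrightarrow> 0"
  proof (rule tendsto_norm_zero_cancel)
    have "((\<lambda>n. exp (- Re c * ln (real n))) \<longlongrightarrow> 0) at_top" using c by real_asymp
    thus "(\<lambda>n. norm (exp (- c * of_real (ln (real n))))) \<longlonglongrightarrow> 0" by simp
  qed
  ultimately have "(\<lambda>n. L n * exp (- c * of_real (ln (real n)))) \<longlonglongrightarrow> 1 * 1 * 1 / (1 * 1 * 1) * 0"
    by (rule tendsto_mult)
  moreover have "MSM_mellin a a' b b' c (T + of_nat (Suc n)) = L n * exp (- c * of_real (ln (real n)))" for n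
  proof -
    define E where "E = (\<lambda>z::complex. exp (z * of_real (ln (real n))))"
    have E: "E z \<noteq> 0" "E (z + w) = E z * E w" for z w by (simp_all add: E_def ring_distribs exp_add)
    have G: "Gamma (z + of_nat (Suc n)) = g n z * (fact n * E z)" for z
      by (simp add: g_def E_def)
    have Ec: "E (- c) * (E (T - a) * E (T - b) * E (T + a' + b' - c)) = E (T - a - b) * E (T + a' - c) * E (T + b' - c)"
      by (simp flip: E(2)) (simp add: algebra_simps)
    have "MSM_mellin a a' b b' c (T + of_nat (Suc n)) =
       Gamma (T - a - b + of_nat (Suc n)) * Gamma (T + a' - c + of_nat (Suc n)) * Gamma (T + b' - c + of_nat (Suc n)) /
       (Gamma (T - a + of_nat (Suc n)) * Gamma (T - b + of_nat (Suc n)) * Gamma (T + a' + b' - c + of_nat (Suc n)))"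
      by (simp add: MSM_mellin_def rGamma_inverse_Gamma divide_inverse algebra_simps)
    also have "\<dots> = L n * ((E (T - a - b) * E (T + a' - c) * E (T + b' - c)) / (E (T - a) * E (T - b) * E (T + a' + b' - c)))"
      unfolding G L_def by (simp add: field_simps)
    also have "(E (T - a - b) * E (T + a' - c) * E (T + b' - c)) / (E (T - a) * E (T - b) * E (T + a' + b' - c)) = E (- c)"
      using Ec E(1) by (simp add: divide_eq_eq)
    finally show ?thesis by (simp add: E_def)
  qed
  ultimately show ?thesis by simp
qed

section \<open>Evaluation of the integral for all admissible parameters\<close>

lemma continuous_on_MSM_kernel:
  assumes c: "Re c > 0"
  shows "continuous_on {0<..} (MSM_kernel a a' b b' c T)"
    and "continuous_on {0..} (\<lambda>W. appell_F3 a a' b b' c (of_real (W / (1 + W))) (of_real (- W)))"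
proof -
  have *: "continuous_on (cut_plane \<times> cut_plane) (\<lambda>(X, Y). appell_F3 a a' b b' c X Y)"
    using appell_F3_is_continuation[OF c, of a a' b b'] by (simp add: appell_F3_continuation_def holomorphic2_on_def)
  have "continuous_on {0..} (\<lambda>W::real. W / (1 + W))" by (intro continuous_intros) auto
  hence **: "continuous_on {0..} (\<lambda>W. (complex_of_real (W / (1 + W)), complex_of_real (- W)))"
    by (intro continuous_on_Pair continuous_on_of_real continuous_on_minus continuous_on_id)
  have "continuous_on {0..} (\<lambda>W. (\<lambda>(X, Y). appell_F3 a a' b b' c X Y) (of_real (W / (1 + W)), of_real (- W)))"
    by (rule continuous_on_compose2[OF * **]) (use locus_in_cut_plane in auto)
  thus *: "continuous_on {0..} (\<lambda>W. appell_F3 a a' b b' c (of_real (W / (1 + W))) (of_real (- W)))"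
    by simp
  show "continuous_on {0<..} (MSM_kernel a a' b b' c T)"
    unfolding MSM_kernel_def
    by (intro continuous_intros continuous_on_subset[OF *]) auto
qed

lemma MSM_kernel_measurable [measurable]:
  assumes c: "Re c > 0"
  shows "MSM_kernel a a' b b' c T \<in> borel_measurable borel"
proof -
  have "(\<lambda>W. indicator {0<..} W *\<^sub>R MSM_kernel a a' b b' c T W) \<in> borel_measurable borel"
    by (intro borel_measurable_continuous_on_indicator continuous_on_MSM_kernel c) auto
  moreover have "(\<lambda>W. indicator {0<..} W *\<^sub>R MSM_kernel a a' b b' c T W) = MSM_kernel a a' b b' c T"
    by (auto simp: indicator_def)
  ultimately show ?thesis by simp
qed

definition MSM_formula ::
    "complex \<Rightarrow> complex \<Rightarrow> complex \<Rightarrow> complex \<Rightarrow> complex \<Rightarrow> complex \<Rightarrow> bool" where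
  "MSM_formula a a' b b' c T \<longleftrightarrow>
     has_bochner_integral lborel (MSM_kernel a a' b b' c T) (MSM_mellin a a' b b' c T)"

text \<open>The difference of the kernels at \<open>T\<close> and \<open>T + 1\<close> is \<open>W/(1 + W)\<close> times the kernel, and thus controls it for \<open>W \<ge> 1\<close>.
For \<open>W \<le> 1\<close> the kernel is \<open>W\<^bsup>c-1\<^esup>\<close> times a bounded function.\<close>
lemma MSM_kernel_integrable:
  assumes c: "Re c > 0"
    and diff: "integrable lborel (\<lambda>W. MSM_kernel a a' b b' c T W - MSM_kernel a a' b b' c (T + 1) W)"
  shows "integrable lborel (MSM_kernel a a' b b' c T)"
proof -
  let ?k = "MSM_kernel a a' b b' c T" and ?d = "\<lambda>W. MSM_kernel a a' b b' c T W - MSM_kernel a a' b b' c (T + 1) W"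
  let ?g = "\<lambda>W. ppow (- T) (1 + W) *
     (rGamma c * appell_F3 a a' b b' c (of_real (W / (1 + W))) (of_real (- W)))"
  have "continuous_on {0..1} ?g"
    by (intro continuous_intros continuous_on_subset[OF continuous_on_MSM_kernel(2)[OF c]]) auto
  hence "compact (?g ` {0..1})" by (intro compact_continuous_image) auto
  hence "bounded (?g ` {0..1})" by (rule compact_imp_bounded)
  then obtain B where B: "B > 0" "\<forall>z\<in>?g ` {0..1}. norm z \<le> B"
    unfolding bounded_pos by blast
  hence B': "norm (?g W) \<le> B" if "W \<in> {0..1}" for W using that by blast
  let ?\<beta> = "\<lambda>W. ppow (c - 1) W * ppow (1 - 1) (1 - W)"
  show ?thesis
  proof (rule Bochner_Integration.integrable_bound)
    show "integrable lborel (\<lambda>W. B * norm (?\<beta> W) + 2 * norm (?d W))"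
      using has_bochner_integral_Beta[of c 1] c diff
      by (intro Bochner_Integration.integrable_add integrable_mult_right integrable_norm) (auto simp: has_bochner_integral_iff)
    show "?k \<in> borel_measurable lborel" using MSM_kernel_measurable[OF c] by simp
    have bound: "norm (?k W) \<le> B * norm (?\<beta> W) + 2 * norm (?d W)" for W
    proof (cases "0 < W \<and> W < 1")
      case True
      have "norm (?k W) = norm (?g W) * norm (?\<beta> W)"
        using True by (simp add: MSM_kernel_def norm_mult ppow_zero mult_ac)
      also have "\<dots> \<le> B * norm (?\<beta> W)" using B'[of W] True by (intro mult_right_mono) auto
      finally show ?thesis by (simp add: add_increasing2)
    next
      case False
      show ?thesis
      proof (cases "W > 0")
        case True
        hence W: "W \<ge> 1" using False by simp
        have "norm (?d W) = \<bar>W / (1 + W)\<bar> * norm (?k W)"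
          unfolding MSM_kernel_raise_c(2)[OF c True] norm_mult norm_of_real ..
        moreover have "1 / 2 \<le> \<bar>W / (1 + W)\<bar>" using W by (simp add: field_simps)
        hence "1 / 2 * norm (?k W) \<le> \<bar>W / (1 + W)\<bar> * norm (?k W)" by (intro mult_right_mono) auto
        ultimately have "norm (?k W) \<le> 2 * norm (?d W)" by linarith
        moreover have "0 \<le> B * norm (?\<beta> W)" using B(1) by simp
        ultimately show ?thesis by linarith
      qed (use B in simp)
    qed
    show "AE W in lborel. norm (?k W) \<le> norm (B * norm (?\<beta> W) + 2 * norm (?d W))"
      unfolding real_norm_def by (intro AE_I2 order_trans[OF bound abs_ge_self])
  qed
qed

lemma MSM_kernel_shift:
  assumes "W > 0"
  shows "MSM_kernel a a' b b' c (T + of_nat n) W = MSM_kernel a a' b b' c T W * of_real ((1 / (1 + W)) ^ n)"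
proof -
  have "ppow (- (T + of_nat n)) (1 + W) = ppow (- T) (1 + W) * inverse (of_real (1 + W) ^ n)"
    using ppow_add[of "- T" "- of_nat n" "1 + W"] ppow_minus[of "of_nat n" "1 + W"] ppow_of_nat[of "1 + W" n] assms
    by simp
  thus ?thesis by (simp add: MSM_kernel_def power_one_over divide_inverse mult_ac flip: power_inverse)
qed

text \<open>The defect \<open>D\<close> of the formula does not change when \<open>T\<close> is increased by one, and it tends to zero: the integrals
by dominated convergence, as the kernel at \<open>T + n\<close> is the kernel at \<open>T\<close> times \<open>(1 + W)\<^bsup>-n\<^esup>\<close>, and the Gamma quotients
by \<open>MSM_mellin_tendsto_0\<close>.\<close>
lemma MSM_formula_periodic_defect:
  assumes adm: "MSM_admissible a a' b b' c T"
    and diff: "\<And>n. has_bochner_integral lborel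
       (\<lambda>W. MSM_kernel a a' b b' c (T + of_nat n) W - MSM_kernel a a' b b' c (T + of_nat n + 1) W)
       (MSM_mellin a a' b b' c (T + of_nat n) - MSM_mellin a a' b b' c (T + of_nat n + 1))"
  shows "MSM_formula a a' b b' c T"
proof -
  have c: "Re c > 0" using adm by (simp add: MSM_admissible_def)
  let ?k = "\<lambda>n. MSM_kernel a a' b b' c (T + of_nat n)"
  let ?M = "\<lambda>n. MSM_mellin a a' b b' c (T + of_nat n)"
  have int: "integrable lborel (?k n)" for n
    by (rule MSM_kernel_integrable[OF c]) (use diff[of n] in \<open>simp add: has_bochner_integral_iff\<close>)
  define D where "D = (\<lambda>n. integral\<^sup>L lborel (?k n) - ?M n)"
  have "D (Suc n) = D n" for n
  proof -
    have "integral\<^sup>L lborel (?k n) - integral\<^sup>L lborel (?k (Suc n)) = ?M n - ?M (Suc n)"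
      using diff[of n] int[of n] int[of "Suc n"] by (simp add: has_bochner_integral_iff add_ac)
    thus ?thesis by (simp add: D_def algebra_simps)
  qed
  hence const: "D n = D 0" for n by (induction n) simp_all
  \<comment> \<open>The decay of the quotient requires the three remaining Gamma arguments in the right half-plane, which holds
     after a shift of \<open>T\<close>.\<close>
  obtain N :: nat where N: "\<bar>Re (T - a)\<bar> + \<bar>Re (T - b)\<bar> + \<bar>Re (T + a' + b' - c)\<bar> < real N"
    using reals_Archimedean2 by blast
  have "(\<lambda>n. MSM_mellin a a' b b' c ((T + of_nat N) + of_nat (Suc n))) \<longlonglongrightarrow> 0"
    by (rule MSM_mellin_tendsto_0[OF c]) (use adm N in \<open>auto simp: MSM_admissible_def\<close>)
  hence "(\<lambda>n. ?M (n + Suc N)) \<longlonglongrightarrow> 0" by (simp add: add_ac)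
  hence M0: "?M \<longlonglongrightarrow> 0" by (rule LIMSEQ_offset)
  have "(\<lambda>n. integral\<^sup>L lborel (?k n)) \<longlonglongrightarrow> integral\<^sup>L lborel (\<lambda>_::real. 0 :: complex)"
  proof (rule integral_dominated_convergence)
    show "integrable lborel (\<lambda>W. norm (?k 0 W))" using int by (intro integrable_norm)
    show "?k n \<in> borel_measurable lborel" for n using MSM_kernel_measurable[OF c] by simp
    show "AE W in lborel. norm (?k n W) \<le> norm (?k 0 W)" for n
    proof (rule AE_I2)
      fix W :: real
      show "norm (?k n W) \<le> norm (?k 0 W)"
      proof (cases "W > 0")
        case True
        have "\<bar>1 / (1 + W)\<bar> ^ n \<le> 1" using True by (intro power_le_one) auto
        hence "norm (?k 0 W) * \<bar>1 / (1 + W)\<bar> ^ n \<le> norm (?k 0 W) * 1" by (intro mult_left_mono) auto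
        thus ?thesis
          unfolding MSM_kernel_shift[OF True, of a a' b b' c T n] norm_mult norm_of_real power_abs by simp
      qed simp
    qed
    show "AE W in lborel. (\<lambda>n. ?k n W) \<longlonglongrightarrow> 0"
    proof (rule AE_I2)
      fix W :: real
      show "(\<lambda>n. ?k n W) \<longlonglongrightarrow> 0"
      proof (cases "W > 0")
        case True
        have "(\<lambda>n. (1 / (1 + W)) ^ n) \<longlonglongrightarrow> 0" using True by (intro LIMSEQ_realpow_zero) auto
        hence "(\<lambda>n. MSM_kernel a a' b b' c T W * of_real ((1 / (1 + W)) ^ n)) \<longlonglongrightarrow> MSM_kernel a a' b b' c T W * of_real 0"
          by (intro tendsto_mult tendsto_const tendsto_of_real)
        thus ?thesis unfolding MSM_kernel_shift[OF True] by simp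
      qed simp
    qed
  qed simp
  hence lim: "D \<longlonglongrightarrow> 0 - 0" unfolding D_def by (intro tendsto_diff M0) simp
  have "D = (\<lambda>_. D 0)" by (rule ext) (rule const)
  from lim have "(\<lambda>_::nat. D 0) \<longlonglongrightarrow> 0 - 0" by (subst (asm) \<open>D = (\<lambda>_. D 0)\<close>)
  hence "D 0 = 0" by (simp add: LIMSEQ_const_iff)
  thus ?thesis using int[of 0] by (simp add: D_def MSM_formula_def has_bochner_integral_iff)
qed

lemma MSM_formula_pos:
  assumes "MSM_admissible a a' b b' c T" "Re b > 0" "Re b' > 0"
  shows "MSM_formula a a' b b' c T"
proof -
  have "MSM_formula a a' b b' c T"
    if "MSM_admissible a a' b b' c T" "Re b > 0" "Re b' > 0" "Re (c - b - b') + real N > 0" for N a a' b b' c T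
    using that
  proof (induction N arbitrary: a a' b b' c T)
    case 0
    thus ?case using MSM_kernel_base by (simp add: MSM_formula_def)
  next
    case (Suc N)
    show ?case
    proof (rule MSM_formula_periodic_defect[OF Suc.prems(1)])
      fix n
      let ?T = "T + of_nat n"
      have c: "Re c > 0" and adm: "MSM_admissible a a' b b' c ?T"
        using Suc.prems(1) by (auto simp: MSM_admissible_def)
      have "MSM_formula a a' b b' (c + 1) (?T + 1)" "MSM_formula (a + 1) a' (b + 1) b' (c + 2) (?T + 2)"
           "MSM_formula a (a' + 1) b (b' + 1) (c + 2) (?T + 1)"
        by (intro Suc.IH; use Suc.prems in \<open>simp add: MSM_admissible_def\<close>)+
      thus "has_bochner_integral lborel
          (\<lambda>W. MSM_kernel a a' b b' c ?T W - MSM_kernel a a' b b' c (?T + 1) W)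
          (MSM_mellin a a' b b' c ?T - MSM_mellin a a' b b' c (?T + 1))"
        unfolding MSM_kernel_raise_c(1)[OF c] MSM_mellin_raise_c[OF adm] MSM_formula_def
        by (intro has_bochner_integral_add has_bochner_integral_diff has_bochner_integral_mult_right)
    qed
  qed
  moreover obtain N :: nat where "- Re (c - b - b') < real N" using reals_Archimedean2 by blast
  hence "Re (c - b - b') + real N > 0" by linarith
  ultimately show ?thesis using assms by blast
qed

lemma MSM_formula_pos_b':
  assumes "MSM_admissible a a' b b' c T" "Re b' > 0"
  shows "MSM_formula a a' b b' c T"
proof -
  have "MSM_formula a a' b b' c T"
    if "MSM_admissible a a' b b' c T" "Re b' > 0" "Re b + real N > 0" for N a a' b b' c T
    using that
  proof (induction N arbitrary: a a' b b' c T)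
    case 0
    thus ?case using MSM_formula_pos by simp
  next
    case (Suc N)
    have c: "Re c > 0" using Suc.prems(1) by (simp add: MSM_admissible_def)
    have "MSM_formula a a' (b + 1) b' c (T + 1)" "MSM_formula a a' (b + 1) b' (c + 1) (T + 1)"
        "MSM_formula a (a' + 1) (b + 1) (b' + 1) (c + 2) (T + 1)"
      by (intro Suc.IH; use Suc.prems in \<open>simp add: MSM_admissible_def\<close>)+
    hence "has_bochner_integral lborel (\<lambda>W. MSM_kernel a a' b b' c T W) (MSM_mellin a a' b b' c T)"
      unfolding MSM_formula_def
      by (subst MSM_kernel_raise_b[OF c], subst MSM_mellin_raise_b[OF Suc.prems(1)])
         (intro has_bochner_integral_add has_bochner_integral_diff has_bochner_integral_mult_right)
    thus ?case by (simp add: MSM_formula_def)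
  qed
  moreover obtain N :: nat where "- Re b < real N" using reals_Archimedean2 by blast
  hence "Re b + real N > 0" by linarith
  ultimately show ?thesis using assms by blast
qed

text \<open>Admissibility is preserved by all three relations: although \<open>c\<close> and \<open>a + b\<close> may increase by up to two, \<open>T\<close>, \<open>a'\<close> and
\<open>b'\<close> increase along with them.\<close>
theorem MSM_kernel_integral:
  assumes "MSM_admissible a a' b b' c T"
  shows "MSM_formula a a' b b' c T"
proof -
  have "MSM_formula a a' b b' c T"
    if "MSM_admissible a a' b b' c T" "Re b' + real N > 0" for N a a' b b' c T
    using that
  proof (induction N arbitrary: a a' b b' c T)
    case 0
    thus ?case using MSM_formula_pos_b' by simp
  next
    case (Suc N)
    have c: "Re c > 0" using Suc.prems(1) by (simp add: MSM_admissible_def)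
    have "MSM_formula a a' b (b' + 1) c T" "MSM_formula a (a' + 1) b (b' + 1) (c + 1) T"
      by (intro Suc.IH; use Suc.prems in \<open>simp add: MSM_admissible_def\<close>)+
    hence "has_bochner_integral lborel (\<lambda>W. MSM_kernel a a' b b' c T W) (MSM_mellin a a' b b' c T)"
      unfolding MSM_formula_def
      by (subst MSM_kernel_raise_b'[OF c], subst MSM_mellin_raise_b'[OF Suc.prems(1)])
         (intro has_bochner_integral_add has_bochner_integral_mult_right)
    thus ?case by (simp add: MSM_formula_def)
  qed
  moreover obtain N :: nat where "- Re b' < real N" using reals_Archimedean2 by blast
  hence "Re b' + real N > 0" by linarith
  ultimately show ?thesis using assms by blast
qed

section \<open>Fractional integrals of powers and of Jacobi type polynomials\<close>

lemma MSM_integrand_power: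
  assumes adm: "MSM_admissible \<delta> \<delta>' \<mu> \<mu>' \<epsilon> (\<delta> + \<tau>)" and x: "x > 0"
  shows "has_bochner_integral lborel
     (\<lambda>t. indicator {x<..} t *\<^sub>R MSM_integrand \<delta> \<delta>' \<mu> \<mu>' \<epsilon> (\<lambda>t. of_real t powr (- \<tau>)) x t)
     (of_real x powr (\<epsilon> - \<delta> - \<tau>) * Gamma \<epsilon> * MSM_mellin \<delta> \<delta>' \<mu> \<mu>' \<epsilon> (\<delta> + \<tau>))"
    (is "has_bochner_integral _ ?g ?v")
proof -
  let ?C = "ppow (\<epsilon> - 1 - \<delta> - \<tau>) x * Gamma \<epsilon>"
  have "Re \<epsilon> > 0" using adm by (simp add: MSM_admissible_def)
  hence Gam: "Gamma \<epsilon> * rGamma \<epsilon> = 1"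
    using Gamma_nonzero_of_Re_pos[of \<epsilon>] by (simp add: rGamma_inverse_Gamma)
  have "has_bochner_integral lborel (\<lambda>W. ?C * MSM_kernel \<delta> \<delta>' \<mu> \<mu>' \<epsilon> (\<delta> + \<tau>) W)
          (?C * MSM_mellin \<delta> \<delta>' \<mu> \<mu>' \<epsilon> (\<delta> + \<tau>))"
    using MSM_kernel_integral[OF adm] unfolding MSM_formula_def
    by (rule has_bochner_integral_mult_right)
  moreover have "?C * MSM_kernel \<delta> \<delta>' \<mu> \<mu>' \<epsilon> (\<delta> + \<tau>) W = ?g (x + x * W)" for W
  proof (cases "W > 0")
    case W: True
    have xW: "x * W > 0" "1 + W > 0" "x * (1 + W) > 0" using W x by auto
    have args: "1 - x / (x + x * W) = W / (1 + W)" "1 - (x + x * W) / x = - W"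
      using x W xW(3) by (simp_all add: field_simps)
    have "?g (x + x * W) = ppow (\<epsilon> - 1) (x * W) * ppow (- \<delta>) (x * (1 + W)) *
        appell_F3 \<delta> \<delta>' \<mu> \<mu>' \<epsilon> (of_real (W / (1 + W))) (of_real (- W)) * ppow (- \<tau>) (x * (1 + W))"
    proof -
      have "x * (1 + W) = x + x * W" by (simp add: algebra_simps)
      thus ?thesis using xW unfolding MSM_integrand_def args by (simp add: ppow_def)
    qed
    also have "\<dots> = (ppow (\<epsilon> - 1) x * ppow (- \<delta>) x * ppow (- \<tau>) x) * (ppow (- \<delta>) (1 + W) * ppow (- \<tau>) (1 + W)) *
        (ppow (\<epsilon> - 1) W * appell_F3 \<delta> \<delta>' \<mu> \<mu>' \<epsilon> (of_real (W / (1 + W))) (of_real (- W)))"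
      using x W xW by (simp only: ppow_mult mult_ac)
    also have "ppow (- \<delta>) (1 + W) * ppow (- \<tau>) (1 + W) = ppow (- (\<delta> + \<tau>)) (1 + W)"
      by (simp flip: ppow_add)
    also have "ppow (\<epsilon> - 1) x * ppow (- \<delta>) x * ppow (- \<tau>) x = ppow (\<epsilon> - 1 - \<delta> - \<tau>) x"
      by (simp flip: ppow_add)
    also have "\<dots> * ppow (- (\<delta> + \<tau>)) (1 + W) * (ppow (\<epsilon> - 1) W *
          appell_F3 \<delta> \<delta>' \<mu> \<mu>' \<epsilon> (of_real (W / (1 + W))) (of_real (- W))) =
        (Gamma \<epsilon> * rGamma \<epsilon>) * (\<dots> * ppow (- (\<delta> + \<tau>)) (1 + W) * (ppow (\<epsilon> - 1) W *
          appell_F3 \<delta> \<delta>' \<mu> \<mu>' \<epsilon> (of_real (W / (1 + W))) (of_real (- W))))"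
      by (simp add: Gam)
    also have "\<dots> = ?C * MSM_kernel \<delta> \<delta>' \<mu> \<mu>' \<epsilon> (\<delta> + \<tau>) W"
      unfolding MSM_kernel_def by (simp only: mult_ac)
    finally show ?thesis ..
  next
    case False
    hence "x * W \<le> 0" using x by (intro mult_nonneg_nonpos) auto
    thus ?thesis using False by (simp add: indicator_def)
  qed
  moreover have "?C * MSM_mellin \<delta> \<delta>' \<mu> \<mu>' \<epsilon> (\<delta> + \<tau>) = ?v /\<^sub>R \<bar>x\<bar>"
  proof -
    have "of_real x powr (\<epsilon> - \<delta> - \<tau>) = of_real x * ppow (\<epsilon> - 1 - \<delta> - \<tau>) x"
      using ppow_plus_1[OF x, of "\<epsilon> - 1 - \<delta> - \<tau>"] x by (simp add: ppow_def algebra_simps)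
    thus ?thesis using x by (simp add: scaleR_conv_of_real)
  qed
  ultimately have "has_bochner_integral lborel (\<lambda>W. ?g (x + x * W)) (?v /\<^sub>R \<bar>x\<bar>)" by simp
  thus ?thesis
    by (rule lborel_has_bochner_integral_real_affine_iff[THEN iffD2, rotated]) (use x in simp)
qed

lemma Gamma_add_of_nat: "z \<notin> \<int>\<^sub>\<le>\<^sub>0 \<Longrightarrow> Gamma (z + of_nat k) = pochhammer z k * Gamma z" for z :: complex
  by (simp add: pochhammer_Gamma Gamma_eq_zero_iff)

lemma rGamma_add_of_nat: "z \<notin> \<int>\<^sub>\<le>\<^sub>0 \<Longrightarrow> rGamma (z + of_nat k) = rGamma z / pochhammer z k" for z :: complex
  by (simp add: rGamma_inverse_Gamma Gamma_add_of_nat field_simps)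

lemma MSM_mellin_add_of_nat:
  assumes "MSM_admissible a a' b b' c T"
    and "T - a \<notin> \<int>\<^sub>\<le>\<^sub>0" "T - b \<notin> \<int>\<^sub>\<le>\<^sub>0" "T + a' + b' - c \<notin> \<int>\<^sub>\<le>\<^sub>0"
  shows "MSM_mellin a a' b b' c (T + of_nat k) = MSM_mellin a a' b b' c T *
     (pochhammer (T - a - b) k * pochhammer (T + a' - c) k * pochhammer (T + b' - c) k /
      (pochhammer (T - a) k * pochhammer (T - b) k * pochhammer (T + a' + b' - c) k))"
proof -
  have "T - a - b \<notin> \<int>\<^sub>\<le>\<^sub>0" "T + a' - c \<notin> \<int>\<^sub>\<le>\<^sub>0" "T + b' - c \<notin> \<int>\<^sub>\<le>\<^sub>0"
    using assms(1) by (auto simp: MSM_admissible_def intro!: not_nonpos_Int_of_Re_pos)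
  note G = this[THEN Gamma_add_of_nat, of k] assms(2-4)[THEN rGamma_add_of_nat, of k]
  have "T + of_nat k - a - b = (T - a - b) + of_nat k" "T + of_nat k + a' - c = (T + a' - c) + of_nat k"
     "T + of_nat k + b' - c = (T + b' - c) + of_nat k" "T + of_nat k - a = (T - a) + of_nat k"
     "T + of_nat k - b = (T - b) + of_nat k" "T + of_nat k + a' + b' - c = (T + a' + b' - c) + of_nat k"
    by (simp_all add: algebra_simps)
  hence "MSM_mellin a a' b b' c (T + of_nat k) = Gamma ((T - a - b) + of_nat k) * Gamma ((T + a' - c) + of_nat k) *
      Gamma ((T + b' - c) + of_nat k) * rGamma ((T - a) + of_nat k) * rGamma ((T - b) + of_nat k) *
      rGamma ((T + a' + b' - c) + of_nat k)"
    by (simp only: MSM_mellin_def)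
  thus ?thesis unfolding G by (simp add: MSM_mellin_def mult_ac)
qed

lemma pochhammer_minus_of_nat:
  assumes "k \<le> n"
  shows "pochhammer (- of_nat n :: complex) k = (-1) ^ k * fact n / fact (n - k)"
proof -
  have "(fact n :: complex) = pochhammer 1 ((n - k) + k)" using assms by (simp add: pochhammer_fact)
  also have "\<dots> = fact (n - k) * pochhammer (of_nat n - of_nat k + 1) k"
    unfolding pochhammer_product' using assms by (simp add: pochhammer_fact of_nat_diff algebra_simps)
  finally show ?thesis by (simp add: pochhammer_minus)
qed

text \<open>The hypothesis on \<open>q\<close> excludes exactly the poles of \<open>\<Gamma>(q + 1)\<close>, so that \<open>\<Gamma>(q + n + 1) / \<Gamma>(q + 1)\<close> can be split
at \<open>k\<close> into Pochhammer symbols.\<close>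
lemma jacobi_M_coeff:
  fixes p q :: complex
  assumes q: "\<And>m::nat. m \<ge> 1 \<Longrightarrow> q \<noteq> - of_nat m" and k: "k \<le> n"
  shows "(-1) ^ n * fact n * ((p - of_nat n - 1) gchoose k) * ((q + of_nat n) gchoose (n - k)) =
     (-1) ^ n * Gamma (q + of_nat n + 1) / Gamma (q + 1) *
       (pochhammer (1 + of_nat n - p) k * pochhammer (- of_nat n) k / (pochhammer (1 + q) k * fact k))"
proof -
  have q1: "q + 1 \<notin> \<int>\<^sub>\<le>\<^sub>0"
  proof
    assume "q + 1 \<in> \<int>\<^sub>\<le>\<^sub>0"
    then obtain m where "q + 1 = - of_nat m" by (elim nonpos_Ints_cases')
    hence "q = - of_nat (Suc m)" by (simp add: algebra_simps eq_neg_iff_add_eq_0)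
    thus False using q[of "Suc m"] by simp
  qed
  have nz: "pochhammer (1 + q) k \<noteq> 0" "Gamma (q + 1) \<noteq> 0"
    using q1 by (auto simp: Gamma_eq_zero_iff add.commute[of 1] dest: pochhammer_eq_0_imp_nonpos_Int)
  have "Gamma (q + of_nat n + 1) = pochhammer (1 + q) n * Gamma (q + 1)"
    using Gamma_add_of_nat[OF q1, of n] by (simp add: add_ac)
  also have "pochhammer (1 + q) n = pochhammer (1 + q) k * pochhammer (1 + q + of_nat k) (n - k)"
    using k by (rule pochhammer_product)
  finally have G: "Gamma (q + of_nat n + 1) = pochhammer (1 + q) k * pochhammer (1 + q + of_nat k) (n - k) * Gamma (q + 1)" .
  have B: "(q + of_nat n) gchoose (n - k) = pochhammer (1 + q + of_nat k) (n - k) / fact (n - k)"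
    using k by (simp add: gbinomial_pochhammer' of_nat_diff algebra_simps)
  have A: "(p - of_nat n - 1) gchoose k = (-1) ^ k * pochhammer (1 + of_nat n - p) k / fact k"
    by (simp add: gbinomial_pochhammer algebra_simps)
  show ?thesis
    unfolding A B G pochhammer_minus_of_nat[OF k] using nz by (simp add: mult_ac)
qed

theorem theorem2:
  fixes n :: nat and p q \<delta> \<delta>' \<mu> \<mu>' \<epsilon> \<tau> :: complex and x :: real
  assumes q: "\<And>m::nat. m \<ge> 1 \<Longrightarrow> q \<noteq> - of_nat m"
    and eps: "Re \<epsilon> > 0"
    and tau: "Re \<tau> > Max {Re \<mu>, Re (- \<delta> - \<delta>' + \<epsilon>), Re (- \<delta> - \<mu>' + \<epsilon>)}"
    and "\<tau> \<notin> \<int>\<^sub>\<le>\<^sub>0"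
    and "\<delta> - \<mu> + \<tau> \<notin> \<int>\<^sub>\<le>\<^sub>0"
    and "\<delta> + \<delta>' + \<mu>' - \<epsilon> + \<tau> \<notin> \<int>\<^sub>\<le>\<^sub>0"
    and x: "x > 0"
  shows "MSM_right_exists \<delta> \<delta>' \<mu> \<mu>' \<epsilon>
      (\<lambda>t. of_real t powr (- \<tau>) * jacobi_M n p q (of_real (1 / t))) x \<and>
    MSM_right \<delta> \<delta>' \<mu> \<mu>' \<epsilon>
      (\<lambda>t. of_real t powr (- \<tau>) * jacobi_M n p q (of_real (1 / t))) x =
      of_real x powr (- \<delta> - \<delta>' + \<epsilon> - \<tau>) *
      ((- 1) ^ n * Gamma (q + of_nat n + 1) * Gamma (\<tau> - \<mu>) *
         Gamma (\<delta> + \<delta>' - \<epsilon> + \<tau>) * Gamma (\<delta> + \<mu>' - \<epsilon> + \<tau>) /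
       (Gamma \<tau> * Gamma (q + 1) * Gamma (\<delta> - \<mu> + \<tau>) * Gamma (\<delta> + \<delta>' + \<mu>' - \<epsilon> + \<tau>))) *
      hypergeo
        [1 + of_nat n - p, - of_nat n, - \<mu> + \<tau>, \<delta> + \<delta>' - \<epsilon> + \<tau>, \<delta> + \<mu>' - \<epsilon> + \<tau>]
        [1 + q, \<tau>, \<delta> - \<mu> + \<tau>, \<delta> + \<delta>' + \<mu>' - \<epsilon> + \<tau>]
        (of_real (- 1 / x))"
proof -
  let ?f = "\<lambda>t. of_real t powr (- \<tau>) * jacobi_M n p q (of_real (1 / t))"
  define T where "T = \<delta> + \<tau>"
  define J where "J = (\<lambda>k. (-1) ^ n * fact n * ((p - of_nat n - 1) gchoose k) * ((q + of_nat n) gchoose (n - k)))"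
  define M where "M = (\<lambda>k. MSM_mellin \<delta> \<delta>' \<mu> \<mu>' \<epsilon> (T + of_nat k))"
  define h where "h = (\<lambda>k t. indicator {x<..} t *\<^sub>R
      MSM_integrand \<delta> \<delta>' \<mu> \<mu>' \<epsilon> (\<lambda>t. of_real t powr (- (\<tau> + of_nat k))) x t)"
  have adm: "MSM_admissible \<delta> \<delta>' \<mu> \<mu>' \<epsilon> (T + of_nat k)" for k
    using eps tau by (simp add: MSM_admissible_def T_def)
  have h: "has_bochner_integral lborel (h k) (of_real x powr (\<epsilon> - T - of_nat k) * Gamma \<epsilon> * M k)" for k
    using MSM_integrand_power[of \<delta> \<delta>' \<mu> \<mu>' \<epsilon> "\<tau> + of_nat k" x] adm[of k] x
    by (simp add: h_def M_def T_def algebra_simps)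
  have expand: "indicator {x<..} t *\<^sub>R MSM_integrand \<delta> \<delta>' \<mu> \<mu>' \<epsilon> ?f x t = (\<Sum>k\<le>n. (J k * (-1) ^ k) * h k t)" for t
  proof (cases "t > x")
    case True
    hence t: "t > 0" using x by simp
    have "of_real t powr (- (\<tau> + of_nat k)) = of_real t powr (- \<tau>) * of_real (1 / t) ^ k" for k
    proof -
      have "of_real t powr (- of_nat k) = complex_of_real (1 / t) ^ k"
        using t by (simp add: powr_minus powr_nat' power_one_over divide_inverse power_inverse)
      thus ?thesis using powr_add[of "complex_of_real t" "- \<tau>" "- of_nat k"] by simp
    qed
    moreover have "jacobi_M n p q (of_real (1 / t)) = (\<Sum>k\<le>n. (J k * (-1) ^ k) * of_real (1 / t) ^ k)"
    proof -
      have "(- complex_of_real (1 / t)) ^ k = (-1) ^ k * of_real (1 / t) ^ k" for k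
        by (rule power_minus)
      thus ?thesis unfolding jacobi_M_def J_def sum_distrib_left by (simp only: mult_ac)
    qed
    ultimately show ?thesis
      using True by (simp add: h_def MSM_integrand_def sum_distrib_left mult_ac del: of_real_divide)
  qed (simp add: h_def)
  let ?I = "\<Sum>k\<le>n. (J k * (-1) ^ k) * (of_real x powr (\<epsilon> - T - of_nat k) * Gamma \<epsilon> * M k)"
  have "has_bochner_integral lborel (\<lambda>t. indicator {x<..} t *\<^sub>R MSM_integrand \<delta> \<delta>' \<mu> \<mu>' \<epsilon> ?f x t) ?I"
    unfolding expand by (intro has_bochner_integral_sum has_bochner_integral_mult_right h)
  hence "MSM_right_exists \<delta> \<delta>' \<mu> \<mu>' \<epsilon> ?f x" and int: "(LINT t:{x<..}|lborel. MSM_integrand \<delta> \<delta>' \<mu> \<mu>' \<epsilon> ?f x t) = ?I"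
    by (auto simp: MSM_right_exists_def set_integrable_def set_lebesgue_integral_def has_bochner_integral_iff)
  moreover have "MSM_right \<delta> \<delta>' \<mu> \<mu>' \<epsilon> ?f x =
      of_real x powr (- \<delta> - \<delta>' + \<epsilon> - \<tau>) *
      ((- 1) ^ n * Gamma (q + of_nat n + 1) * Gamma (\<tau> - \<mu>) *
         Gamma (\<delta> + \<delta>' - \<epsilon> + \<tau>) * Gamma (\<delta> + \<mu>' - \<epsilon> + \<tau>) /
       (Gamma \<tau> * Gamma (q + 1) * Gamma (\<delta> - \<mu> + \<tau>) * Gamma (\<delta> + \<delta>' + \<mu>' - \<epsilon> + \<tau>))) *
      hypergeo
        [1 + of_nat n - p, - of_nat n, - \<mu> + \<tau>, \<delta> + \<delta>' - \<epsilon> + \<tau>, \<delta> + \<mu>' - \<epsilon> + \<tau>]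
        [1 + q, \<tau>, \<delta> - \<mu> + \<tau>, \<delta> + \<delta>' + \<mu>' - \<epsilon> + \<tau>]
        (of_real (- 1 / x))" (is "_ = ?X * ?G * ?H")
  proof -
    let ?Q = "(-1) ^ n * Gamma (q + of_nat n + 1) / Gamma (q + 1)"
    define R where "R = (\<lambda>k. pochhammer (1 + of_nat n - p) k * pochhammer (- of_nat n) k / (pochhammer (1 + q) k * fact k))"
    define S where "S = (\<lambda>k. pochhammer (- \<mu> + \<tau>) k * pochhammer (\<delta> + \<delta>' - \<epsilon> + \<tau>) k * pochhammer (\<delta> + \<mu>' - \<epsilon> + \<tau>) k /
        (pochhammer \<tau> k * pochhammer (\<delta> - \<mu> + \<tau>) k * pochhammer (\<delta> + \<delta>' + \<mu>' - \<epsilon> + \<tau>) k))"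
    have args: "T - \<delta> - \<mu> = - \<mu> + \<tau>" "T + \<delta>' - \<epsilon> = \<delta> + \<delta>' - \<epsilon> + \<tau>" "T + \<mu>' - \<epsilon> = \<delta> + \<mu>' - \<epsilon> + \<tau>"
        "T - \<delta> = \<tau>" "T - \<mu> = \<delta> - \<mu> + \<tau>" "T + \<delta>' + \<mu>' - \<epsilon> = \<delta> + \<delta>' + \<mu>' - \<epsilon> + \<tau>"
      by (simp_all add: T_def)
    have Gam: "Gamma \<epsilon> \<noteq> 0" using eps by (rule Gamma_nonzero_of_Re_pos)
    have M: "M k = M 0 * S k" for k
      using MSM_mellin_add_of_nat[of \<delta> \<delta>' \<mu> \<mu>' \<epsilon> T k] adm[of 0] assms(4-6)
      unfolding args by (simp add: M_def S_def)
    have J: "J k = ?Q * R k" if "k \<le> n" for k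
      unfolding J_def R_def by (rule jacobi_M_coeff[OF q that])
    have X: "of_real x powr (- \<delta>') * of_real x powr (\<epsilon> - T - of_nat k) = ?X * of_real (1 / x) ^ k" for k
    proof -
      have "of_real x powr (- of_nat k) = complex_of_real (1 / x) ^ k"
        using x by (simp add: powr_minus powr_nat' power_one_over divide_inverse power_inverse)
      moreover have "- \<delta>' + (\<epsilon> - T - of_nat k) = (- \<delta> - \<delta>' + \<epsilon> - \<tau>) + (- of_nat k)"
        by (simp add: T_def)
      ultimately show ?thesis by (metis powr_add)
    qed
    have "MSM_right \<delta> \<delta>' \<mu> \<mu>' \<epsilon> ?f x =
        (\<Sum>k\<le>n. (J k * (-1) ^ k) * ((of_real x powr (- \<delta>') * of_real x powr (\<epsilon> - T - of_nat k)) * M k))"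
      unfolding MSM_right_def int sum_distrib_left using Gam by (intro sum.cong refl) (simp add: mult_ac)
    also have "\<dots> = (\<Sum>k\<le>n. ?X * (?Q * M 0) * (R k * S k * ((-1) ^ k * of_real (1 / x) ^ k)))"
    proof (rule sum.cong[OF refl])
      fix k assume "k \<in> {..n}"
      hence k: "k \<le> n" by simp
      show "(J k * (-1) ^ k) * ((of_real x powr (- \<delta>') * of_real x powr (\<epsilon> - T - of_nat k)) * M k) =
          ?X * (?Q * M 0) * (R k * S k * ((-1) ^ k * of_real (1 / x) ^ k))"
        unfolding X J[OF k] by (subst M[of k]) (simp only: mult_ac)
    qed
    also have "\<dots> = ?X * (?Q * M 0) * (\<Sum>k\<le>n. R k * S k * ((-1) ^ k * of_real (1 / x) ^ k))"
      by (simp only: sum_distrib_left)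
    also have "?Q * M 0 = ?G"
      unfolding M_def of_nat_0 add_0_right MSM_mellin_def args by (simp add: rGamma_inverse_Gamma divide_inverse mult_ac)
    also have "(\<Sum>k\<le>n. R k * S k * ((-1) ^ k * of_real (1 / x) ^ k)) = ?H"
    proof -
      have "(complex_of_real (- 1 / x)) ^ k = (-1) ^ k * of_real (1 / x) ^ k" for k
        using power_minus[of "complex_of_real (1 / x)" k] by simp
      thus ?thesis
        using hypergeo_terminating[of "[1 + of_nat n - p]" n
            "[- \<mu> + \<tau>, \<delta> + \<delta>' - \<epsilon> + \<tau>, \<delta> + \<mu>' - \<epsilon> + \<tau>]"]
        by (simp add: R_def S_def mult_ac)
    qed
    finally show ?thesis .
  qed
  ultimately show ?thesis by blast
qed

end
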